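(* Let $R$ be a commutative ring with unit and let $I\subseteq R$ be an ideal generated by a finite regular sequence. Then for every integer $s\geq 0$, the short exact sequence of $R$-modules $$0 \longrightarrow I^{s+1} \longrightarrow I^s \longrightarrow I^s/I^{s+1} \longrightarrow 0$$ (inclusion and canonical projection, with $I^0=R$) induces a short exact sequence of graded free $R/I$-modules $$0 \to \operatorname{Tor}_*^R(R/I, I^s) \to \operatorname{Tor}_*^R(R/I, I^s/I^{s+1}) \to \operatorname{Tor}_{*-1}^R(R/I, I^{s+1}) \to 0.$$ Here the first map is induced by the projection $I^s\to I^s/I^{s+1}$ and the second map is the connecting homomorphism of the given short exact sequence. That is, the sequence is exact in every degree, and all its terms are free $R/I$-modules in every degree.
   Context: All rings are commutative with unit. $\operatorname{Tor}_{*-1}^R(-,-)$ denotes the graded module whose degree $k$ component is $\operatorname{Tor}_{k-1}^R(-,-)$, with $\operatorname{Tor}_{-1}^R=0$. *)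

theory Defs
  imports "HOL-Algebra.Ideal_Product" "HOL-Algebra.QuotRing" "HOL-Algebra.Module"
begin

text \<open>
  A module in HOL-Algebra is a record that extends the ring record; its multiplicative fields
  (\<open>mult\<close>, \<open>one\<close>) play no role in \<^locale>\<open>module\<close> and are left \<^const>\<open>undefined\<close> throughout.
\<close>

section \<open>Modules\<close>

definition module_homs ::
  "('a, 'm) ring_scheme \<Rightarrow> ('a, 'b, 'n) module_scheme \<Rightarrow> ('a, 'c, 'k) module_scheme \<Rightarrow> ('b \<Rightarrow> 'c) set"
  where "module_homs R M N = {f \<in> carrier M \<rightarrow> carrier N.
     (\<forall>x\<in>carrier M. \<forall>y\<in>carrier M. f (x \<oplus>\<^bsub>M\<^esub> y) = f x \<oplus>\<^bsub>N\<^esub> f y) \<and>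
     (\<forall>a\<in>carrier R. \<forall>x\<in>carrier M. f (a \<odot>\<^bsub>M\<^esub> x) = a \<odot>\<^bsub>N\<^esub> f x)}"

definition short_exact ::
  "('a, 'm) ring_scheme \<Rightarrow> ('a, 'b, 'k) module_scheme \<Rightarrow> ('a, 'c, 'l) module_scheme \<Rightarrow>
   ('a, 'd, 'n) module_scheme \<Rightarrow> ('b \<Rightarrow> 'c) \<Rightarrow> ('c \<Rightarrow> 'd) \<Rightarrow> bool"
  where "short_exact R L M N f g \<longleftrightarrow>
     module R L \<and> module R M \<and> module R N \<and>
     f \<in> module_homs R L M \<and> g \<in> module_homs R M N \<and>
     inj_on f (carrier L) \<and> f ` carrier L = a_kernel M N g \<and> g ` carrier M = carrier N"

definition ideal_module :: "('a, 'm) ring_scheme \<Rightarrow> 'a set \<Rightarrow> ('a, 'a) module"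
  where "ideal_module R J = \<lparr>carrier = J, mult = undefined, one = undefined,
     zero = \<zero>\<^bsub>R\<^esub>, add = add R, smult = mult R\<rparr>"

definition quot_module :: "('a, 'b, 'n) module_scheme \<Rightarrow> 'b set \<Rightarrow> ('a, 'b set) module"
  where "quot_module M N = \<lparr>carrier = a_rcosets\<^bsub>M\<^esub> N, mult = undefined, one = undefined,
     zero = N, add = set_add M, smult = (\<lambda>a X. \<Union>x\<in>X. N +>\<^bsub>M\<^esub> (a \<odot>\<^bsub>M\<^esub> x))\<rparr>"

definition submodule_generated ::
  "('a, 'm) ring_scheme \<Rightarrow> ('a, 'b, 'n) module_scheme \<Rightarrow> 'b set \<Rightarrow> 'b set"
  where "submodule_generated R M A = \<Inter>{H. submodule H R M \<and> A \<subseteq> H}"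

definition free_on :: "('a, 'm) ring_scheme \<Rightarrow> 's set \<Rightarrow> ('a, 's \<Rightarrow> 'a) module"
  where "free_on R S = \<lparr>
     carrier = {\<phi>. range \<phi> \<subseteq> carrier R \<and> finite {s. \<phi> s \<noteq> \<zero>\<^bsub>R\<^esub>} \<and> {s. \<phi> s \<noteq> \<zero>\<^bsub>R\<^esub>} \<subseteq> S},
     mult = undefined, one = undefined,
     zero = (\<lambda>_. \<zero>\<^bsub>R\<^esub>), add = (\<lambda>\<phi> \<psi> s. \<phi> s \<oplus>\<^bsub>R\<^esub> \<psi> s), smult = (\<lambda>a \<phi> s. a \<otimes>\<^bsub>R\<^esub> \<phi> s)\<rparr>"

definition single :: "('a, 'm) ring_scheme \<Rightarrow> 's \<Rightarrow> 's \<Rightarrow> 'a"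
  where "single R s = (\<lambda>t. if t = s then \<one>\<^bsub>R\<^esub> else \<zero>\<^bsub>R\<^esub>)"

text \<open>The linear map from the free module to \<open>M\<close> that sends the basis element \<open>s\<close> to \<open>h s\<close>.\<close>

definition lin_ext ::
  "('a, 'm) ring_scheme \<Rightarrow> ('a, 'b, 'n) module_scheme \<Rightarrow> ('s \<Rightarrow> 'b) \<Rightarrow> ('s \<Rightarrow> 'a) \<Rightarrow> 'b"
  where "lin_ext R M h \<phi> = (\<Oplus>\<^bsub>M\<^esub>s\<in>{s. \<phi> s \<noteq> \<zero>\<^bsub>R\<^esub>}. \<phi> s \<odot>\<^bsub>M\<^esub> h s)"

definition is_basis ::
  "('a, 'm) ring_scheme \<Rightarrow> ('a, 'b, 'n) module_scheme \<Rightarrow> 'b set \<Rightarrow> bool"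
  where "is_basis R M B \<longleftrightarrow> B \<subseteq> carrier M \<and>
     (\<forall>x\<in>carrier M. \<exists>!c. c \<in> carrier (free_on R B) \<and> lin_ext R M (\<lambda>b. b) c = x)"

definition free_module :: "('a, 'm) ring_scheme \<Rightarrow> ('a, 'b, 'n) module_scheme \<Rightarrow> bool"
  where "free_module R M \<longleftrightarrow> module R M \<and> (\<exists>B. is_basis R M B)"

text \<open>
  \<open>M\<close> is a direct summand of a free module. It suffices to split the canonical surjection from
  the free module on the elements of \<open>M\<close>, which avoids an existential quantifier over types.
\<close>

definition projective_module :: "('a, 'm) ring_scheme \<Rightarrow> ('a, 'b, 'n) module_scheme \<Rightarrow> bool"
  where "projective_module R M \<longleftrightarrow> module R M \<and>
     (\<exists>\<sigma>\<in>module_homs R M (free_on R (carrier M)).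
        \<forall>x\<in>carrier M. lin_ext R M (\<lambda>y. y) (\<sigma> x) = x)"

text \<open>
  The \<open>R/I\<close>-module structure of an \<open>R\<close>-module killed by \<open>I\<close>: the coset \<open>c\<close> acts as any of its
  representatives, and \<^const>\<open>the_elem\<close> is specified only because they all act alike.
\<close>

definition quot_scalars :: "('a, 'b, 'n) module_scheme \<Rightarrow> ('a set, 'b) module"
  where "quot_scalars M = \<lparr>carrier = carrier M, mult = undefined, one = undefined,
     zero = \<zero>\<^bsub>M\<^esub>, add = add M, smult = (\<lambda>c x. the_elem ((\<lambda>r. r \<odot>\<^bsub>M\<^esub> x) ` c))\<rparr>"

definition killed_by :: "'a set \<Rightarrow> ('a, 'b, 'n) module_scheme \<Rightarrow> bool"
  where "killed_by I M \<longleftrightarrow> (\<forall>a\<in>I. \<forall>x\<in>carrier M. a \<odot>\<^bsub>M\<^esub> x = \<zero>\<^bsub>M\<^esub>)"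

text \<open>\<open>M\<close> is an \<open>R\<close>-module on which the scalars descend to \<open>R/I\<close> and which is free over \<open>R/I\<close>.\<close>

definition free_over_quot :: "('a, 'm) ring_scheme \<Rightarrow> 'a set \<Rightarrow> ('a, 'b, 'n) module_scheme \<Rightarrow> bool"
  where "free_over_quot R I M \<longleftrightarrow>
     module R M \<and> killed_by I M \<and> free_module (R Quot I) (quot_scalars M)"

section \<open>Tensor products\<close>

definition tensor_relations ::
  "('a, 'm) ring_scheme \<Rightarrow> ('a, 'b, 'n) module_scheme \<Rightarrow> ('a, 'c, 'k) module_scheme \<Rightarrow>
   ('b \<times> 'c \<Rightarrow> 'a) set"
  where "tensor_relations R M N = (let F = free_on R (carrier M \<times> carrier N); e = single R in
     {e (x \<oplus>\<^bsub>M\<^esub> x', y) \<ominus>\<^bsub>F\<^esub> (e (x, y) \<oplus>\<^bsub>F\<^esub> e (x', y)) | x x' y.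
        x \<in> carrier M \<and> x' \<in> carrier M \<and> y \<in> carrier N} \<union>
     {e (x, y \<oplus>\<^bsub>N\<^esub> y') \<ominus>\<^bsub>F\<^esub> (e (x, y) \<oplus>\<^bsub>F\<^esub> e (x, y')) | x y y'.
        x \<in> carrier M \<and> y \<in> carrier N \<and> y' \<in> carrier N} \<union>
     {e (a \<odot>\<^bsub>M\<^esub> x, y) \<ominus>\<^bsub>F\<^esub> a \<odot>\<^bsub>F\<^esub> e (x, y) | a x y.
        a \<in> carrier R \<and> x \<in> carrier M \<and> y \<in> carrier N} \<union>
     {e (x, a \<odot>\<^bsub>N\<^esub> y) \<ominus>\<^bsub>F\<^esub> a \<odot>\<^bsub>F\<^esub> e (x, y) | a x y.
        a \<in> carrier R \<and> x \<in> carrier M \<and> y \<in> carrier N})"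

definition tensor_kernel ::
  "('a, 'm) ring_scheme \<Rightarrow> ('a, 'b, 'n) module_scheme \<Rightarrow> ('a, 'c, 'k) module_scheme \<Rightarrow>
   ('b \<times> 'c \<Rightarrow> 'a) set"
  where "tensor_kernel R M N =
     submodule_generated R (free_on R (carrier M \<times> carrier N)) (tensor_relations R M N)"

definition tensor ::
  "('a, 'm) ring_scheme \<Rightarrow> ('a, 'b, 'n) module_scheme \<Rightarrow> ('a, 'c, 'k) module_scheme \<Rightarrow>
   ('a, ('b \<times> 'c \<Rightarrow> 'a) set) module"
  where "tensor R M N = quot_module (free_on R (carrier M \<times> carrier N)) (tensor_kernel R M N)"

definition pure_tensor ::
  "('a, 'm) ring_scheme \<Rightarrow> ('a, 'b, 'n) module_scheme \<Rightarrow> ('a, 'c, 'k) module_scheme \<Rightarrow>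
   'b \<Rightarrow> 'c \<Rightarrow> ('b \<times> 'c \<Rightarrow> 'a) set"
  where "pure_tensor R M N x y =
     tensor_kernel R M N +>\<^bsub>free_on R (carrier M \<times> carrier N)\<^esub> single R (x, y)"

text \<open>The map \<open>f \<otimes> g\<close> into \<open>M \<otimes> N\<close> (\<open>M\<close> and \<open>N\<close> are the codomains of \<open>f\<close> and \<open>g\<close>).\<close>

definition tensor_map ::
  "('a, 'm) ring_scheme \<Rightarrow> ('a, 'b, 'n) module_scheme \<Rightarrow> ('a, 'c, 'k) module_scheme \<Rightarrow>
   ('d \<Rightarrow> 'b) \<Rightarrow> ('e \<Rightarrow> 'c) \<Rightarrow> ('d \<times> 'e \<Rightarrow> 'a) set \<Rightarrow> ('b \<times> 'c \<Rightarrow> 'a) set"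
  where "tensor_map R M N f g X =
     the_elem (lin_ext R (tensor R M N) (\<lambda>(x, y). pure_tensor R M N (f x) (g y)) ` X)"

section \<open>Chain complexes and homology\<close>

record ('a, 'b) chain_complex =
  obj :: "int \<Rightarrow> ('a, 'b) module"
  bd :: "int \<Rightarrow> 'b \<Rightarrow> 'b"  \<comment> \<open>\<open>bd X k\<close> maps degree \<open>k\<close> to degree \<open>k - 1\<close>\<close>

definition cycles :: "('a, 'b) chain_complex \<Rightarrow> int \<Rightarrow> 'b set"
  where "cycles X k = a_kernel (obj X k) (obj X (k - 1)) (bd X k)"

definition boundaries :: "('a, 'b) chain_complex \<Rightarrow> int \<Rightarrow> 'b set"
  where "boundaries X k = bd X (k + 1) ` carrier (obj X (k + 1))"

definition homology :: "('a, 'b) chain_complex \<Rightarrow> int \<Rightarrow> ('a, 'b set) module"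
  where "homology X k = quot_module ((obj X k)\<lparr>carrier := cycles X k\<rparr>) (boundaries X k)"

text \<open>The map into the homology of \<open>Y\<close> in degree \<open>k\<close> that a chain map \<open>f\<close> induces.\<close>

definition homology_map ::
  "('a, 'c) chain_complex \<Rightarrow> int \<Rightarrow> ('b \<Rightarrow> 'c) \<Rightarrow> 'b set \<Rightarrow> 'c set"
  where "homology_map Y k f Z = the_elem ((\<lambda>z. boundaries Y k +>\<^bsub>obj Y k\<^esub> f z) ` Z)"

text \<open>
  For a short exact sequence of complexes \<open>0 \<rightarrow> X \<rightarrow> Y \<rightarrow> W \<rightarrow> 0\<close> with maps \<open>f\<close> and \<open>g\<close>:
  represent the class \<open>Z\<close> by \<open>g y\<close>, write the boundary of \<open>y\<close> as \<open>f x\<close>, and take the class of \<open>x\<close>.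
\<close>

definition connecting_hom ::
  "('a, 'b) chain_complex \<Rightarrow> ('a, 'c) chain_complex \<Rightarrow> (int \<Rightarrow> 'b \<Rightarrow> 'c) \<Rightarrow> (int \<Rightarrow> 'c \<Rightarrow> 'd) \<Rightarrow>
   int \<Rightarrow> 'd set \<Rightarrow> 'b set"
  where "connecting_hom X Y f g k Z = (THE C.
     \<exists>y\<in>carrier (obj Y k). \<exists>x\<in>carrier (obj X (k - 1)).
       g k y \<in> Z \<and> f (k - 1) x = bd Y k y \<and> C = boundaries X (k - 1) +>\<^bsub>obj X (k - 1)\<^esub> x)"

section \<open>Tor\<close>

text \<open>
  Resolutions are graded by all integers and vanish in negative degrees, so that the homology
  in degree \<open>-1\<close> is the zero module.
\<close>

definition projective_resolution ::
  "('a, 'm) ring_scheme \<Rightarrow> ('a, 'b, 'n) module_scheme \<Rightarrow> ('a, 'p) chain_complex \<Rightarrow> ('p \<Rightarrow> 'b) \<Rightarrow> bool"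
  where "projective_resolution R A P \<epsilon> \<longleftrightarrow>
     (\<forall>k. projective_module R (obj P k)) \<and>
     (\<forall>k<0. carrier (obj P k) = {\<zero>\<^bsub>obj P k\<^esub>}) \<and>
     (\<forall>k. bd P k \<in> module_homs R (obj P k) (obj P (k - 1))) \<and>
     (\<forall>k>0. cycles P k = boundaries P k) \<and>
     \<epsilon> \<in> module_homs R (obj P 0) A \<and> \<epsilon> ` carrier (obj P 0) = carrier A \<and>
     a_kernel (obj P 0) A \<epsilon> = boundaries P 0"

definition tensor_complex ::
  "('a, 'm) ring_scheme \<Rightarrow> ('a, 'p) chain_complex \<Rightarrow> ('a, 'b, 'n) module_scheme \<Rightarrow>
   ('a, ('p \<times> 'b \<Rightarrow> 'a) set) chain_complex"
  where "tensor_complex R P M = \<lparr>obj = (\<lambda>k. tensor R (obj P k) M),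
     bd = (\<lambda>k. tensor_map R (obj P (k - 1)) M (bd P k) (\<lambda>y. y))\<rparr>"

text \<open>\<open>Tor R P M k\<close> is \<open>Tor\<^sub>k(A, M)\<close> computed from the projective resolution \<open>P\<close> of \<open>A\<close>.\<close>

definition Tor ::
  "('a, 'm) ring_scheme \<Rightarrow> ('a, 'p) chain_complex \<Rightarrow> ('a, 'b, 'n) module_scheme \<Rightarrow> int \<Rightarrow>
   ('a, ('p \<times> 'b \<Rightarrow> 'a) set set) module"
  where "Tor R P M k = homology (tensor_complex R P M) k"

text \<open>The map into \<open>Tor R P N k\<close> induced by a linear map \<open>f\<close> with codomain \<open>N\<close>.\<close>

definition Tor_map ::
  "('a, 'm) ring_scheme \<Rightarrow> ('a, 'p) chain_complex \<Rightarrow> ('a, 'c, 'n) module_scheme \<Rightarrow> ('b \<Rightarrow> 'c) \<Rightarrow>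
   int \<Rightarrow> ('p \<times> 'b \<Rightarrow> 'a) set set \<Rightarrow> ('p \<times> 'c \<Rightarrow> 'a) set set"
  where "Tor_map R P N f k =
     homology_map (tensor_complex R P N) k (tensor_map R (obj P k) N (\<lambda>x. x) f)"

text \<open>
  The connecting homomorphism from \<open>Tor R P N k\<close> to \<open>Tor R P L (k - 1)\<close> of a short exact sequence
  \<open>0 \<rightarrow> L \<rightarrow> M \<rightarrow> N \<rightarrow> 0\<close> with maps \<open>f\<close> and \<open>g\<close>.
\<close>

definition Tor_connecting ::
  "('a, 'm) ring_scheme \<Rightarrow> ('a, 'p) chain_complex \<Rightarrow> ('a, 'b, 'k) module_scheme \<Rightarrow>
   ('a, 'c, 'l) module_scheme \<Rightarrow> ('a, 'd, 'n) module_scheme \<Rightarrow> ('b \<Rightarrow> 'c) \<Rightarrow> ('c \<Rightarrow> 'd) \<Rightarrow>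
   int \<Rightarrow> ('p \<times> 'd \<Rightarrow> 'a) set set \<Rightarrow> ('p \<times> 'b \<Rightarrow> 'a) set set"
  where "Tor_connecting R P L M N f g k =
     connecting_hom (tensor_complex R P L) (tensor_complex R P M)
       (\<lambda>j. tensor_map R (obj P j) M (\<lambda>x. x) f) (\<lambda>j. tensor_map R (obj P j) N (\<lambda>x. x) g) k"

section \<open>Regular sequences\<close>

text \<open>
  Each \<open>xs ! i\<close> is a non-zero-divisor modulo its predecessors. Some authors also require the ideal
  generated by \<open>xs\<close> to be proper; this is not demanded here.
\<close>

definition regular_sequence :: "('a, 'm) ring_scheme \<Rightarrow> 'a list \<Rightarrow> bool"
  where "regular_sequence R xs \<longleftrightarrow> set xs \<subseteq> carrier R \<and>
     (\<forall>i<length xs. let J = genideal R (set (take i xs)); Q = R Quot J in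
        \<forall>c\<in>carrier Q. (J +>\<^bsub>R\<^esub> xs ! i) \<otimes>\<^bsub>Q\<^esub> c = \<zero>\<^bsub>Q\<^esub> \<longrightarrow> c = \<zero>\<^bsub>Q\<^esub>)"

section \<open>Powers of an ideal\<close>

definition power_module :: "('a, 'm) ring_scheme \<Rightarrow> 'a set \<Rightarrow> nat \<Rightarrow> ('a, 'a) module"
  where "power_module R I n = ideal_module R (I [^]\<^bsub>ideals_set R\<^esub> n)"

definition graded_piece :: "('a, 'm) ring_scheme \<Rightarrow> 'a set \<Rightarrow> nat \<Rightarrow> ('a, 'a set) module"
  where "graded_piece R I n =
     quot_module (power_module R I n) (I [^]\<^bsub>ideals_set R\<^esub> Suc n)"

definition graded_proj :: "('a, 'm) ring_scheme \<Rightarrow> 'a set \<Rightarrow> nat \<Rightarrow> 'a \<Rightarrow> 'a set"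
  where "graded_proj R I n x = (I [^]\<^bsub>ideals_set R\<^esub> Suc n) +>\<^bsub>power_module R I n\<^esub> x"

section \<open>The short exact sequence of powers of an ideal\<close>

lemma module_free_on: fixes R (structure) assumes "cring R" shows "module R (free_on R S)"
proof -
  interpret cring R by fact
  have fin: "finite {s. f s \<oplus> g s \<noteq> \<zero>} \<and> {s. f s \<oplus> g s \<noteq> \<zero>} \<subseteq> S"
    if "finite {s. f s \<noteq> \<zero>}" "finite {s. g s \<noteq> \<zero>}" "{s. f s \<noteq> \<zero>} \<subseteq> S" "{s. g s \<noteq> \<zero>} \<subseteq> S" for f g :: "_ \<Rightarrow> 'a"
  proof -
    have "{s. f s \<oplus> g s \<noteq> \<zero>} \<subseteq> {s. f s \<noteq> \<zero>} \<union> {s. g s \<noteq> \<zero>}" by auto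
    with that show ?thesis by (meson finite_Un finite_subset le_sup_iff order_trans Un_least)
  qed
  show ?thesis
  proof (rule moduleI)
    show "abelian_group (free_on R S)"
    proof (rule abelian_groupI)
      fix x y assume "x \<in> carrier (free_on R S)" "y \<in> carrier (free_on R S)"
      then show "x \<oplus>\<^bsub>free_on R S\<^esub> y \<in> carrier (free_on R S)"
        using fin[of x y] by (auto simp: free_on_def image_subset_iff)
    next
      fix x assume a: "x \<in> carrier (free_on R S)"
      have "(\<lambda>s. \<ominus> x s) \<in> carrier (free_on R S)"
      proof -
        have "{s. \<ominus> x s \<noteq> \<zero>} \<subseteq> {s. x s \<noteq> \<zero>}" by auto
        then show ?thesis using a by (auto simp: free_on_def image_subset_iff elim: finite_subset)
      qed
      moreover have "(\<lambda>s. \<ominus> x s) \<oplus>\<^bsub>free_on R S\<^esub> x = \<zero>\<^bsub>free_on R S\<^esub>"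
        using a by (auto simp: free_on_def image_subset_iff l_neg)
      ultimately show "\<exists>y\<in>carrier (free_on R S). y \<oplus>\<^bsub>free_on R S\<^esub> x = \<zero>\<^bsub>free_on R S\<^esub>" by blast
    qed (auto simp: free_on_def image_subset_iff a_ac fun_eq_iff)
    fix a x assume a: "a \<in> carrier R" "x \<in> carrier (free_on R S)"
    have "{s. a \<otimes> x s \<noteq> \<zero>} \<subseteq> {s. x s \<noteq> \<zero>}" using a by auto
    then show "a \<odot>\<^bsub>free_on R S\<^esub> x \<in> carrier (free_on R S)"
      using a by (auto simp: free_on_def image_subset_iff elim: finite_subset)
  qed (auto simp: free_on_def image_subset_iff assms l_distr r_distr m_assoc)
qed

lemma module_quot_module:
  assumes M: "module R M" and N: "submodule N R M"
  shows "module R (quot_module M N) \<and> (\<lambda>x. N +>\<^bsub>M\<^esub> x) \<in> module_homs R M (quot_module M N)"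
proof -
  interpret module R M by fact
  interpret N: submodule N R M by fact
  interpret additive_subgroup N M using N.subgroup_axioms by (simp add: additive_subgroup_def)
  interpret abelian_subgroup N M
    by (rule abelian_subgroupI3) (unfold_locales)
  have sm: "a \<odot>\<^bsub>quot_module M N\<^esub> (N +>\<^bsub>M\<^esub> x) = N +>\<^bsub>M\<^esub> (a \<odot>\<^bsub>M\<^esub> x)"
    if "a \<in> carrier R" "x \<in> carrier M" for a x
  proof -
    have "N +>\<^bsub>M\<^esub> (a \<odot>\<^bsub>M\<^esub> y) = N +>\<^bsub>M\<^esub> (a \<odot>\<^bsub>M\<^esub> x)" if "y \<in> N +>\<^bsub>M\<^esub> x" for y
    proof -
      obtain h where h: "h \<in> N" "y = h \<oplus>\<^bsub>M\<^esub> x" using \<open>y \<in> _\<close> by (auto simp: a_r_coset_def')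
      then have "a \<odot>\<^bsub>M\<^esub> y = a \<odot>\<^bsub>M\<^esub> h \<oplus>\<^bsub>M\<^esub> a \<odot>\<^bsub>M\<^esub> x"
        using \<open>a \<in> _\<close> \<open>x \<in> _\<close> by (simp add: smult_r_distr)
      then have "a \<odot>\<^bsub>M\<^esub> y \<in> N +>\<^bsub>M\<^esub> (a \<odot>\<^bsub>M\<^esub> x)" using h \<open>a \<in> _\<close> by (auto simp: a_r_coset_def' N.smult_closed)
      then show ?thesis using \<open>a \<in> _\<close> \<open>x \<in> _\<close> by (metis a_repr_independence smult_closed a_subgroup)
    qed
    moreover have "x \<in> N +>\<^bsub>M\<^esub> x" using that by (simp add: a_rcos_self)
    ultimately have "(\<Union>y\<in>N +>\<^bsub>M\<^esub> x. N +>\<^bsub>M\<^esub> (a \<odot>\<^bsub>M\<^esub> y)) = N +>\<^bsub>M\<^esub> (a \<odot>\<^bsub>M\<^esub> x)"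
      by blast
    then show ?thesis by (simp add: quot_module_def)
  qed
  have ad: "(N +>\<^bsub>M\<^esub> x) \<oplus>\<^bsub>quot_module M N\<^esub> (N +>\<^bsub>M\<^esub> y) = N +>\<^bsub>M\<^esub> (x \<oplus>\<^bsub>M\<^esub> y)"
    if "x \<in> carrier M" "y \<in> carrier M" for x y
    using that by (simp add: quot_module_def a_rcos_sum)
  have car: "carrier (quot_module M N) = (\<lambda>x. N +>\<^bsub>M\<^esub> x) ` carrier M"
    by (auto simp: quot_module_def A_RCOSETS_def')
  have z: "\<zero>\<^bsub>quot_module M N\<^esub> = N +>\<^bsub>M\<^esub> \<zero>\<^bsub>M\<^esub>"
    by (simp add: quot_module_def M.a_coset_add_zero a_subset)
  have h: "(\<lambda>x. N +>\<^bsub>M\<^esub> x) \<in> module_homs R M (quot_module M N)"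
    unfolding module_homs_def using ad sm car by auto
  have "module R (quot_module M N)"
  proof (rule moduleI)
    show "abelian_group (quot_module M N)"
    proof (rule abelian_groupI)
      fix x assume "x \<in> carrier (quot_module M N)"
      then obtain u where "u \<in> carrier M" "x = N +>\<^bsub>M\<^esub> u" by (auto simp: car)
      then show "\<exists>y\<in>carrier (quot_module M N). y \<oplus>\<^bsub>quot_module M N\<^esub> x = \<zero>\<^bsub>quot_module M N\<^esub>"
        by (intro bexI[of _ "N +>\<^bsub>M\<^esub> (\<ominus>\<^bsub>M\<^esub> u)"]) (auto simp: car ad z M.l_neg)
    qed (auto simp: car ad z M.a_ac)
  qed (auto simp: car ad sm smult_l_distr smult_r_distr smult_assoc1 R.is_cring)
  with h show ?thesis by blast
qed

lemma module_ideal_module: fixes R (structure) assumes "cring R" "ideal J R" shows "module R (ideal_module R J)"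
proof -
  interpret cring R by fact
  interpret J: ideal J R by fact
  show ?thesis
  proof (rule moduleI)
    show "abelian_group (ideal_module R J)"
    proof (rule abelian_groupI)
      fix x assume "x \<in> carrier (ideal_module R J)"
      then show "\<exists>y\<in>carrier (ideal_module R J). y \<oplus>\<^bsub>ideal_module R J\<^esub> x = \<zero>\<^bsub>ideal_module R J\<^esub>"
        by (intro bexI[of _ "\<ominus> x"]) (auto simp: ideal_module_def l_neg J.a_Hcarr)
    qed (auto simp: ideal_module_def a_ac J.a_Hcarr)
  qed (auto simp: ideal_module_def assms l_distr r_distr m_assoc J.a_Hcarr J.I_l_closed)
qed

lemma (in cring) ideal_power_ideal: assumes "ideal I R" shows "ideal (I [^]\<^bsub>ideals_set R\<^esub> (n::nat)) R"
proof (induct n)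
  case 0 show ?case by (simp add: nat_pow_def ideals_set_def oneideal)
next
  case (Suc n) then show ?case using ideal_prod_is_ideal[OF _ assms] 
    by (simp add: nat_pow_def ideals_set_def)
qed

lemma (in cring) ideal_power_Suc_subset: assumes "ideal I R"
  shows "I [^]\<^bsub>ideals_set R\<^esub> Suc n \<subseteq> I [^]\<^bsub>ideals_set R\<^esub> (n::nat)"
  using ideal_prod_inter[OF ideal_power_ideal[OF assms, of n] assms]
  by (simp add: nat_pow_def ideals_set_def)

lemma short_exact_ideal_powers:
  assumes "cring R" "ideal I R"
  shows "short_exact R (power_module R I (Suc n)) (power_module R I n) (graded_piece R I n)
    (\<lambda>x. x) (graded_proj R I n)"
proof -
  interpret cring R by fact
  let ?N = "I [^]\<^bsub>ideals_set R\<^esub> Suc n" and ?M = "I [^]\<^bsub>ideals_set R\<^esub> n"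
  interpret N: ideal ?N R by (rule ideal_power_ideal[OF assms(2)])
  interpret M: ideal ?M R by (rule ideal_power_ideal[OF assms(2)])
  have MM: "module R (power_module R I n)" and NN: "module R (power_module R I (Suc n))"
    unfolding power_module_def by (intro module_ideal_module assms M.ideal_axioms N.ideal_axioms)+
  interpret PM: module R "power_module R I n" by fact
  have sub: "submodule ?N R (power_module R I n)"
  proof (rule PM.module_incl_imp_submodule)
    show "?N \<subseteq> carrier (power_module R I n)" using ideal_power_Suc_subset[OF assms(2)] by (simp add: power_module_def ideal_module_def)
    have "(power_module R I n)\<lparr>carrier := ?N\<rparr> = power_module R I (Suc n)"
      by (simp add: power_module_def ideal_module_def)
    then show "module R (power_module R I n\<lparr>carrier := ?N\<rparr>)" using NN by simp
  qed
  have Q: "module R (graded_piece R I n)" unfolding graded_piece_def using module_quot_module[OF MM sub] by blast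
  interpret S: submodule ?N R "power_module R I n" by fact
  interpret additive_subgroup ?N "power_module R I n" using S.subgroup_axioms by (simp add: additive_subgroup_def)
  interpret abelian_subgroup ?N "power_module R I n"
    by (rule abelian_subgroupI3) (unfold_locales)
  have mem: "x \<in> ?N +>\<^bsub>power_module R I n\<^esub> x" if "x \<in> ?M" for x
    using that by (intro a_rcos_self) (simp add: power_module_def ideal_module_def)
  have ker: "a_kernel (power_module R I n) (graded_piece R I n) (graded_proj R I n) = ?N"
  proof -
    have "?N +>\<^bsub>power_module R I n\<^esub> x = ?N" if "x \<in> ?N" for x
      using a_rcos_const[OF that] by simp
    moreover have "?N \<subseteq> ?M" by (rule ideal_power_Suc_subset[OF assms(2)])
    moreover have "carrier (power_module R I n) = ?M" by (simp add: power_module_def ideal_module_def)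
    ultimately have "{x \<in> carrier (power_module R I n). ?N +>\<^bsub>power_module R I n\<^esub> x = ?N} = ?N"
      using mem by blast
    then show ?thesis by (simp add: a_kernel_def kernel_def graded_piece_def quot_module_def graded_proj_def)
  qed
  show ?thesis unfolding short_exact_def ker
    apply (intro conjI NN MM Q)
    subgoal using ideal_power_Suc_subset[OF assms(2), of n] unfolding module_homs_def by (auto simp add: power_module_def ideal_module_def Pi_def simp del: nat_pow_Suc) 
    subgoal using module_quot_module[OF MM sub] unfolding graded_piece_def graded_proj_def[abs_def] by blast
    subgoal by simp
    subgoal by (simp add: power_module_def ideal_module_def)
    subgoal by (auto simp: graded_piece_def quot_module_def A_RCOSETS_def' graded_proj_def)
    done
qed

end

theory Submission
  imports Defs
begin

text \<open>
  Let \<open>P\<close> be the given projective resolution of \<open>R/I\<close>. Since each \<open>P\<^sub>k\<close> is flat, \<open>P \<otimes> K\<close> is the subcomplex \<open>K P\<close> of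
  \<open>P\<close> for every ideal \<open>K\<close>, and multiplication by an element of \<open>I\<close> is null homotopic on \<open>P\<close>. The long
  exact sequence reduces exactness to the claim that every cycle in \<open>I\<^sup>s\<^sup>+\<^sup>1 P\<close> bounds in \<open>I\<^sup>s P\<close>. This is
  proved with \<open>I\<close> replaced by the ideals generated by the initial segments of the regular sequence, by
  induction on the length: if \<open>I' = J + (x)\<close>, then \<open>I'\<^sup>s\<^sup>+\<^sup>1 = x I'\<^sup>s + J\<^sup>s\<^sup>+\<^sup>1\<close>, and \<open>x\<close> is a non-zero-divisor modulo \<open>J\<^sup>s\<^sup>+\<^sup>1\<close>.
  The same decomposition filters \<open>Tor\<^sub>k(I'\<^sup>s\<^sup>+\<^sup>1)\<close> with quotients \<open>Tor\<^sub>k(J\<^sup>s\<^sup>+\<^sup>1)\<close>, \<open>Tor\<^sub>k(I'\<^sup>s)\<close> and \<open>Tor\<^sub>k\<^sub>-\<^sub>1(J\<^sup>s\<^sup>+\<^sup>1)\<close>, so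
  that all these modules are iterated extensions of copies of \<open>R/I\<close>. As \<open>I\<close> kills them, they are free over \<open>R/I\<close>.
\<close>

section \<open>Modules, homomorphisms and subquotients\<close>

text \<open>Regularity enters only through the claim that \<open>x\<close> is a non-zero-divisor
  modulo \<open>J\<^sup>s\<^sup>+\<^sup>1\<close>. This amounts to injectivity of \<open>x\<close>
  on the pieces \<open>J\<^sup>n/J\<^sup>n\<^sup>+\<^sup>1\<close>, and the induction on the
  sequence closes only for \<open>J\<^sup>n/K J\<^sup>n\<close> with an arbitrary ideal
  \<open>K\<close> above \<open>J\<close>; see \<open>regular_sequence_graded\<close>. The
  resolution is arbitrary, not a Koszul complex, so freeness cannot be read off from it. It comes
  from the finiteness of the filtration: in a module killed by \<open>I\<close>, an extension by
  \<open>R/I\<close> splits, because a lifted generator still has annihilator \<open>I\<close>.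
  \<open>P\<close> resolves \<open>R/I\<close> for the full ideal while \<open>J\<close> runs
  through smaller ones. The induction survives this because every element of \<open>I\<close> has a
  null homotopy on the same \<open>P\<close>, and a linear homotopy preserves each
  \<open>K P\<close>. Staying inside \<open>P\<close> also lets the complexes of different ideals be
  compared by inclusion. The quotient \<open>I\<^sup>s/I\<^sup>s\<^sup>+\<^sup>1\<close> is not an
  ideal and has no such subcomplex; its Tor is treated as the middle term of the exact
  sequence.\<close>

lemma (in module) smult_lcomm:
  "a \<in> carrier R \<Longrightarrow> b \<in> carrier R \<Longrightarrow> x \<in> carrier M \<Longrightarrow> a \<odot>\<^bsub>M\<^esub> (b \<odot>\<^bsub>M\<^esub> x) = b \<odot>\<^bsub>M\<^esub> (a \<odot>\<^bsub>M\<^esub> x)"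
  by (simp add: smult_assoc1[symmetric] R.m_comm)

lemma (in module) a_inv_zero: "\<ominus>\<^bsub>M\<^esub> \<zero>\<^bsub>M\<^esub> = \<zero>\<^bsub>M\<^esub>"
  by (simp add: M.minus_equality)

text \<open>Registers the module laws with the method \<open>algebra\<close>, which then proves
  identities between linear combinations.\<close>

lemmas (in module) module_simprules
  [algebra module "zero M" "add M" "a_inv M" "a_minus M" "one R" "mult R" "smult M"] =
  M.a_closed M.zero_closed M.a_inv_closed M.minus_closed
  M.a_assoc M.l_zero M.l_neg M.a_comm M.minus_eq
  M.r_zero M.r_neg M.r_neg2 M.r_neg1 M.minus_add M.minus_minus a_inv_zero
  M.a_lcomm smult_closed smult_l_distr smult_r_distr smult_assoc1 smult_one smult_l_null smult_r_null
  smult_l_minus smult_r_minus smult_lcomm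
  R.a_closed R.zero_closed R.a_inv_closed R.minus_closed R.m_closed R.one_closed R.minus_eq

context module
begin

lemma submodule_zero: "submodule H R M \<Longrightarrow> \<zero>\<^bsub>M\<^esub> \<in> H"
  using subgroup.one_closed[OF submodule.axioms(1)] by fastforce

lemma submodule_minus: "submodule H R M \<Longrightarrow> x \<in> H \<Longrightarrow> y \<in> H \<Longrightarrow> x \<ominus>\<^bsub>M\<^esub> y \<in> H"
  by (simp add: a_minus_def submoduleE)

lemma submodule_carrier: "submodule H R M \<Longrightarrow> x \<in> H \<Longrightarrow> x \<in> carrier M"
  using submoduleE(1) by blast

lemmas submodule_closed = submodule_zero submodule_minus submoduleE(3-5)

lemma submoduleI':
  assumes "H \<subseteq> carrier M" "\<zero>\<^bsub>M\<^esub> \<in> H" "\<And>x y. x \<in> H \<Longrightarrow> y \<in> H \<Longrightarrow> x \<oplus>\<^bsub>M\<^esub> y \<in> H"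
    and sm: "\<And>a x. a \<in> carrier R \<Longrightarrow> x \<in> H \<Longrightarrow> a \<odot>\<^bsub>M\<^esub> x \<in> H"
  shows "submodule H R M"
proof (rule submoduleI)
  fix x assume x: "x \<in> H"
  then have "(\<ominus> \<one>) \<odot>\<^bsub>M\<^esub> x \<in> H" by (intro sm) auto
  then show "\<ominus>\<^bsub>M\<^esub> x \<in> H" using x assms(1) by (simp add: smult_l_minus subset_iff)
qed (use assms in auto)

lemma zero_submodule: "submodule {\<zero>\<^bsub>M\<^esub>} R M"
  by (rule submoduleI) auto

lemma submodule_Int: "submodule H R M \<Longrightarrow> submodule K R M \<Longrightarrow> submodule (H \<inter> K) R M"
  by (rule submoduleI) (auto simp: submodule_closed submodule_carrier)

lemma submodule_finsum:
  assumes H: "submodule H R M" and f: "\<And>i. i \<in> A \<Longrightarrow> f i \<in> H"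
  shows "finsum M f A \<in> H"
proof (cases "finite A")
  case True
  then show ?thesis using f
  proof (induct A)
    case empty then show ?case using H by (simp add: submodule_zero)
  next
    case (insert a A)
    then have "f \<in> A \<rightarrow> carrier M" "f a \<in> carrier M" using submodule_carrier[OF H] by auto
    with insert show ?case using H by (simp add: submodule_closed)
  qed
next
  case False
  then show ?thesis using H by (simp add: M.finsum_infinite submodule_zero)
qed

lemma rcos_self: "submodule N R M \<Longrightarrow> x \<in> carrier M \<Longrightarrow> x \<in> N +>\<^bsub>M\<^esub> x"
  unfolding a_r_coset_def' using submodule_zero[of N] M.l_zero[of x] by force

lemma rcos_mem_iff:
  assumes N: "submodule N R M" and "x \<in> carrier M" "y \<in> carrier M"
  shows "y \<in> N +>\<^bsub>M\<^esub> x \<longleftrightarrow> y \<ominus>\<^bsub>M\<^esub> x \<in> N"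
proof
  assume "y \<in> N +>\<^bsub>M\<^esub> x"
  then obtain h where h: "h \<in> N" "y = h \<oplus>\<^bsub>M\<^esub> x" by (auto simp: a_r_coset_def')
  moreover have "(h \<oplus>\<^bsub>M\<^esub> x) \<ominus>\<^bsub>M\<^esub> x = h"
    using assms submodule_carrier[OF N h(1)] by algebra
  ultimately show "y \<ominus>\<^bsub>M\<^esub> x \<in> N" by simp
next
  assume "y \<ominus>\<^bsub>M\<^esub> x \<in> N"
  moreover have "y = (y \<ominus>\<^bsub>M\<^esub> x) \<oplus>\<^bsub>M\<^esub> x" using assms by algebra
  ultimately show "y \<in> N +>\<^bsub>M\<^esub> x" by (auto simp: a_r_coset_def')
qed

lemma rcos_eq_iff:
  assumes N: "submodule N R M" and x: "x \<in> carrier M" and y: "y \<in> carrier M"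
  shows "N +>\<^bsub>M\<^esub> x = N +>\<^bsub>M\<^esub> y \<longleftrightarrow> x \<ominus>\<^bsub>M\<^esub> y \<in> N"
proof
  assume "N +>\<^bsub>M\<^esub> x = N +>\<^bsub>M\<^esub> y"
  then show "x \<ominus>\<^bsub>M\<^esub> y \<in> N" using rcos_self[OF N x] rcos_mem_iff[OF N y x] by simp
next
  assume "x \<ominus>\<^bsub>M\<^esub> y \<in> N"
  then have "x \<in> N +>\<^bsub>M\<^esub> y" using rcos_mem_iff[OF N y x] by simp
  then show "N +>\<^bsub>M\<^esub> x = N +>\<^bsub>M\<^esub> y"
    using M.a_repr_independence[OF _ y submodule.axioms(1)[OF N]] by simp
qed

lemma rcos_zero: "submodule N R M \<Longrightarrow> N +>\<^bsub>M\<^esub> \<zero>\<^bsub>M\<^esub> = N"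
  by (intro M.a_coset_add_zero submoduleE)

lemma rcos_eq_self_iff:
  assumes N: "submodule N R M" and x: "x \<in> carrier M"
  shows "N +>\<^bsub>M\<^esub> x = N \<longleftrightarrow> x \<in> N"
proof -
  have "x \<ominus>\<^bsub>M\<^esub> \<zero>\<^bsub>M\<^esub> = x" using x by algebra
  then show ?thesis using rcos_eq_iff[OF N x, of "\<zero>\<^bsub>M\<^esub>"] rcos_zero[OF N] by simp
qed

end

lemma module_homsI:
  assumes "\<And>x. x \<in> carrier M \<Longrightarrow> f x \<in> carrier N"
    and "\<And>x y. x \<in> carrier M \<Longrightarrow> y \<in> carrier M \<Longrightarrow> f (x \<oplus>\<^bsub>M\<^esub> y) = f x \<oplus>\<^bsub>N\<^esub> f y"
    and "\<And>a x. a \<in> carrier R \<Longrightarrow> x \<in> carrier M \<Longrightarrow> f (a \<odot>\<^bsub>M\<^esub> x) = a \<odot>\<^bsub>N\<^esub> f x"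
  shows "f \<in> module_homs R M N"
  using assms by (auto simp: module_homs_def)

lemma hom_closed: "f \<in> module_homs R M N \<Longrightarrow> x \<in> carrier M \<Longrightarrow> f x \<in> carrier N"
  by (auto simp: module_homs_def)

lemma hom_add:
  "f \<in> module_homs R M N \<Longrightarrow> x \<in> carrier M \<Longrightarrow> y \<in> carrier M \<Longrightarrow> f (x \<oplus>\<^bsub>M\<^esub> y) = f x \<oplus>\<^bsub>N\<^esub> f y"
  by (auto simp: module_homs_def)

lemma hom_smult:
  "f \<in> module_homs R M N \<Longrightarrow> a \<in> carrier R \<Longrightarrow> x \<in> carrier M \<Longrightarrow> f (a \<odot>\<^bsub>M\<^esub> x) = a \<odot>\<^bsub>N\<^esub> f x"
  by (auto simp: module_homs_def)

lemma hom_comp: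
  assumes "f \<in> module_homs R M N" "g \<in> module_homs R N L"
  shows "(\<lambda>x. g (f x)) \<in> module_homs R M L"
  by (rule module_homsI) (simp_all add: hom_closed[OF assms(1)] hom_add[OF assms(1)] hom_smult[OF assms(1)]
      hom_closed[OF assms(2)] hom_add[OF assms(2)] hom_smult[OF assms(2)])

lemma id_hom: "(\<lambda>x. x) \<in> module_homs R M M"
  by (rule module_homsI) auto

lemma zero_hom: "module R N \<Longrightarrow> (\<lambda>_. \<zero>\<^bsub>N\<^esub>) \<in> module_homs R M N"
proof -
  assume "module R N"
  then interpret N: module R N .
  show ?thesis by (rule module_homsI) simp_all
qed

locale module_pair = M: module R M + N: module R N for R (structure) and M and N
begin

lemma finsum_module_hom:
  assumes B: "finite B" and f: "\<And>q. q \<in> B \<Longrightarrow> f q \<in> module_homs R M N"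
  shows "(\<lambda>x. finsum N (\<lambda>q. f q x) B) \<in> module_homs R M N"
proof (rule module_homsI)
  have c: "(\<lambda>q. f q x) \<in> B \<rightarrow> carrier N" if "x \<in> carrier M" for x using hom_closed[OF f that] by auto
  then show "finsum N (\<lambda>q. f q x) B \<in> carrier N" if "x \<in> carrier M" for x
    using that by (intro N.M.finsum_closed)
  show "finsum N (\<lambda>q. f q (x \<oplus>\<^bsub>M\<^esub> y)) B = finsum N (\<lambda>q. f q x) B \<oplus>\<^bsub>N\<^esub> finsum N (\<lambda>q. f q y) B"
    if xy: "x \<in> carrier M" "y \<in> carrier M" for x y
    unfolding N.M.finsum_addf[OF c[OF xy(1)] c[OF xy(2)], symmetric]
    by (rule N.M.finsum_cong') (use c xy hom_add[OF f] in auto)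
  show "finsum N (\<lambda>q. f q (a \<odot>\<^bsub>M\<^esub> x)) B = a \<odot>\<^bsub>N\<^esub> finsum N (\<lambda>q. f q x) B"
    if ax: "a \<in> carrier R" "x \<in> carrier M" for a x
    unfolding N.finsum_smult_ldistr[OF B ax(1) c[OF ax(2)]]
    by (rule N.M.finsum_cong') (use c ax hom_smult[OF f] in auto)
qed

context
  fixes f assumes f: "f \<in> module_homs R M N"
begin

lemma hom_zero: "f \<zero>\<^bsub>M\<^esub> = \<zero>\<^bsub>N\<^esub>"
proof -
  have "f \<zero>\<^bsub>M\<^esub> = f (\<zero> \<odot>\<^bsub>M\<^esub> \<zero>\<^bsub>M\<^esub>)" by simp
  also have "\<dots> = \<zero> \<odot>\<^bsub>N\<^esub> f \<zero>\<^bsub>M\<^esub>" by (rule hom_smult[OF f]) auto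
  also have "\<dots> = \<zero>\<^bsub>N\<^esub>" by (simp add: hom_closed[OF f])
  finally show ?thesis .
qed

lemma hom_neg: "x \<in> carrier M \<Longrightarrow> f (\<ominus>\<^bsub>M\<^esub> x) = \<ominus>\<^bsub>N\<^esub> f x"
proof -
  assume x: "x \<in> carrier M"
  have "\<ominus>\<^bsub>M\<^esub> x = (\<ominus> \<one>) \<odot>\<^bsub>M\<^esub> x" using x by (simp add: M.smult_l_minus)
  then have "f (\<ominus>\<^bsub>M\<^esub> x) = (\<ominus> \<one>) \<odot>\<^bsub>N\<^esub> f x" using x by (simp add: hom_smult[OF f])
  then show ?thesis using x by (simp add: N.smult_l_minus hom_closed[OF f])
qed

lemma hom_minus: "x \<in> carrier M \<Longrightarrow> y \<in> carrier M \<Longrightarrow> f (x \<ominus>\<^bsub>M\<^esub> y) = f x \<ominus>\<^bsub>N\<^esub> f y"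
  by (simp add: a_minus_def hom_add[OF f] hom_neg)

lemma hom_finsum:
  assumes "finite A" "\<And>i. i \<in> A \<Longrightarrow> g i \<in> carrier M"
  shows "f (finsum M g A) = finsum N (\<lambda>i. f (g i)) A"
  using assms
proof (induct A)
  case empty show ?case by (simp add: hom_zero)
next
  case (insert a A)
  then have "g \<in> A \<rightarrow> carrier M" "g a \<in> carrier M" "(\<lambda>i. f (g i)) \<in> A \<rightarrow> carrier N" "f (g a) \<in> carrier N"
    by (auto intro: hom_closed[OF f])
  with insert show ?case by (simp add: hom_add[OF f])
qed

lemma hom_image_submodule:
  assumes H: "submodule H R M"
  shows "submodule (f ` H) R N"
proof (rule N.submoduleI)
  note [simp] = M.submodule_carrier[OF H] M.submodule_closed[OF H] hom_closed[OF f]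
  show "f ` H \<subseteq> carrier N" by auto
  show "\<zero>\<^bsub>N\<^esub> \<in> f ` H" using M.submodule_zero[OF H] by (metis hom_zero imageI)
  show "\<ominus>\<^bsub>N\<^esub> a \<in> f ` H" if "a \<in> f ` H" for a
    using that by (auto simp: hom_neg[symmetric])
  show "a \<oplus>\<^bsub>N\<^esub> b \<in> f ` H" if "a \<in> f ` H" "b \<in> f ` H" for a b
    using that by (auto simp: hom_add[OF f, symmetric])
  show "a \<odot>\<^bsub>N\<^esub> x \<in> f ` H" if "a \<in> carrier R" "x \<in> f ` H" for a x
    using that by (auto simp: hom_smult[OF f, symmetric])
qed

lemma hom_vimage_submodule:
  assumes H: "submodule H R N"
  shows "submodule {x \<in> carrier M. f x \<in> H} R M"
  by (rule M.submoduleI)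
    (auto simp: hom_zero hom_neg hom_add[OF f] hom_smult[OF f] N.submodule_closed[OF H])

lemma a_kernel_submodule: "submodule (a_kernel M N f) R M"
  using hom_vimage_submodule[OF N.zero_submodule] by (simp add: a_kernel_def')

end
end

lemma (in module) minus_eq_zero_iff:
  "x \<in> carrier M \<Longrightarrow> y \<in> carrier M \<Longrightarrow> x \<ominus>\<^bsub>M\<^esub> y = \<zero>\<^bsub>M\<^esub> \<longleftrightarrow> x = y"
  by (metis M.a_transpose_inv M.l_zero M.minus_equality M.minus_minus M.r_neg a_minus_def M.a_inv_closed)

text \<open>Both \<open>homology\<close> and, with \<open>Z\<close> the whole carrier,
  \<open>tensor\<close> have this form, so one set of lemmas about classes serves homology and
  tensor products.\<close>

definition subquot :: "('a, 'b, 'n) module_scheme \<Rightarrow> 'b set \<Rightarrow> 'b set \<Rightarrow> ('a, 'b set) module"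
  where "subquot M Z B = quot_module (M\<lparr>carrier := Z\<rparr>) B"

lemma a_r_coset_carrier_update [simp]: "N +>\<^bsub>M\<lparr>carrier := Z\<rparr>\<^esub> x = N +>\<^bsub>M\<^esub> x"
  by (simp add: a_r_coset_def')

locale subquotient = module +
  fixes Z B
  assumes Z: "submodule Z R M" and B: "submodule B R M" and BZ: "B \<subseteq> Z"
begin

lemma module_Z: "module R (M\<lparr>carrier := Z\<rparr>)"
  by (rule submodule.submodule_is_module[OF Z]) unfold_locales

lemma submodule_Z: "submodule B R (M\<lparr>carrier := Z\<rparr>)"
  by (rule module.module_incl_imp_submodule[OF module_Z])
    (use submodule.submodule_is_module[OF B] BZ in \<open>auto intro: module_axioms\<close>)

lemma module_subquot: "module R (subquot M Z B)"
  using module_quot_module[OF module_Z submodule_Z] by (simp add: subquot_def)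

lemma class_hom: "(\<lambda>z. B +>\<^bsub>M\<^esub> z) \<in> module_homs R (M\<lparr>carrier := Z\<rparr>) (subquot M Z B)"
  using module_quot_module[OF module_Z submodule_Z] by (simp add: subquot_def)

lemma subquot_carrier: "carrier (subquot M Z B) = (\<lambda>z. B +>\<^bsub>M\<^esub> z) ` Z"
  by (auto simp: subquot_def quot_module_def A_RCOSETS_def')

lemma subquot_zero: "\<zero>\<^bsub>subquot M Z B\<^esub> = B"
  by (simp add: subquot_def quot_module_def)

lemma subquot_class_closed: "z \<in> Z \<Longrightarrow> B +>\<^bsub>M\<^esub> z \<in> carrier (subquot M Z B)"
  by (simp add: subquot_carrier)

lemma subquot_add:
  "z \<in> Z \<Longrightarrow> z' \<in> Z \<Longrightarrow> (B +>\<^bsub>M\<^esub> z) \<oplus>\<^bsub>subquot M Z B\<^esub> (B +>\<^bsub>M\<^esub> z') = B +>\<^bsub>M\<^esub> (z \<oplus>\<^bsub>M\<^esub> z')"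
  using hom_add[OF class_hom, of z z'] by simp

lemma subquot_smult:
  "a \<in> carrier R \<Longrightarrow> z \<in> Z \<Longrightarrow> a \<odot>\<^bsub>subquot M Z B\<^esub> (B +>\<^bsub>M\<^esub> z) = B +>\<^bsub>M\<^esub> (a \<odot>\<^bsub>M\<^esub> z)"
  using hom_smult[OF class_hom, of a z] by simp

lemma subquot_eq_iff: "z \<in> Z \<Longrightarrow> z' \<in> Z \<Longrightarrow> B +>\<^bsub>M\<^esub> z = B +>\<^bsub>M\<^esub> z' \<longleftrightarrow> z \<ominus>\<^bsub>M\<^esub> z' \<in> B"
  by (intro rcos_eq_iff B submodule_carrier[OF Z])

lemma subquot_eq_zero_iff: "z \<in> Z \<Longrightarrow> B +>\<^bsub>M\<^esub> z = B \<longleftrightarrow> z \<in> B"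
  by (intro rcos_eq_self_iff B submodule_carrier[OF Z])

lemma class_subset: "z \<in> Z \<Longrightarrow> B +>\<^bsub>M\<^esub> z \<subseteq> Z"
  using BZ by (auto simp: a_r_coset_def' submodule_closed[OF Z])

text \<open>The induced maps in the definitions are written as \<open>the_elem\<close> of the image
  of a coset; this evaluates them at a representative once the value is constant on the
  coset.\<close>

lemma the_elem_class:
  assumes z: "z \<in> Z" and eq: "\<And>z'. z' \<in> Z \<Longrightarrow> z' \<ominus>\<^bsub>M\<^esub> z \<in> B \<Longrightarrow> f z' = f z"
  shows "the_elem (f ` (B +>\<^bsub>M\<^esub> z)) = f z"
proof -
  have "f z' = f z" if "z' \<in> B +>\<^bsub>M\<^esub> z" for z'
    using eq[of z'] that class_subset[OF z] rcos_mem_iff[OF B, of z z'] submodule_carrier[OF Z] z by blast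
  moreover have "z \<in> B +>\<^bsub>M\<^esub> z" using rcos_self[OF B submodule_carrier[OF Z z]] .
  ultimately have "f ` (B +>\<^bsub>M\<^esub> z) = {f z}" by blast
  then show ?thesis by simp
qed

end

section \<open>Free modules and linear extension\<close>

lemma free_on_carrier:
  "\<phi> \<in> carrier (free_on R S) \<longleftrightarrow>
     (\<forall>s. \<phi> s \<in> carrier R) \<and> finite {s. \<phi> s \<noteq> \<zero>\<^bsub>R\<^esub>} \<and> {s. \<phi> s \<noteq> \<zero>\<^bsub>R\<^esub>} \<subseteq> S"
  by (auto simp: free_on_def)

lemma free_on_sel [simp]:
  "\<zero>\<^bsub>free_on R S\<^esub> = (\<lambda>_. \<zero>\<^bsub>R\<^esub>)"
  "\<phi> \<oplus>\<^bsub>free_on R S\<^esub> \<psi> = (\<lambda>s. \<phi> s \<oplus>\<^bsub>R\<^esub> \<psi> s)"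
  "a \<odot>\<^bsub>free_on R S\<^esub> \<phi> = (\<lambda>s. a \<otimes>\<^bsub>R\<^esub> \<phi> s)"
  by (auto simp: free_on_def)

context module
begin

text \<open>\<open>lin_ext\<close> sums over the exact support, which can shrink under addition or
  scaling; linearity therefore calls for a common larger index set.\<close>

lemma lin_ext_eq_finsum:
  assumes A: "finite A" "{s. \<phi> s \<noteq> \<zero>} \<subseteq> A"
    and \<phi>: "\<And>s. s \<in> A \<Longrightarrow> \<phi> s \<in> carrier R" and h: "\<And>s. s \<in> A \<Longrightarrow> h s \<in> carrier M"
  shows "lin_ext R M h \<phi> = (\<Oplus>\<^bsub>M\<^esub>s\<in>A. \<phi> s \<odot>\<^bsub>M\<^esub> h s)"
  unfolding lin_ext_def
  by (rule M.add.finprod_mono_neutral_cong_left) (use assms in auto)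

lemma lin_ext_hom:
  assumes h: "\<And>s. s \<in> S \<Longrightarrow> h s \<in> carrier M"
  shows "lin_ext R M h \<in> module_homs R (free_on R S) M"
proof (rule module_homsI)
  fix \<phi> assume p: "\<phi> \<in> carrier (free_on R S)"
  let ?A = "{s. \<phi> s \<noteq> \<zero>}"
  have A: "finite ?A" "?A \<subseteq> S" "\<And>s. \<phi> s \<in> carrier R" using p by (auto simp: free_on_carrier)
  show "lin_ext R M h \<phi> \<in> carrier M"
    unfolding lin_ext_def by (rule M.finsum_closed) (use A h in auto)
  fix a assume a: "a \<in> carrier R"
  have "lin_ext R M h (\<lambda>s. a \<otimes> \<phi> s) = (\<Oplus>\<^bsub>M\<^esub>s\<in>?A. (a \<otimes> \<phi> s) \<odot>\<^bsub>M\<^esub> h s)"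
    by (rule lin_ext_eq_finsum) (use A a h in auto)
  also have "\<dots> = (\<Oplus>\<^bsub>M\<^esub>s\<in>?A. a \<odot>\<^bsub>M\<^esub> (\<phi> s \<odot>\<^bsub>M\<^esub> h s))"
    by (rule M.finsum_cong') (use A a h in \<open>auto simp: smult_assoc1\<close>)
  also have "\<dots> = a \<odot>\<^bsub>M\<^esub> lin_ext R M h \<phi>"
    unfolding lin_ext_def by (rule finsum_smult_ldistr[symmetric]) (use A a h in auto)
  finally show "lin_ext R M h (a \<odot>\<^bsub>free_on R S\<^esub> \<phi>) = a \<odot>\<^bsub>M\<^esub> lin_ext R M h \<phi>" by simp
next
  fix \<phi> \<psi> assume p: "\<phi> \<in> carrier (free_on R S)" and q: "\<psi> \<in> carrier (free_on R S)"
  let ?A = "{s. \<phi> s \<noteq> \<zero>} \<union> {s. \<psi> s \<noteq> \<zero>}"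
  have A: "finite ?A" "?A \<subseteq> S" "\<And>s. \<phi> s \<in> carrier R" "\<And>s. \<psi> s \<in> carrier R" using p q by (auto simp: free_on_carrier)
  then have h': "h s \<in> carrier M" if "s \<in> ?A" for s using that h by blast
  have "lin_ext R M h (\<lambda>s. \<phi> s \<oplus> \<psi> s) = (\<Oplus>\<^bsub>M\<^esub>s\<in>?A. (\<phi> s \<oplus> \<psi> s) \<odot>\<^bsub>M\<^esub> h s)"
    by (rule lin_ext_eq_finsum) (use A(1,3,4) h' in auto)
  also have "\<dots> = (\<Oplus>\<^bsub>M\<^esub>s\<in>?A. \<phi> s \<odot>\<^bsub>M\<^esub> h s \<oplus>\<^bsub>M\<^esub> \<psi> s \<odot>\<^bsub>M\<^esub> h s)"
    by (rule M.finsum_cong') (use A(3,4) h' in \<open>simp_all add: smult_l_distr\<close>)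
  also have "\<dots> = (\<Oplus>\<^bsub>M\<^esub>s\<in>?A. \<phi> s \<odot>\<^bsub>M\<^esub> h s) \<oplus>\<^bsub>M\<^esub> (\<Oplus>\<^bsub>M\<^esub>s\<in>?A. \<psi> s \<odot>\<^bsub>M\<^esub> h s)"
    by (rule M.finsum_addf) (use A(3,4) h' in auto)
  also have "(\<Oplus>\<^bsub>M\<^esub>s\<in>?A. \<phi> s \<odot>\<^bsub>M\<^esub> h s) = lin_ext R M h \<phi>"
    by (rule lin_ext_eq_finsum[symmetric]) (use A(1,3,4) h' in auto)
  also have "(\<Oplus>\<^bsub>M\<^esub>s\<in>?A. \<psi> s \<odot>\<^bsub>M\<^esub> h s) = lin_ext R M h \<psi>"
    by (rule lin_ext_eq_finsum[symmetric]) (use A(1,3,4) h' in auto)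
  finally show "lin_ext R M h (\<phi> \<oplus>\<^bsub>free_on R S\<^esub> \<psi>) = lin_ext R M h \<phi> \<oplus>\<^bsub>M\<^esub> lin_ext R M h \<psi>" by simp
qed

lemma single_carrier: "s \<in> S \<Longrightarrow> single R s \<in> carrier (free_on R S)"
  by (auto simp: free_on_carrier single_def)

lemma lin_ext_single:
  assumes "h s \<in> carrier M"
  shows "lin_ext R M h (single R s) = h s"
proof -
  have "lin_ext R M h (single R s) = (\<Oplus>\<^bsub>M\<^esub>t\<in>{s}. single R s t \<odot>\<^bsub>M\<^esub> h t)"
    by (rule lin_ext_eq_finsum) (use assms in \<open>auto simp: single_def\<close>)
  then show ?thesis using assms by (simp add: single_def)
qed

end

lemma (in cring) free_on_expand:
  assumes \<phi>: "\<phi> \<in> carrier (free_on R S)"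
  shows "\<phi> = (\<Oplus>\<^bsub>free_on R S\<^esub>s\<in>{s. \<phi> s \<noteq> \<zero>}. \<phi> s \<odot>\<^bsub>free_on R S\<^esub> single R s)"
proof -
  interpret F: module R "free_on R S" by (rule module_free_on) unfold_locales
  have ev: "finsum (free_on R S) (\<lambda>s. \<phi> s \<odot>\<^bsub>free_on R S\<^esub> single R s) A t = (if t \<in> A then \<phi> t else \<zero>)"
    if "finite A" "A \<subseteq> S" for A t
    using that
  proof (induct A)
    case empty show ?case by simp
  next
    case (insert a A)
    then have c: "(\<lambda>s. \<phi> s \<odot>\<^bsub>free_on R S\<^esub> single R s) \<in> insert a A \<rightarrow> carrier (free_on R S)"
      using \<phi> by (intro Pi_I F.smult_closed F.single_carrier) (auto simp: free_on_carrier)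
    with insert have "finsum (free_on R S) (\<lambda>s. \<phi> s \<odot>\<^bsub>free_on R S\<^esub> single R s) (insert a A) =
       \<phi> a \<odot>\<^bsub>free_on R S\<^esub> single R a \<oplus>\<^bsub>free_on R S\<^esub> finsum (free_on R S) (\<lambda>s. \<phi> s \<odot>\<^bsub>free_on R S\<^esub> single R s) A"
      by (intro F.M.finsum_insert) (auto simp del: free_on_sel)
    with insert \<phi> show ?case by (auto simp: single_def free_on_carrier)
  qed
  show ?thesis
  proof
    fix t
    show "\<phi> t = (\<Oplus>\<^bsub>free_on R S\<^esub>s\<in>{s. \<phi> s \<noteq> \<zero>}. \<phi> s \<odot>\<^bsub>free_on R S\<^esub> single R s) t"
      by (subst ev) (use \<phi> in \<open>auto simp: free_on_carrier\<close>)
  qed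
qed

lemma (in cring) free_on_induct:
  assumes \<phi>: "\<phi> \<in> carrier (free_on R S)" and H: "submodule H R (free_on R S)"
    and s: "\<And>s. s \<in> S \<Longrightarrow> single R s \<in> H"
  shows "\<phi> \<in> H"
proof -
  interpret F: module R "free_on R S" by (rule module_free_on) unfold_locales
  have "(\<Oplus>\<^bsub>free_on R S\<^esub>s\<in>{s. \<phi> s \<noteq> \<zero>}. \<phi> s \<odot>\<^bsub>free_on R S\<^esub> single R s) \<in> H"
    by (rule F.submodule_finsum[OF H], rule F.submoduleE(4)[OF H]) (use \<phi> s in \<open>auto simp: free_on_carrier\<close>)
  then show ?thesis using free_on_expand[OF \<phi>] by simp
qed

section \<open>Iterated extensions by \<open>R/I\<close>\<close>

text \<open>The map sending \<open>r\<close> to \<open>r b\<close> identifies \<open>R/I\<close>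
  with \<open>Z/Y\<close> in each step. All stages are submodules of one ambient module above the
  floor \<open>D\<close>, so that \<open>Z/D\<close> is filtered without forming quotient modules,
  whose types would change.\<close>

inductive qfilt :: "('a, 'm) ring_scheme \<Rightarrow> 'a set \<Rightarrow> ('a, 'b, 'n) module_scheme \<Rightarrow> 'b set \<Rightarrow> 'b set \<Rightarrow> bool"
  for R I M D where
    qfilt_refl: "submodule D R M \<Longrightarrow> qfilt R I M D D"
  | qfilt_step: "qfilt R I M D Y \<Longrightarrow> submodule Z R M \<Longrightarrow> Y \<subseteq> Z \<Longrightarrow> b \<in> Z \<Longrightarrow>
      (\<And>z. z \<in> Z \<Longrightarrow> \<exists>r\<in>carrier R. z \<ominus>\<^bsub>M\<^esub> r \<odot>\<^bsub>M\<^esub> b \<in> Y) \<Longrightarrow>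
      (\<And>r. r \<in> carrier R \<Longrightarrow> r \<odot>\<^bsub>M\<^esub> b \<in> Y \<longleftrightarrow> r \<in> I) \<Longrightarrow> qfilt R I M D Z"

lemma qfilt_trans:
  assumes "qfilt R I M Y Z" "qfilt R I M D Y"
  shows "qfilt R I M D Z"
  using assms by induct (auto intro: qfilt_step)

lemma qfilt_submodule: "qfilt R I M D Z \<Longrightarrow> submodule D R M \<and> submodule Z R M \<and> D \<subseteq> Z"
  by (induct rule: qfilt.induct) auto

text \<open>
  A linear correspondence between \<open>Z\<close> and \<open>Z'\<close> that is total on both sides and matches \<open>D\<close> with
  \<open>D'\<close> amounts to an isomorphism \<open>Z/D \<rightarrow> Z'/D'\<close> for which no map \<open>Z \<rightarrow> Z'\<close> has to be chosen.
\<close>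

lemma qfilt_transport:
  fixes M :: "('a, 'b, 'n) module_scheme" and M' :: "('a, 'c, 'k) module_scheme" 
  assumes M: "module R M" and M': "module R M'"
    and filt: "qfilt R I M D Z" and D': "submodule D' R M'" "D' \<subseteq> Z'"
    and dom: "\<And>x y. \<rho> x y \<Longrightarrow> x \<in> Z \<and> y \<in> Z'" and Z': "Z' \<subseteq> carrier M'"
    and add: "\<And>x y x' y'. \<rho> x y \<Longrightarrow> \<rho> x' y' \<Longrightarrow> \<rho> (x \<oplus>\<^bsub>M\<^esub> x') (y \<oplus>\<^bsub>M'\<^esub> y')"
    and smult: "\<And>a x y. a \<in> carrier R \<Longrightarrow> \<rho> x y \<Longrightarrow> \<rho> (a \<odot>\<^bsub>M\<^esub> x) (a \<odot>\<^bsub>M'\<^esub> y)"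
    and left: "\<And>x. x \<in> Z \<Longrightarrow> \<exists>y. \<rho> x y" and right: "\<And>y. y \<in> Z' \<Longrightarrow> \<exists>x. \<rho> x y"
    and iff: "\<And>x y. \<rho> x y \<Longrightarrow> x \<in> D \<longleftrightarrow> y \<in> D'"
  shows "qfilt R I M' D' Z'"
proof -
  interpret M: module R M by fact
  interpret M': module R M' by fact
  have ZM: "submodule Z R M" and DZ: "D \<subseteq> Z" using qfilt_submodule[OF filt] by auto
  have car: "x \<in> carrier M" "y \<in> carrier M'" if "\<rho> x y" for x y
    using dom[OF that] Z' M.submodule_carrier[OF ZM] by auto
  have sub: "\<rho> (x \<ominus>\<^bsub>M\<^esub> x') (y \<ominus>\<^bsub>M'\<^esub> y')" if "\<rho> x y" "\<rho> x' y'" for x y x' y'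
  proof -
    have "\<rho> (x \<oplus>\<^bsub>M\<^esub> (\<ominus>\<^bsub>R\<^esub> \<one>\<^bsub>R\<^esub>) \<odot>\<^bsub>M\<^esub> x') (y \<oplus>\<^bsub>M'\<^esub> (\<ominus>\<^bsub>R\<^esub> \<one>\<^bsub>R\<^esub>) \<odot>\<^bsub>M'\<^esub> y')" using that by (intro add smult) auto
    then show ?thesis using car[OF that(2)] by (simp add: M.smult_l_minus M'.smult_l_minus a_minus_def)
  qed
  have main: "qfilt R I M' D' {y. \<exists>x\<in>Y. \<rho> x y}" if "qfilt R I M D Y" "Y \<subseteq> Z" for Y
    using that
  proof (induct rule: qfilt.induct)
    case qfilt_refl
    have "{y. \<exists>x\<in>D. \<rho> x y} = D'" using iff right D'(2) by blast
    then show ?case using D' by (simp add: qfilt.qfilt_refl)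
  next
    case (qfilt_step Y Y1 b)
    note Y = qfilt_submodule[OF qfilt_step(1)] and Y1 = qfilt_step(3)
    let ?Y' = "{y. \<exists>x\<in>Y. \<rho> x y}" and ?Y1' = "{y. \<exists>x\<in>Y1. \<rho> x y}"
    have YZ: "Y \<subseteq> Z" using qfilt_step(4,8) by simp
    obtain b' where b': "\<rho> b b'" using left qfilt_step(5,8) by blast
    note main = qfilt_step(2)[OF YZ]
    have "submodule ?Y1' R M'"
    proof (rule M'.submoduleI')
      show "?Y1' \<subseteq> carrier M'" using car(2) by blast
      show "\<zero>\<^bsub>M'\<^esub> \<in> ?Y1'"
        using M'.submodule_zero[of ?Y'] qfilt_submodule[OF main] qfilt_step(4) by blast
      show "x \<oplus>\<^bsub>M'\<^esub> y \<in> ?Y1'" if "x \<in> ?Y1'" "y \<in> ?Y1'" for x y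
        using that add M.submodule_closed(5)[OF Y1] by blast
      show "a \<odot>\<^bsub>M'\<^esub> x \<in> ?Y1'" if "a \<in> carrier R" "x \<in> ?Y1'" for a x
        using that smult M.submodule_closed(4)[OF Y1] by blast
    qed
    moreover have "\<exists>r\<in>carrier R. z \<ominus>\<^bsub>M'\<^esub> r \<odot>\<^bsub>M'\<^esub> b' \<in> ?Y'" if z: "z \<in> ?Y1'" for z
    proof -
      obtain x where x: "x \<in> Y1" "\<rho> x z" using z by blast
      obtain r where r: "r \<in> carrier R" "x \<ominus>\<^bsub>M\<^esub> r \<odot>\<^bsub>M\<^esub> b \<in> Y" using qfilt_step(6)[OF x(1)] by blast
      show ?thesis using sub[OF x(2) smult[OF r(1) b']] r by blast
    qed
    moreover have "r \<odot>\<^bsub>M'\<^esub> b' \<in> ?Y' \<longleftrightarrow> r \<in> I" if r: "r \<in> carrier R" for r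
    proof -
      have rb: "\<rho> (r \<odot>\<^bsub>M\<^esub> b) (r \<odot>\<^bsub>M'\<^esub> b')" by (rule smult[OF r b'])
      \<comment> \<open>An element of \<open>Y\<close> related to \<open>r b'\<close> may differ
        from \<open>r b\<close>, but the difference is related to zero and hence lies in
        \<open>D\<close>, which is contained in \<open>Y\<close>.\<close>
      have "r \<odot>\<^bsub>M\<^esub> b \<in> Y" if "\<rho> y (r \<odot>\<^bsub>M'\<^esub> b')" "y \<in> Y" for y
      proof -
        have "\<rho> (r \<odot>\<^bsub>M\<^esub> b \<ominus>\<^bsub>M\<^esub> y) (r \<odot>\<^bsub>M'\<^esub> b' \<ominus>\<^bsub>M'\<^esub> r \<odot>\<^bsub>M'\<^esub> b')" by (rule sub[OF rb that(1)])
        then have "\<rho> (r \<odot>\<^bsub>M\<^esub> b \<ominus>\<^bsub>M\<^esub> y) \<zero>\<^bsub>M'\<^esub>" using car[OF rb] by (simp add: M'.M.r_neg a_minus_def)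
        then have "r \<odot>\<^bsub>M\<^esub> b \<ominus>\<^bsub>M\<^esub> y \<in> D" using iff[of _ "\<zero>\<^bsub>M'\<^esub>"] M'.submodule_zero[OF D'(1)] by simp
        then have "(r \<odot>\<^bsub>M\<^esub> b \<ominus>\<^bsub>M\<^esub> y) \<oplus>\<^bsub>M\<^esub> y \<in> Y" using Y that(2) by (auto intro: M.submodule_closed(5))
        moreover have "(r \<odot>\<^bsub>M\<^esub> b \<ominus>\<^bsub>M\<^esub> y) \<oplus>\<^bsub>M\<^esub> y = r \<odot>\<^bsub>M\<^esub> b"
          using car(1)[OF rb] car(1)[OF that(1)] by algebra
        ultimately show ?thesis by simp
      qed
      then show ?thesis using rb unfolding qfilt_step(7)[OF r, symmetric] by auto
    qed
    ultimately show ?case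
      by (intro qfilt.qfilt_step[OF main, of _ b']) (use qfilt_step(4,5) b' in auto)
  qed
  have "{y. \<exists>x\<in>Z. \<rho> x y} = Z'" using dom right by blast
  then show ?thesis using main[OF filt subset_refl] by simp
qed

text \<open>For \<open>Y\<close> killed by \<open>I\<close> this is a finite basis over
  \<open>R/I\<close>, written with coefficients in \<open>R\<close>: independence only asks the
  coefficients of a relation to lie in \<open>I\<close>.\<close>

definition basis_mod ::
  "('a, 'm) ring_scheme \<Rightarrow> 'a set \<Rightarrow> ('a, 'b, 'n) module_scheme \<Rightarrow> 'b set \<Rightarrow> 'b set \<Rightarrow> bool"
  where "basis_mod R I M B Y \<longleftrightarrow> finite B \<and> B \<subseteq> carrier M \<and>
    (\<forall>y\<in>Y. \<exists>c\<in>B \<rightarrow> carrier R. y = (\<Oplus>\<^bsub>M\<^esub>b\<in>B. c b \<odot>\<^bsub>M\<^esub> b)) \<and>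
    (\<forall>c\<in>B \<rightarrow> carrier R. (\<Oplus>\<^bsub>M\<^esub>b\<in>B. c b \<odot>\<^bsub>M\<^esub> b) \<in> Y) \<and>
    (\<forall>c\<in>B \<rightarrow> carrier R. (\<Oplus>\<^bsub>M\<^esub>b\<in>B. c b \<odot>\<^bsub>M\<^esub> b) = \<zero>\<^bsub>M\<^esub> \<longrightarrow> (\<forall>b\<in>B. c b \<in> I))"

text \<open>Each new generator joins the basis. In a relation its coefficient carries it into
  \<open>Y\<close>, hence lies in \<open>I\<close>; since \<open>I\<close> kills \<open>M\<close>,
  that term is zero and a relation among the old generators remains. This is where the extensions by
  \<open>R/I\<close> split.\<close>

lemma (in module) qfilt_basis:
  assumes I: "ideal I R" and killed: "killed_by I M"
    and filt: "qfilt R I M {\<zero>\<^bsub>M\<^esub>} Y"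
  shows "\<exists>B. basis_mod R I M B Y"
  using filt
proof (induct rule: qfilt.induct)
  case qfilt_refl
  show ?case by (rule exI[of _ "{}"]) (auto simp: basis_mod_def)
next
  case (qfilt_step Y Z b)
  note Y = qfilt_submodule[OF qfilt_step(1)] and Z = qfilt_step(3) and b = submodule_carrier[OF qfilt_step(3,5)]
  obtain B where B: "finite B" "B \<subseteq> carrier M"
    and gen: "\<And>y. y \<in> Y \<Longrightarrow> \<exists>c\<in>B \<rightarrow> carrier R. y = (\<Oplus>\<^bsub>M\<^esub>b\<in>B. c b \<odot>\<^bsub>M\<^esub> b)"
    and sub: "\<And>c. c \<in> B \<rightarrow> carrier R \<Longrightarrow> (\<Oplus>\<^bsub>M\<^esub>b\<in>B. c b \<odot>\<^bsub>M\<^esub> b) \<in> Y"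
    and ind: "\<And>c x. c \<in> B \<rightarrow> carrier R \<Longrightarrow> (\<Oplus>\<^bsub>M\<^esub>b\<in>B. c b \<odot>\<^bsub>M\<^esub> b) = \<zero>\<^bsub>M\<^esub> \<Longrightarrow> x \<in> B \<Longrightarrow> c x \<in> I"
    using qfilt_step(2) unfolding basis_mod_def by (elim exE conjE) (rule that, assumption+, (erule bspec, assumption)+, simp)
  show ?case
  proof (cases "b \<in> Y")
    \<comment> \<open>Here \<open>I\<close> is the whole ring, which a regular sequence is allowed
      to generate; the step then adds nothing.\<close>
    case True
    have "z \<in> Y" if z: "z \<in> Z" for z
    proof -
      obtain r where r: "r \<in> carrier R" "z \<ominus>\<^bsub>M\<^esub> r \<odot>\<^bsub>M\<^esub> b \<in> Y" using qfilt_step(6)[OF z] by blast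
      then have "(z \<ominus>\<^bsub>M\<^esub> r \<odot>\<^bsub>M\<^esub> b) \<oplus>\<^bsub>M\<^esub> r \<odot>\<^bsub>M\<^esub> b \<in> Y" using Y True by (simp add: submodule_closed)
      moreover have "(z \<ominus>\<^bsub>M\<^esub> r \<odot>\<^bsub>M\<^esub> b) \<oplus>\<^bsub>M\<^esub> r \<odot>\<^bsub>M\<^esub> b = z" using r(1) b submodule_carrier[OF Z z] by algebra
      ultimately show ?thesis by simp
    qed
    then have "Z = Y" using qfilt_step(4) by blast
    then show ?thesis using B gen sub ind by (intro exI[of _ B]) (simp add: basis_mod_def)
  next
    case False
    have lc: "c b' \<odot>\<^bsub>M\<^esub> b' \<in> carrier M" if "c \<in> B \<rightarrow> carrier R" "b' \<in> B" for c b'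
      using that B by auto
    have bB: "b \<notin> B"
    proof
      assume "b \<in> B"
      \<comment> \<open>The indicator of \<open>b\<close> writes \<open>b\<close> as a combination
        of \<open>B\<close>, which would put it into \<open>Y\<close>.\<close>
      define c where "c = (\<lambda>b'. if b' = b then \<one> else \<zero>)"
      have "(\<Oplus>\<^bsub>M\<^esub>b\<in>B. c b \<odot>\<^bsub>M\<^esub> b) = (\<Oplus>\<^bsub>M\<^esub>b\<in>{b}. c b \<odot>\<^bsub>M\<^esub> b)"
        by (rule M.add.finprod_mono_neutral_cong_right) (use B \<open>b \<in> B\<close> in \<open>auto simp: c_def\<close>)
      moreover have "\<dots> = b" using b by (simp add: c_def)
      ultimately show False using sub[of c] False by (auto simp: c_def)
    qed
    have ext: "(\<Oplus>\<^bsub>M\<^esub>b\<in>insert b B. c b \<odot>\<^bsub>M\<^esub> b) = (\<Oplus>\<^bsub>M\<^esub>b\<in>B. c b \<odot>\<^bsub>M\<^esub> b) \<oplus>\<^bsub>M\<^esub> c b \<odot>\<^bsub>M\<^esub> b"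
      if c: "c \<in> insert b B \<rightarrow> carrier R" for c
    proof -
      have "(\<Oplus>\<^bsub>M\<^esub>b\<in>B. c b \<odot>\<^bsub>M\<^esub> b) \<in> carrier M" using c B by (intro M.finsum_closed) auto
      then show ?thesis using c bB B b
        by (subst M.finsum_insert) (auto intro: M.a_comm)
    qed
    show ?thesis unfolding basis_mod_def
    proof (intro exI[of _ "insert b B"] conjI ballI impI)
      show "finite (insert b B)" "insert b B \<subseteq> carrier M" using B b by auto
    next
      fix z assume zZ: "z \<in> Z"
      then obtain r where r: "r \<in> carrier R" "z \<ominus>\<^bsub>M\<^esub> r \<odot>\<^bsub>M\<^esub> b \<in> Y" using qfilt_step(6) by blast
      define y where "y = z \<ominus>\<^bsub>M\<^esub> r \<odot>\<^bsub>M\<^esub> b"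
      have z: "z = y \<oplus>\<^bsub>M\<^esub> r \<odot>\<^bsub>M\<^esub> b" "y \<in> Y" "r \<in> carrier R"
        unfolding y_def using r b submodule_carrier[OF Z zZ] by (algebra, simp_all)
      obtain c where c: "c \<in> B \<rightarrow> carrier R" "y = (\<Oplus>\<^bsub>M\<^esub>b\<in>B. c b \<odot>\<^bsub>M\<^esub> b)" using gen[OF z(2)] by blast
      have e: "(\<Oplus>\<^bsub>M\<^esub>b'\<in>B. (c(b := r)) b' \<odot>\<^bsub>M\<^esub> b') = y" unfolding c(2)
        by (rule M.finsum_cong') (use c bB B in auto)
      have "z = (\<Oplus>\<^bsub>M\<^esub>b'\<in>insert b B. (c(b := r)) b' \<odot>\<^bsub>M\<^esub> b')"
        by (subst ext) (use c z(3) e in \<open>auto simp: z(1)\<close>)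
      moreover have "c(b := r) \<in> insert b B \<rightarrow> carrier R" using c z(3) by auto
      ultimately show "\<exists>c\<in>insert b B \<rightarrow> carrier R. z = (\<Oplus>\<^bsub>M\<^esub>b\<in>insert b B. c b \<odot>\<^bsub>M\<^esub> b)" by blast
    next
      fix c assume c: "c \<in> insert b B \<rightarrow> carrier R"
      then show "(\<Oplus>\<^bsub>M\<^esub>b\<in>insert b B. c b \<odot>\<^bsub>M\<^esub> b) \<in> Z" unfolding ext[OF c]
        using sub[of c] qfilt_step(4,5) by (intro submodule_closed(4,5)[OF Z]) auto
    next
      fix c x assume c: "c \<in> insert b B \<rightarrow> carrier R" and z: "(\<Oplus>\<^bsub>M\<^esub>b\<in>insert b B. c b \<odot>\<^bsub>M\<^esub> b) = \<zero>\<^bsub>M\<^esub>"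
        and x: "x \<in> insert b B"
      have cB: "c \<in> B \<rightarrow> carrier R" and cb: "c b \<in> carrier R" using c by auto
      have s: "(\<Oplus>\<^bsub>M\<^esub>b\<in>B. c b \<odot>\<^bsub>M\<^esub> b) \<in> Y" (is "?s \<in> Y") using sub[OF cB] .
      then have sM: "?s \<in> carrier M" using Y submodule_carrier by blast
      have "c b \<odot>\<^bsub>M\<^esub> b = \<ominus>\<^bsub>M\<^esub> ?s" using z unfolding ext[OF c]
        using M.minus_equality[of "c b \<odot>\<^bsub>M\<^esub> b" ?s] sM cb b by (simp add: M.a_comm)
      then have "c b \<odot>\<^bsub>M\<^esub> b \<in> Y" using s Y submodule_closed(3)[of Y] by auto
      then have cI: "c b \<in> I" using qfilt_step(7)[OF cb] by simp
      then have "c b \<odot>\<^bsub>M\<^esub> b = \<zero>\<^bsub>M\<^esub>" using killed b by (auto simp: killed_by_def)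
      then have "?s = \<zero>\<^bsub>M\<^esub>" using z sM unfolding ext[OF c] by simp
      then show "c x \<in> I" using ind[OF cB] x cI by blast
    qed
  qed
qed

section \<open>Modules over the quotient ring\<close>

lemma quot_scalars_sel [simp]:
  "carrier (quot_scalars M) = carrier M" "\<zero>\<^bsub>quot_scalars M\<^esub> = \<zero>\<^bsub>M\<^esub>"
  "x \<oplus>\<^bsub>quot_scalars M\<^esub> y = x \<oplus>\<^bsub>M\<^esub> y"
  by (simp_all add: quot_scalars_def)

lemma (in cring) quot_carrier: "carrier (R Quot I) = (\<lambda>r. I +> r) ` carrier R"
  by (auto simp: FactRing_def A_RCOSETS_def')

lemma quot_zero: "\<zero>\<^bsub>R Quot I\<^esub> = I" and quot_one: "\<one>\<^bsub>R Quot I\<^esub> = I +>\<^bsub>R\<^esub> \<one>\<^bsub>R\<^esub>"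
  by (simp_all add: FactRing_def)

lemma (in cring) quot_sel:
  assumes I: "ideal I R" and r: "r \<in> carrier R" and s: "s \<in> carrier R"
  shows "(I +> r) \<oplus>\<^bsub>R Quot I\<^esub> (I +> s) = I +> (r \<oplus> s)"
    and "(I +> r) \<otimes>\<^bsub>R Quot I\<^esub> (I +> s) = I +> (r \<otimes> s)"
    and "I +> r = I \<longleftrightarrow> r \<in> I"
    and "I +> r = I +> s \<longleftrightarrow> r \<ominus> s \<in> I"
proof -
  interpret I: ideal I R by fact
  show "(I +> r) \<oplus>\<^bsub>R Quot I\<^esub> (I +> s) = I +> (r \<oplus> s)"
    using r s by (simp add: FactRing_def I.a_rcos_sum)
  show "(I +> r) \<otimes>\<^bsub>R Quot I\<^esub> (I +> s) = I +> (r \<otimes> s)"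
    using r s by (simp add: FactRing_def I.rcoset_mult_add)
  show "I +> r = I +> s \<longleftrightarrow> r \<ominus> s \<in> I"
    using quotient_eq_iff_same_a_r_cos[OF I r s] by simp
  have "I +> r = I +> \<zero> \<longleftrightarrow> r \<ominus> \<zero> \<in> I"
    using quotient_eq_iff_same_a_r_cos[OF I r zero_closed] by simp
  moreover have "I +> \<zero> = I" by (rule a_coset_add_zero) (use I.Icarr in auto)
  moreover have "r \<ominus> \<zero> = r" using r by algebra
  ultimately show "I +> r = I \<longleftrightarrow> r \<in> I" by simp
qed

context module
begin

context
  fixes I assumes I: "ideal I R" and killed: "killed_by I M"
begin

lemma quot_scalars_smult:
  assumes r: "r \<in> carrier R" and x: "x \<in> carrier M"
  shows "(I +> r) \<odot>\<^bsub>quot_scalars M\<^esub> x = r \<odot>\<^bsub>M\<^esub> x"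
proof -
  interpret I: ideal I R by (rule I)
  have "s \<odot>\<^bsub>M\<^esub> x = r \<odot>\<^bsub>M\<^esub> x" if s: "s \<in> I +> r" for s
  proof -
    obtain i where i: "i \<in> I" "s = i \<oplus> r" using s by (auto simp: a_r_coset_def')
    moreover have "i \<odot>\<^bsub>M\<^esub> x = \<zero>\<^bsub>M\<^esub>" using killed i x by (auto simp: killed_by_def)
    ultimately show ?thesis using r x by (simp add: smult_l_distr I.Icarr)
  qed
  moreover have "r \<in> I +> r" using I.a_rcos_self[OF r] .
  ultimately have "(\<lambda>s. s \<odot>\<^bsub>M\<^esub> x) ` (I +> r) = {r \<odot>\<^bsub>M\<^esub> x}" by blast
  then show ?thesis by (simp add: quot_scalars_def)
qed

lemma module_quot_scalars: "module (R Quot I) (quot_scalars M)"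
proof (rule moduleI)
  show "cring (R Quot I)" by (rule ideal.quotient_is_cring[OF I is_cring])
  show "abelian_group (quot_scalars M)"
  proof (rule abelian_groupI)
    fix x assume "x \<in> carrier (quot_scalars M)"
    then show "\<exists>y\<in>carrier (quot_scalars M). y \<oplus>\<^bsub>quot_scalars M\<^esub> x = \<zero>\<^bsub>quot_scalars M\<^esub>"
      by (intro bexI[of _ "\<ominus>\<^bsub>M\<^esub> x"]) (auto simp: M.l_neg)
  qed (auto simp: M.a_ac)
qed (auto simp: quot_carrier quot_one quot_sel[OF I] quot_scalars_smult smult_l_distr smult_r_distr smult_assoc1)

lemma finsum_quot_scalars: "finsum (quot_scalars M) f A = finsum M f A"
  by (simp add: finsum_def finprod_def quot_scalars_def)

lemma qfilt_imp_free_over_quot: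
  assumes filt: "qfilt R I M {\<zero>\<^bsub>M\<^esub>} (carrier M)"
  shows "free_over_quot R I M"
proof -
  interpret I: ideal I R by (rule I)
  interpret Q: module "R Quot I" "quot_scalars M" by (rule module_quot_scalars)
  obtain B where bas: "basis_mod R I M B (carrier M)" using qfilt_basis[OF I killed filt] by blast
  have B: "finite B" "B \<subseteq> carrier M"
    and gen: "\<And>y. y \<in> carrier M \<Longrightarrow> \<exists>c\<in>B \<rightarrow> carrier R. y = (\<Oplus>\<^bsub>M\<^esub>b\<in>B. c b \<odot>\<^bsub>M\<^esub> b)"
    and ind: "\<And>c x. c \<in> B \<rightarrow> carrier R \<Longrightarrow> (\<Oplus>\<^bsub>M\<^esub>b\<in>B. c b \<odot>\<^bsub>M\<^esub> b) = \<zero>\<^bsub>M\<^esub> \<Longrightarrow> x \<in> B \<Longrightarrow> c x \<in> I"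
    using bas unfolding basis_mod_def by simp_all
  have le: "lin_ext (R Quot I) (quot_scalars M) (\<lambda>b. b) \<gamma> = (\<Oplus>\<^bsub>M\<^esub>b\<in>B. c b \<odot>\<^bsub>M\<^esub> b)"
    if c: "c \<in> B \<rightarrow> carrier R" and \<gamma>: "\<And>b. \<gamma> b = (if b \<in> B then I +> c b else I)" for c \<gamma>
  proof -
    have "lin_ext (R Quot I) (quot_scalars M) (\<lambda>b. b) \<gamma> = (\<Oplus>\<^bsub>quot_scalars M\<^esub>b\<in>B. \<gamma> b \<odot>\<^bsub>quot_scalars M\<^esub> b)"
      by (rule Q.lin_ext_eq_finsum) (use B c in \<open>auto simp: \<gamma> quot_carrier quot_zero split: if_splits\<close>)
    also have "\<dots> = (\<Oplus>\<^bsub>quot_scalars M\<^esub>b\<in>B. c b \<odot>\<^bsub>M\<^esub> b)"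
      by (rule Q.M.finsum_cong') (use B c in \<open>auto simp: \<gamma> quot_scalars_smult Pi_iff subset_iff\<close>)
    finally show ?thesis by (simp add: finsum_quot_scalars)
  qed
  have "is_basis (R Quot I) (quot_scalars M) B"
    unfolding is_basis_def
  proof (intro conjI ballI)
    show "B \<subseteq> carrier (quot_scalars M)" using B by simp
    fix x assume "x \<in> carrier (quot_scalars M)"
    then obtain c where c: "c \<in> B \<rightarrow> carrier R" "x = (\<Oplus>\<^bsub>M\<^esub>b\<in>B. c b \<odot>\<^bsub>M\<^esub> b)" using gen by auto
    \<comment> \<open>Outside \<open>B\<close> the value is \<open>I\<close>, the zero of the
      quotient ring, as membership in \<open>free_on\<close> demands.\<close>
    define \<gamma> where "\<gamma> b = (if b \<in> B then I +> c b else I)" for b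
    show "\<exists>!c. c \<in> carrier (free_on (R Quot I) B) \<and> lin_ext (R Quot I) (quot_scalars M) (\<lambda>b. b) c = x"
    proof (intro ex1I[of _ \<gamma>] conjI)
      have "I \<in> carrier (R Quot I)" using Q.R.zero_closed by (simp add: quot_zero)
      moreover have "{s. \<gamma> s \<noteq> I} \<subseteq> B" by (auto simp: \<gamma>_def)
      ultimately show "\<gamma> \<in> carrier (free_on (R Quot I) B)"
        using B c(1) by (auto simp: free_on_carrier quot_zero \<gamma>_def quot_carrier intro: finite_subset)
      show "lin_ext (R Quot I) (quot_scalars M) (\<lambda>b. b) \<gamma> = x"
        unfolding c(2) by (rule le) (use c in \<open>auto simp: \<gamma>_def\<close>)
    next
      fix \<delta> assume \<delta>: "\<delta> \<in> carrier (free_on (R Quot I) B) \<and> lin_ext (R Quot I) (quot_scalars M) (\<lambda>b. b) \<delta> = x"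
      then have "\<forall>b. \<exists>r\<in>carrier R. \<delta> b = I +> r"
        by (auto simp: free_on_carrier quot_carrier image_iff)
      \<comment> \<open>Representatives of the competing coefficients: their differences from
        \<open>c\<close> form a relation over \<open>R\<close>, so they lie in \<open>I\<close> and
        the cosets agree.\<close>
      then obtain d where d: "\<And>b. d b \<in> carrier R" "\<And>b. \<delta> b = I +> d b" by metis
      have out: "\<delta> b = I" if "b \<notin> B" for b using \<delta> that by (auto simp: free_on_carrier quot_zero)
      have "lin_ext (R Quot I) (quot_scalars M) (\<lambda>b. b) \<delta> = (\<Oplus>\<^bsub>M\<^esub>b\<in>B. d b \<odot>\<^bsub>M\<^esub> b)"
        by (rule le) (use d out in auto)
      then have dx: "x = (\<Oplus>\<^bsub>M\<^esub>b\<in>B. d b \<odot>\<^bsub>M\<^esub> b)" using \<delta> by simp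
      have mem: "(\<lambda>b. e b \<odot>\<^bsub>M\<^esub> b) \<in> B \<rightarrow> carrier M" if "e \<in> B \<rightarrow> carrier R" for e
        using that B by auto
      have dB: "d \<in> B \<rightarrow> carrier R" "(\<lambda>b. \<ominus> c b) \<in> B \<rightarrow> carrier R" "(\<lambda>b. d b \<ominus> c b) \<in> B \<rightarrow> carrier R"
        using d c by auto
      have "(\<Oplus>\<^bsub>M\<^esub>b\<in>B. (d b \<ominus> c b) \<odot>\<^bsub>M\<^esub> b) \<oplus>\<^bsub>M\<^esub> (\<Oplus>\<^bsub>M\<^esub>b\<in>B. c b \<odot>\<^bsub>M\<^esub> b)
          = (\<Oplus>\<^bsub>M\<^esub>b\<in>B. (d b \<ominus> c b) \<odot>\<^bsub>M\<^esub> b \<oplus>\<^bsub>M\<^esub> c b \<odot>\<^bsub>M\<^esub> b)"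
        by (rule M.finsum_addf[symmetric]) (use mem dB c in auto)
      also have "\<dots> = (\<Oplus>\<^bsub>M\<^esub>b\<in>B. d b \<odot>\<^bsub>M\<^esub> b)"
      proof (rule M.finsum_cong')
        fix b assume "b \<in> B"
        then have "b \<in> carrier M" "d b \<in> carrier R" "c b \<in> carrier R" using B d c by auto
        then show "(d b \<ominus> c b) \<odot>\<^bsub>M\<^esub> b \<oplus>\<^bsub>M\<^esub> c b \<odot>\<^bsub>M\<^esub> b = d b \<odot>\<^bsub>M\<^esub> b" by algebra
      qed (use mem dB in auto)
      finally have "(\<Oplus>\<^bsub>M\<^esub>b\<in>B. (d b \<ominus> c b) \<odot>\<^bsub>M\<^esub> b) \<oplus>\<^bsub>M\<^esub> x = x" using dx c(2) by simp
      moreover have "x \<in> carrier M" "(\<Oplus>\<^bsub>M\<^esub>b\<in>B. (d b \<ominus> c b) \<odot>\<^bsub>M\<^esub> b) \<in> carrier M"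
        unfolding dx using mem[OF dB(1)] mem[OF dB(3)] by (auto intro: M.finsum_closed)
      ultimately have "(\<Oplus>\<^bsub>M\<^esub>b\<in>B. (d b \<ominus> c b) \<odot>\<^bsub>M\<^esub> b) = \<zero>\<^bsub>M\<^esub>" by simp
      then have "d b \<ominus> c b \<in> I" if "b \<in> B" for b using ind[OF dB(3) _ that] by blast
      then have "\<delta> b = \<gamma> b" if "b \<in> B" for b
        using that d(2) quot_sel(4)[OF I d(1) funcset_mem[OF c(1) that], of b] by (simp add: \<gamma>_def)
      then show "\<delta> = \<gamma>" using out by (auto simp: fun_eq_iff \<gamma>_def)
    qed
  qed
  then show ?thesis
    using killed module_quot_scalars module_axioms by (auto simp: free_over_quot_def free_module_def)
qed

end
end

lemma short_exact_quot_scalars: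
  assumes I: "ideal I R" and ex: "short_exact R L M N f g"
    and k: "killed_by I L" "killed_by I M" "killed_by I N"
  shows "short_exact (R Quot I) (quot_scalars L) (quot_scalars M) (quot_scalars N) f g"
proof -
  interpret L: module R L using ex by (simp add: short_exact_def)
  interpret M: module R M using ex by (simp add: short_exact_def)
  interpret N: module R N using ex by (simp add: short_exact_def)
  have f: "f \<in> module_homs R L M" and g: "g \<in> module_homs R M N" using ex by (auto simp: short_exact_def)
  have "f \<in> module_homs (R Quot I) (quot_scalars L) (quot_scalars M)"
    by (rule module_homsI)
      (auto simp: L.quot_carrier L.quot_scalars_smult[OF I k(1)] M.quot_scalars_smult[OF I k(2)]
        hom_closed[OF f] hom_add[OF f] hom_smult[OF f])
  moreover have "g \<in> module_homs (R Quot I) (quot_scalars M) (quot_scalars N)"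
    by (rule module_homsI)
      (auto simp: L.quot_carrier M.quot_scalars_smult[OF I k(2)] N.quot_scalars_smult[OF I k(3)]
        hom_closed[OF g] hom_add[OF g] hom_smult[OF g])
  ultimately show ?thesis
    using ex L.module_quot_scalars[OF I k(1)] M.module_quot_scalars[OF I k(2)] N.module_quot_scalars[OF I k(3)]
    by (auto simp: short_exact_def a_kernel_def')
qed

text \<open>Meant for the graded piece, whose Tor has no description inside \<open>P\<close> and is
  filtered as the middle term of the exact sequence.\<close>

lemma qfilt_short_exact:
  assumes ex: "short_exact R L M N f g"
    and L: "qfilt R I L {\<zero>\<^bsub>L\<^esub>} (carrier L)" and N: "qfilt R I N {\<zero>\<^bsub>N\<^esub>} (carrier N)"
  shows "qfilt R I M {\<zero>\<^bsub>M\<^esub>} (carrier M)"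
proof -
  interpret LM: module_pair R L M using ex by (simp add: short_exact_def module_pair_def)
  interpret MN: module_pair R M N using ex by (simp add: short_exact_def module_pair_def)
  have mL: "module R L" and mM: "module R M" and mN: "module R N" using ex by (auto simp: short_exact_def)
  have f: "f \<in> module_homs R L M" and g: "g \<in> module_homs R M N" and inj: "inj_on f (carrier L)"
    and im: "f ` carrier L = a_kernel M N g" and sur: "g ` carrier M = carrier N"
    using ex by (auto simp: short_exact_def)
  have z: "f x = \<zero>\<^bsub>M\<^esub> \<longleftrightarrow> x = \<zero>\<^bsub>L\<^esub>" if "x \<in> carrier L" for x
    using inj_onD[OF inj, of x "\<zero>\<^bsub>L\<^esub>"] that LM.hom_zero[OF f] by auto
  have "qfilt R I M {\<zero>\<^bsub>M\<^esub>} (a_kernel M N g)"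
    by (rule qfilt_transport[OF mL mM L, where \<rho> = "\<lambda>x y. x \<in> carrier L \<and> y = f x"])
      (auto simp: im[symmetric] hom_closed[OF f] hom_add[OF f] hom_smult[OF f] z LM.N.zero_submodule
        intro: image_eqI[of _ f "\<zero>\<^bsub>L\<^esub>"] simp: LM.hom_zero[OF f])
  \<comment> \<open>The relation is the graph of \<open>g\<close> read backwards: an element of
    \<open>N\<close> is related to all its preimages, which spares the choice of a section.\<close>
  moreover have "qfilt R I M (a_kernel M N g) (carrier M)"
    by (rule qfilt_transport[OF mN mM N, where \<rho> = "\<lambda>y x. x \<in> carrier M \<and> y = g x"])
      (use sur in \<open>auto simp: hom_closed[OF g] hom_add[OF g] hom_smult[OF g] a_kernel_def' MN.a_kernel_submodule[OF g, unfolded a_kernel_def']\<close>)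
  ultimately show ?thesis by (rule qfilt_trans[rotated])
qed

section \<open>Homology of chain complexes\<close>

locale complex =
  fixes R :: "('a, 'm) ring_scheme" and X :: "('a, 'b) chain_complex"
  assumes obj_module: "module R (obj X k)"
    and bd_hom: "bd X k \<in> module_homs R (obj X k) (obj X (k - 1))"
    and bd_bd: "x \<in> carrier (obj X k) \<Longrightarrow> bd X (k - 1) (bd X k x) = \<zero>\<^bsub>obj X (k - 1 - 1)\<^esub>"
begin

lemma bd_pair: "module_pair R (obj X k) (obj X l)"
  by (simp add: module_pair_def obj_module)

lemma bd_closed: "x \<in> carrier (obj X k) \<Longrightarrow> bd X k x \<in> carrier (obj X (k - 1))"
  by (rule hom_closed[OF bd_hom])

lemmas bd_zero = module_pair.hom_zero[OF bd_pair bd_hom]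
lemmas bd_minus = module_pair.hom_minus[OF bd_pair bd_hom]
lemmas bd_add = hom_add[OF bd_hom]
lemmas bd_smult = hom_smult[OF bd_hom]

lemma cycles_iff: "z \<in> cycles X k \<longleftrightarrow> z \<in> carrier (obj X k) \<and> bd X k z = \<zero>\<^bsub>obj X (k - 1)\<^esub>"
  by (auto simp: cycles_def a_kernel_def')

lemma boundaries_iff: "z \<in> boundaries X k \<longleftrightarrow> (\<exists>y\<in>carrier (obj X (k + 1)). z = bd X (k + 1) y)"
  by (auto simp: boundaries_def)

lemma cycles_submodule: "submodule (cycles X k) R (obj X k)"
  unfolding cycles_def by (rule module_pair.a_kernel_submodule[OF bd_pair bd_hom])

lemma boundaries_submodule: "submodule (boundaries X k) R (obj X k)"
  unfolding boundaries_def
  using module_pair.hom_image_submodule[OF bd_pair bd_hom module.carrier_is_submodule[OF obj_module], of "k + 1"]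
  by simp

lemma boundaries_subset: "boundaries X k \<subseteq> cycles X k"
  using bd_bd[of _ "k + 1"] bd_closed[of _ "k + 1"] by (auto simp: boundaries_iff cycles_iff)

lemma subquotient: "subquotient R (obj X k) (cycles X k) (boundaries X k)"
  by (intro subquotient.intro subquotient_axioms.intro obj_module cycles_submodule boundaries_submodule boundaries_subset)

lemma homology_eq: "homology X k = subquot (obj X k) (cycles X k) (boundaries X k)"
  by (simp add: homology_def subquot_def)

lemma module_homology: "module R (homology X k)"
  unfolding homology_eq by (rule subquotient.module_subquot[OF subquotient])

lemmas homology_carrier = subquotient.subquot_carrier[OF subquotient, folded homology_eq]
lemmas homology_zero = subquotient.subquot_zero[OF subquotient, folded homology_eq]
lemmas homology_add = subquotient.subquot_add[OF subquotient, folded homology_eq]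
lemmas homology_smult = subquotient.subquot_smult[OF subquotient, folded homology_eq]
lemmas homology_eq_iff = subquotient.subquot_eq_iff[OF subquotient]
lemmas homology_eq_zero_iff = subquotient.subquot_eq_zero_iff[OF subquotient]

end

locale chain_map = X: complex R X + Y: complex R Y for R X Y +
  fixes f
  assumes map_hom: "f k \<in> module_homs R (obj X k) (obj Y k)"
    and map_bd: "x \<in> carrier (obj X k) \<Longrightarrow> bd Y k (f k x) = f (k - 1) (bd X k x)"
begin

lemma map_pair: "module_pair R (obj X k) (obj Y k)"
  by (simp add: module_pair_def X.obj_module Y.obj_module)

lemma map_closed: "x \<in> carrier (obj X k) \<Longrightarrow> f k x \<in> carrier (obj Y k)"
  by (rule hom_closed[OF map_hom])

lemmas map_zero = module_pair.hom_zero[OF map_pair map_hom]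
lemmas map_minus = module_pair.hom_minus[OF map_pair map_hom]
lemmas map_add = hom_add[OF map_hom]
lemmas map_smult = hom_smult[OF map_hom]

lemma map_cycles: "z \<in> cycles X k \<Longrightarrow> f k z \<in> cycles Y k"
  by (simp add: X.cycles_iff Y.cycles_iff map_closed map_bd map_zero)

lemma map_boundaries: "z \<in> boundaries X k \<Longrightarrow> f k z \<in> boundaries Y k"
  using map_bd[of _ "k + 1"] map_closed[of _ "k + 1"] by (force simp: X.boundaries_iff Y.boundaries_iff)

lemma homology_map_class:
  assumes z: "z \<in> cycles X k"
  shows "homology_map Y k (f k) (boundaries X k +>\<^bsub>obj X k\<^esub> z) = boundaries Y k +>\<^bsub>obj Y k\<^esub> f k z"
  unfolding homology_map_def
proof (rule subquotient.the_elem_class[OF X.subquotient z])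
  fix z' assume z': "z' \<in> cycles X k" "z' \<ominus>\<^bsub>obj X k\<^esub> z \<in> boundaries X k"
  then have "f k z' \<ominus>\<^bsub>obj Y k\<^esub> f k z \<in> boundaries Y k"
    using map_boundaries[OF z'(2)] z by (simp add: map_minus X.cycles_iff)
  then show "boundaries Y k +>\<^bsub>obj Y k\<^esub> f k z' = boundaries Y k +>\<^bsub>obj Y k\<^esub> f k z"
    using z z' by (simp add: Y.homology_eq_iff map_cycles)
qed

lemma homology_map_hom: "homology_map Y k (f k) \<in> module_homs R (homology X k) (homology Y k)"
proof (rule module_homsI)
  interpret Z: module R "(obj X k)\<lparr>carrier := cycles X k\<rparr>"
    by (rule subquotient.module_Z[OF X.subquotient])
  fix u assume "u \<in> carrier (homology X k)"
  then obtain z where z: "z \<in> cycles X k" "u = boundaries X k +>\<^bsub>obj X k\<^esub> z" by (auto simp: X.homology_carrier)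
  then show "homology_map Y k (f k) u \<in> carrier (homology Y k)"
    by (auto simp: homology_map_class Y.homology_carrier map_cycles)
  {
    fix a assume a: "a \<in> carrier R"
    then have "a \<odot>\<^bsub>obj X k\<^esub> z \<in> cycles X k" using Z.smult_closed[of a z] z by simp
    then show "homology_map Y k (f k) (a \<odot>\<^bsub>homology X k\<^esub> u) = a \<odot>\<^bsub>homology Y k\<^esub> homology_map Y k (f k) u"
      using a z by (simp add: X.homology_smult Y.homology_smult homology_map_class map_cycles map_smult X.cycles_iff)
  next
    fix v assume "v \<in> carrier (homology X k)"
    then obtain z' where z': "z' \<in> cycles X k" "v = boundaries X k +>\<^bsub>obj X k\<^esub> z'" by (auto simp: X.homology_carrier)
    then have "z \<oplus>\<^bsub>obj X k\<^esub> z' \<in> cycles X k" using Z.M.a_closed[of z z'] z by simp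
    then show "homology_map Y k (f k) (u \<oplus>\<^bsub>homology X k\<^esub> v) = homology_map Y k (f k) u \<oplus>\<^bsub>homology Y k\<^esub> homology_map Y k (f k) v"
      using z z' by (simp add: X.homology_add Y.homology_add homology_map_class map_cycles map_add X.cycles_iff)
  }
qed

end

section \<open>The connecting homomorphism of a short exact sequence of complexes\<close>

locale short_exact_complexes = f: chain_map R X Y f + g: chain_map R Y W g for R X Y W f g +
  assumes exact: "short_exact R (obj X k) (obj Y k) (obj W k) (f k) (g k)"
begin

abbreviation \<delta> where "\<delta> \<equiv> connecting_hom X Y f g"

lemma f_inj: "x \<in> carrier (obj X k) \<Longrightarrow> x' \<in> carrier (obj X k) \<Longrightarrow> f k x = f k x' \<Longrightarrow> x = x'"
  using exact[of k] by (auto simp: short_exact_def inj_on_def)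

lemma g_surj: "w \<in> carrier (obj W k) \<Longrightarrow> \<exists>y\<in>carrier (obj Y k). g k y = w"
proof -
  assume "w \<in> carrier (obj W k)"
  then have "w \<in> g k ` carrier (obj Y k)" using exact[of k] by (simp add: short_exact_def)
  then show ?thesis by blast
qed

lemma ker_g: "y \<in> carrier (obj Y k) \<Longrightarrow> g k y = \<zero>\<^bsub>obj W k\<^esub> \<Longrightarrow> \<exists>x\<in>carrier (obj X k). y = f k x"
  using exact[of k] by (auto simp: short_exact_def a_kernel_def' image_iff set_eq_iff)

lemma gf: "x \<in> carrier (obj X k) \<Longrightarrow> g k (f k x) = \<zero>\<^bsub>obj W k\<^esub>"
  using exact[of k] by (auto simp: short_exact_def a_kernel_def' image_iff set_eq_iff)

lemma zigzag_cycle: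
  assumes y: "y \<in> carrier (obj Y k)" and x: "x \<in> carrier (obj X (k - 1))" and xy: "f (k - 1) x = bd Y k y"
  shows "x \<in> cycles X (k - 1)"
proof -
  have "f (k - 1 - 1) (bd X (k - 1) x) = \<zero>\<^bsub>obj Y (k - 1 - 1)\<^esub>"
    using f.map_bd[OF x] xy f.Y.bd_bd[OF y] by simp
  then have "bd X (k - 1) x = \<zero>\<^bsub>obj X (k - 1 - 1)\<^esub>"
    using f_inj[OF f.X.bd_closed[OF x]] f.map_zero[of "k - 1 - 1"] module.carrier_is_submodule[OF f.X.obj_module]
      module.submodule_zero[OF f.X.obj_module] by metis
  then show ?thesis using x by (simp add: f.X.cycles_iff)
qed

lemma zigzag_exists:
  assumes y: "y \<in> carrier (obj Y k)" and gy: "g k y \<in> cycles W k"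
  shows "\<exists>x\<in>carrier (obj X (k - 1)). f (k - 1) x = bd Y k y"
  using ker_g[OF f.Y.bd_closed[OF y]] g.map_bd[OF y] gy by (auto simp: g.Y.cycles_iff)

text \<open>If \<open>g y\<close> is the boundary of \<open>w\<close>, subtracting the boundary of a
  lift of \<open>w\<close> puts \<open>y\<close> into the image of \<open>f\<close> and leaves the
  boundary of \<open>y\<close> unchanged; injectivity of \<open>f\<close> then exhibits
  \<open>x\<close> as a boundary. Applied to differences, this removes the dependence on all choices
  in the zigzag.\<close>

lemma zigzag_boundary:
  assumes y: "y \<in> carrier (obj Y k)" and x: "x \<in> carrier (obj X (k - 1))" and xy: "f (k - 1) x = bd Y k y"
    and gy: "g k y \<in> boundaries W k"
  shows "x \<in> boundaries X (k - 1)"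
proof -
  interpret Yk: module R "obj Y k" by (rule f.Y.obj_module)
  interpret Yk1: module R "obj Y (k - 1)" by (rule f.Y.obj_module)
  obtain w where w: "w \<in> carrier (obj W (k + 1))" "g k y = bd W (k + 1) w" using gy by (auto simp: g.Y.boundaries_iff)
  obtain v where v: "v \<in> carrier (obj Y (k + 1))" "g (k + 1) v = w" using g_surj[OF w(1)] by blast
  let ?b = "bd Y (k + 1) v"
  have b: "?b \<in> carrier (obj Y k)" using f.Y.bd_closed[OF v(1)] by simp
  have "g k ?b = g k y" using g.map_bd[OF v(1)] v w by simp
  then have "g k (y \<ominus>\<^bsub>obj Y k\<^esub> ?b) = \<zero>\<^bsub>obj W k\<^esub>"
    using y b module.minus_eq_zero_iff[OF g.Y.obj_module] by (simp add: g.map_minus g.map_closed)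
  then obtain u where u: "u \<in> carrier (obj X k)" "y \<ominus>\<^bsub>obj Y k\<^esub> ?b = f k u" using ker_g y b by blast
  have "bd Y k ?b = \<zero>\<^bsub>obj Y (k - 1)\<^esub>" using f.Y.bd_bd[OF v(1)] by simp
  moreover have "bd Y k y \<ominus>\<^bsub>obj Y (k - 1)\<^esub> \<zero>\<^bsub>obj Y (k - 1)\<^esub> = bd Y k y" using f.Y.bd_closed[OF y] by algebra
  ultimately have "bd Y k y = bd Y k (f k u)" using u(2) f.Y.bd_minus[of y k ?b] y b by simp
  then have "f (k - 1) x = f (k - 1) (bd X k u)" using xy f.map_bd[OF u(1)] by simp
  then have "x = bd X k u" by (rule f_inj[OF x f.X.bd_closed[OF u(1)]])
  then show ?thesis using u(1) by (auto simp: f.X.boundaries_iff)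
qed

text \<open>Two zigzags over the same class differ by one that lies over a boundary, so
  \<open>zigzag_boundary\<close> yields the uniqueness that the definite description
  requires.\<close>

lemma connecting_class:
  assumes y: "y \<in> carrier (obj Y k)" and x: "x \<in> carrier (obj X (k - 1))" and xy: "f (k - 1) x = bd Y k y"
    and gy: "g k y \<in> cycles W k"
  shows "\<delta> k (boundaries W k +>\<^bsub>obj W k\<^esub> g k y) = boundaries X (k - 1) +>\<^bsub>obj X (k - 1)\<^esub> x"
  unfolding connecting_hom_def
proof (rule the_equality)
  interpret Wk: subquotient R "obj W k" "cycles W k" "boundaries W k" by (rule g.Y.subquotient)
  show "\<exists>y'\<in>carrier (obj Y k). \<exists>x'\<in>carrier (obj X (k - 1)). g k y' \<in> boundaries W k +>\<^bsub>obj W k\<^esub> g k y \<and>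
    f (k - 1) x' = bd Y k y' \<and>
    boundaries X (k - 1) +>\<^bsub>obj X (k - 1)\<^esub> x = boundaries X (k - 1) +>\<^bsub>obj X (k - 1)\<^esub> x'"
    using x y xy Wk.rcos_self[OF Wk.B g.map_closed[OF y]] by blast
  interpret Yk: module R "obj Y k" by (rule f.Y.obj_module)
  interpret Xk: module R "obj X (k - 1)" by (rule f.X.obj_module)
  fix C assume "\<exists>y'\<in>carrier (obj Y k). \<exists>x'\<in>carrier (obj X (k - 1)). g k y' \<in> boundaries W k +>\<^bsub>obj W k\<^esub> g k y \<and>
    f (k - 1) x' = bd Y k y' \<and> C = boundaries X (k - 1) +>\<^bsub>obj X (k - 1)\<^esub> x'"
  then obtain y' x' where *: "y' \<in> carrier (obj Y k)" "x' \<in> carrier (obj X (k - 1))"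
    "g k y' \<in> boundaries W k +>\<^bsub>obj W k\<^esub> g k y" "f (k - 1) x' = bd Y k y'"
    and C: "C = boundaries X (k - 1) +>\<^bsub>obj X (k - 1)\<^esub> x'" by blast
  have "g k (y' \<ominus>\<^bsub>obj Y k\<^esub> y) \<in> boundaries W k"
    using *(3) Wk.rcos_mem_iff[OF Wk.B g.map_closed[OF y] g.map_closed[OF *(1)]] by (simp add: g.map_minus y *(1))
  moreover have "f (k - 1) (x' \<ominus>\<^bsub>obj X (k - 1)\<^esub> x) = bd Y k (y' \<ominus>\<^bsub>obj Y k\<^esub> y)"
    using * x y xy by (simp add: f.map_minus f.Y.bd_minus)
  ultimately have "x' \<ominus>\<^bsub>obj X (k - 1)\<^esub> x \<in> boundaries X (k - 1)"
    using zigzag_boundary[of "y' \<ominus>\<^bsub>obj Y k\<^esub> y" k "x' \<ominus>\<^bsub>obj X (k - 1)\<^esub> x"] * x y by simp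
  then show "C = boundaries X (k - 1) +>\<^bsub>obj X (k - 1)\<^esub> x"
    unfolding C using Xk.rcos_eq_iff[OF f.X.boundaries_submodule *(2) x] by simp
qed

lemma zigzag_cases:
  assumes u: "u \<in> carrier (homology W k)"
  obtains y x where "y \<in> carrier (obj Y k)" "x \<in> cycles X (k - 1)" "f (k - 1) x = bd Y k y" "g k y \<in> cycles W k"
    "u = boundaries W k +>\<^bsub>obj W k\<^esub> g k y" "\<delta> k u = boundaries X (k - 1) +>\<^bsub>obj X (k - 1)\<^esub> x"
proof -
  obtain w where w: "w \<in> cycles W k" "u = boundaries W k +>\<^bsub>obj W k\<^esub> w" using u by (auto simp: g.Y.homology_carrier)
  obtain y where y: "y \<in> carrier (obj Y k)" "g k y = w" using g_surj w by (auto simp: g.Y.cycles_iff)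
  obtain x where x: "x \<in> carrier (obj X (k - 1))" "f (k - 1) x = bd Y k y" using zigzag_exists[of y k] y w by auto
  show thesis
    by (rule that[OF y(1) zigzag_cycle[OF y(1) x] x(2)]) (use y w connecting_class[OF y(1) x] in auto)
qed

text \<open>The long exact sequence when \<open>f\<close> induces zero on homology: vanishing in
  degree \<open>k\<close> makes the first map injective, vanishing in degree \<open>k - 1\<close>
  makes the connecting map surjective.\<close>

theorem short_exact_homology:
  assumes zero: "\<And>k x. x \<in> cycles X k \<Longrightarrow> f k x \<in> boundaries Y k"
  shows "short_exact R (homology Y k) (homology W k) (homology X (k - 1)) (homology_map W k (g k)) (\<delta> k)"
proof -
  interpret Yk: subquotient R "obj Y k" "cycles Y k" "boundaries Y k" by (rule f.Y.subquotient)
  interpret Xk: subquotient R "obj X (k - 1)" "cycles X (k - 1)" "boundaries X (k - 1)" by (rule f.X.subquotient)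
  interpret Wk: subquotient R "obj W k" "cycles W k" "boundaries W k" by (rule g.Y.subquotient)
  note cyc = Yk.submodule_carrier[OF Yk.Z] Xk.submodule_carrier[OF Xk.Z] Wk.submodule_carrier[OF Wk.Z]
  let ?G = "homology_map W k (g k)"
  have G: "?G \<in> module_homs R (homology Y k) (homology W k)" by (rule g.homology_map_hom)
  have \<delta>: "\<delta> k \<in> module_homs R (homology W k) (homology X (k - 1))"
  proof (rule module_homsI)
    fix u assume "u \<in> carrier (homology W k)"
    then show "\<delta> k u \<in> carrier (homology X (k - 1))"
      by (rule zigzag_cases) (auto simp: f.X.homology_carrier)
  next
    fix u v assume u: "u \<in> carrier (homology W k)" and v: "v \<in> carrier (homology W k)"
    obtain y x where y: "y \<in> carrier (obj Y k)" "x \<in> cycles X (k - 1)" "f (k - 1) x = bd Y k y" "g k y \<in> cycles W k"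
      "u = boundaries W k +>\<^bsub>obj W k\<^esub> g k y" "\<delta> k u = boundaries X (k - 1) +>\<^bsub>obj X (k - 1)\<^esub> x"
      using u by (rule zigzag_cases)
    obtain y' x' where y': "y' \<in> carrier (obj Y k)" "x' \<in> cycles X (k - 1)" "f (k - 1) x' = bd Y k y'" "g k y' \<in> cycles W k"
      "v = boundaries W k +>\<^bsub>obj W k\<^esub> g k y'" "\<delta> k v = boundaries X (k - 1) +>\<^bsub>obj X (k - 1)\<^esub> x'"
      using v by (rule zigzag_cases)
    have "\<delta> k (boundaries W k +>\<^bsub>obj W k\<^esub> g k (y \<oplus>\<^bsub>obj Y k\<^esub> y')) =
        boundaries X (k - 1) +>\<^bsub>obj X (k - 1)\<^esub> (x \<oplus>\<^bsub>obj X (k - 1)\<^esub> x')"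
      by (rule connecting_class)
        (use y y' cyc in \<open>auto simp: f.map_add f.Y.bd_add g.map_add Wk.submodule_closed(5)[OF Wk.Z]\<close>)
    then show "\<delta> k (u \<oplus>\<^bsub>homology W k\<^esub> v) = \<delta> k u \<oplus>\<^bsub>homology X (k - 1)\<^esub> \<delta> k v"
      using y y' by (simp add: g.Y.homology_add f.X.homology_add g.map_add)
  next
    fix a u assume a: "a \<in> carrier R" and u: "u \<in> carrier (homology W k)"
    obtain y x where y: "y \<in> carrier (obj Y k)" "x \<in> cycles X (k - 1)" "f (k - 1) x = bd Y k y" "g k y \<in> cycles W k"
      "u = boundaries W k +>\<^bsub>obj W k\<^esub> g k y" "\<delta> k u = boundaries X (k - 1) +>\<^bsub>obj X (k - 1)\<^esub> x"
      using u by (rule zigzag_cases)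
    have "\<delta> k (boundaries W k +>\<^bsub>obj W k\<^esub> g k (a \<odot>\<^bsub>obj Y k\<^esub> y)) =
        boundaries X (k - 1) +>\<^bsub>obj X (k - 1)\<^esub> (a \<odot>\<^bsub>obj X (k - 1)\<^esub> x)"
      by (rule connecting_class)
        (use a y cyc in \<open>auto simp: f.map_smult f.Y.bd_smult g.map_smult Wk.submodule_closed(4)[OF Wk.Z]\<close>)
    then show "\<delta> k (a \<odot>\<^bsub>homology W k\<^esub> u) = a \<odot>\<^bsub>homology X (k - 1)\<^esub> \<delta> k u"
      using a y by (simp add: g.Y.homology_smult f.X.homology_smult g.map_smult)
  qed
  have "inj_on ?G (carrier (homology Y k))"
  proof (rule inj_onI)
    fix u v assume "u \<in> carrier (homology Y k)" "v \<in> carrier (homology Y k)" and eq: "?G u = ?G v"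
    then obtain y y' where y: "y \<in> cycles Y k" "u = boundaries Y k +>\<^bsub>obj Y k\<^esub> y"
      and y': "y' \<in> cycles Y k" "v = boundaries Y k +>\<^bsub>obj Y k\<^esub> y'" by (auto simp: f.Y.homology_carrier)
    let ?d = "y \<ominus>\<^bsub>obj Y k\<^esub> y'"
    have d: "?d \<in> cycles Y k" using y y' by (simp add: Yk.submodule_closed[OF Yk.Z])
    have "g k ?d \<in> boundaries W k" using eq y y'
      by (simp add: g.homology_map_class g.Y.homology_eq_iff g.map_cycles g.map_minus cyc)
    then obtain w where w: "w \<in> carrier (obj W (k + 1))" "g k ?d = bd W (k + 1) w" by (auto simp: g.Y.boundaries_iff)
    obtain t where t: "t \<in> carrier (obj Y (k + 1))" "g (k + 1) t = w" using g_surj[OF w(1)] by blast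
    let ?b = "bd Y (k + 1) t"
    have b: "?b \<in> boundaries Y k" using t by (auto simp: f.Y.boundaries_iff)
    have bc: "?b \<in> cycles Y k" using b f.Y.boundaries_subset by blast
    have "g k ?b = g k ?d" using g.map_bd[OF t(1)] t w by simp
    then have "g k (?d \<ominus>\<^bsub>obj Y k\<^esub> ?b) = \<zero>\<^bsub>obj W k\<^esub>"
      using Wk.minus_eq_zero_iff by (simp add: g.map_minus g.map_closed cyc(1)[OF d] cyc(1)[OF bc])
    then obtain x where x: "x \<in> carrier (obj X k)" "?d \<ominus>\<^bsub>obj Y k\<^esub> ?b = f k x"
      using ker_g cyc(1)[OF d] cyc(1)[OF bc] by blast
    have "f k x \<in> cycles Y k" unfolding x(2)[symmetric] using d bc by (simp add: Yk.submodule_closed[OF Yk.Z])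
    then have "f (k - 1) (bd X k x) = f (k - 1) \<zero>\<^bsub>obj X (k - 1)\<^esub>"
      using f.map_bd[OF x(1)] by (simp add: f.Y.cycles_iff f.map_zero)
    then have "bd X k x = \<zero>\<^bsub>obj X (k - 1)\<^esub>" using f_inj f.X.bd_closed[OF x(1)] by blast
    then have "f k x \<in> boundaries Y k" using zero x(1) by (simp add: f.X.cycles_iff)
    then have "(?d \<ominus>\<^bsub>obj Y k\<^esub> ?b) \<oplus>\<^bsub>obj Y k\<^esub> ?b \<in> boundaries Y k"
      unfolding x(2) using b by (rule Yk.submodule_closed(5)[OF Yk.B])
    moreover have "(?d \<ominus>\<^bsub>obj Y k\<^esub> ?b) \<oplus>\<^bsub>obj Y k\<^esub> ?b = ?d"
      using cyc(1)[OF y(1)] cyc(1)[OF y'(1)] cyc(1)[OF bc] by algebra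
    ultimately show "u = v" using y y' by (simp add: f.Y.homology_eq_iff)
  qed
  moreover have "?G ` carrier (homology Y k) = a_kernel (homology W k) (homology X (k - 1)) (\<delta> k)"
  proof
    show "?G ` carrier (homology Y k) \<subseteq> a_kernel (homology W k) (homology X (k - 1)) (\<delta> k)"
    proof
      fix u assume "u \<in> ?G ` carrier (homology Y k)"
      then obtain y where y: "y \<in> cycles Y k" "u = boundaries W k +>\<^bsub>obj W k\<^esub> g k y"
        by (auto simp: f.Y.homology_carrier g.homology_map_class)
      have "\<delta> k u = boundaries X (k - 1) +>\<^bsub>obj X (k - 1)\<^esub> \<zero>\<^bsub>obj X (k - 1)\<^esub>" unfolding y(2)
        by (rule connecting_class) (use y cyc in \<open>auto simp: f.map_zero f.Y.cycles_iff g.map_cycles\<close>)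
      then have "\<delta> k u = \<zero>\<^bsub>homology X (k - 1)\<^esub>" by (simp add: Xk.rcos_zero[OF Xk.B] f.X.homology_zero)
      then show "u \<in> a_kernel (homology W k) (homology X (k - 1)) (\<delta> k)"
        using y by (auto simp: a_kernel_def' g.Y.homology_carrier g.map_cycles)
    qed
    show "a_kernel (homology W k) (homology X (k - 1)) (\<delta> k) \<subseteq> ?G ` carrier (homology Y k)"
    proof
      fix u assume "u \<in> a_kernel (homology W k) (homology X (k - 1)) (\<delta> k)"
      then have u: "u \<in> carrier (homology W k)" and u0: "\<delta> k u = boundaries X (k - 1)"
        by (auto simp: a_kernel_def' f.X.homology_zero)
      obtain y x where y: "y \<in> carrier (obj Y k)" "x \<in> cycles X (k - 1)" "f (k - 1) x = bd Y k y" "g k y \<in> cycles W k"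
        "u = boundaries W k +>\<^bsub>obj W k\<^esub> g k y" "\<delta> k u = boundaries X (k - 1) +>\<^bsub>obj X (k - 1)\<^esub> x"
        using u by (rule zigzag_cases)
      have "x \<in> boundaries X (k - 1)" using u0 y(2,6) f.X.homology_eq_zero_iff by simp
      then obtain t where t: "t \<in> carrier (obj X k)" "x = bd X k t" by (auto simp: f.X.boundaries_iff)
      \<comment> \<open>The boundary of \<open>y\<close> is also that of \<open>f t\<close>, so the
        difference is a cycle; \<open>g\<close> does not see the correction.\<close>
      let ?y = "y \<ominus>\<^bsub>obj Y k\<^esub> f k t"
      have "bd Y k ?y = bd Y k y \<ominus>\<^bsub>obj Y (k - 1)\<^esub> bd Y k y"
        using y(1,3) t by (simp add: f.Y.bd_minus f.map_closed f.map_bd)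
      then have c: "?y \<in> cycles Y k"
        using y(1) t(1) module.minus_eq_zero_iff[OF f.Y.obj_module] by (simp add: f.Y.cycles_iff f.map_closed f.Y.bd_closed)
      have "g k ?y = g k y \<ominus>\<^bsub>obj W k\<^esub> \<zero>\<^bsub>obj W k\<^esub>" using y(1) t(1) by (simp add: g.map_minus f.map_closed gf)
      also have "\<dots> = g k y" using g.map_closed[OF y(1)] by algebra
      finally have "?G (boundaries Y k +>\<^bsub>obj Y k\<^esub> ?y) = u" using c y(5) by (simp add: g.homology_map_class)
      then show "u \<in> ?G ` carrier (homology Y k)" using c by (auto simp: f.Y.homology_carrier)
    qed
  qed
  moreover have "\<delta> k ` carrier (homology W k) = carrier (homology X (k - 1))"
  proof
    show "\<delta> k ` carrier (homology W k) \<subseteq> carrier (homology X (k - 1))" using hom_closed[OF \<delta>] by auto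
    show "carrier (homology X (k - 1)) \<subseteq> \<delta> k ` carrier (homology W k)"
    proof
      fix v assume "v \<in> carrier (homology X (k - 1))"
      then obtain x where x: "x \<in> cycles X (k - 1)" "v = boundaries X (k - 1) +>\<^bsub>obj X (k - 1)\<^esub> x"
        by (auto simp: f.X.homology_carrier)
      obtain y where y: "y \<in> carrier (obj Y k)" "f (k - 1) x = bd Y k y" using zero[OF x(1)] by (auto simp: f.Y.boundaries_iff)
      have "bd W k (g k y) = \<zero>\<^bsub>obj W (k - 1)\<^esub>" using g.map_bd[OF y(1)] y(2) gf[of x "k - 1"] x(1) by (simp add: f.X.cycles_iff)
      then have c: "g k y \<in> cycles W k" using y(1) by (simp add: g.Y.cycles_iff g.map_closed)
      have "\<delta> k (boundaries W k +>\<^bsub>obj W k\<^esub> g k y) = v" unfolding x(2)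
        by (rule connecting_class) (use y x c in \<open>auto simp: f.X.cycles_iff\<close>)
      then show "v \<in> \<delta> k ` carrier (homology W k)" using c by (auto simp: g.Y.homology_carrier)
    qed
  qed
  ultimately show ?thesis
    unfolding short_exact_def by (intro conjI f.Y.module_homology g.Y.module_homology f.X.module_homology G \<delta>)
qed

end

section \<open>Tensor products\<close>

lemma (in module) submodule_generated_submodule:
  assumes "A \<subseteq> carrier M"
  shows "submodule (submodule_generated R M A) R M"
proof (rule submoduleI')
  show "submodule_generated R M A \<subseteq> carrier M"
    using carrier_is_submodule assms by (auto simp: submodule_generated_def)
qed (auto simp: submodule_generated_def submodule_closed)

lemma submodule_generated_self: "A \<subseteq> submodule_generated R M A"
  by (auto simp: submodule_generated_def)

lemma submodule_generated_minimal: "submodule H R M \<Longrightarrow> A \<subseteq> H \<Longrightarrow> submodule_generated R M A \<subseteq> H"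
  by (auto simp: submodule_generated_def)

lemma quot_module_eq_subquot: "quot_module (M :: ('a, 'b, 'n) module_scheme) N = subquot M (carrier M) N"
  by (simp add: subquot_def)

definition bilinear ::
  "('a, 'm) ring_scheme \<Rightarrow> ('a, 'b, 'n) module_scheme \<Rightarrow> ('a, 'c, 'k) module_scheme \<Rightarrow>
   ('a, 'd, 'l) module_scheme \<Rightarrow> ('b \<Rightarrow> 'c \<Rightarrow> 'd) \<Rightarrow> bool"
  where "bilinear R M N W \<beta> \<longleftrightarrow>
     (\<forall>x\<in>carrier M. \<beta> x \<in> module_homs R N W) \<and> (\<forall>y\<in>carrier N. (\<lambda>x. \<beta> x y) \<in> module_homs R M W)"

text \<open>The shape of \<open>tensor_map\<close> with an arbitrary bilinear map in place of the
  pure tensors; tensor maps, coordinates and the multiplication map are instances.\<close>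

definition tensor_lift ::
  "('a, 'm) ring_scheme \<Rightarrow> ('a, 'd, 'l) module_scheme \<Rightarrow> ('b \<Rightarrow> 'c \<Rightarrow> 'd) \<Rightarrow> ('b \<times> 'c \<Rightarrow> 'a) set \<Rightarrow> 'd"
  where "tensor_lift R W \<beta> X = the_elem (lin_ext R W (\<lambda>(x, y). \<beta> x y) ` X)"

lemma tensor_map_eq_lift: "tensor_map R M N f g = tensor_lift R (tensor R M N) (\<lambda>x y. pure_tensor R M N (f x) (g y))"
  by (simp add: fun_eq_iff tensor_map_def tensor_lift_def)

lemma module_hom_eq_submodule:
  assumes "module R M" "module R N" and h: "h \<in> module_homs R M N" and h': "h' \<in> module_homs R M N"
  shows "submodule {x \<in> carrier M. h x = h' x} R M"
proof -
  interpret module_pair R M N using assms by (simp add: module_pair_def)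
  show ?thesis
    by (rule M.submoduleI') (auto simp: hom_zero[OF h] hom_zero[OF h'] hom_add[OF h] hom_add[OF h'] hom_smult[OF h] hom_smult[OF h'])
qed

locale tensor_product = module_pair
begin

abbreviation "F \<equiv> free_on R (carrier M \<times> carrier N)"
abbreviation "T \<equiv> tensor R M N"
abbreviation "pt \<equiv> pure_tensor R M N"

lemma module_F: "module R F"
  by (rule module_free_on) (rule M.is_cring)

interpretation F: module R F by (rule module_F)

lemma single_F: "x \<in> carrier M \<Longrightarrow> y \<in> carrier N \<Longrightarrow> single R (x, y) \<in> carrier F"
  by (simp add: F.single_carrier)

lemma relations_subset: "tensor_relations R M N \<subseteq> carrier F"
  unfolding tensor_relations_def Let_def
  by (intro Un_least subsetI; elim CollectE exE conjE; hypsubst; intro F.minus_closed F.M.a_closed F.smult_closed single_F) auto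

lemma subquotient_F: "subquotient R F (carrier F) (tensor_kernel R M N)"
proof -
  have "submodule (tensor_kernel R M N) R F"
    unfolding tensor_kernel_def by (rule F.submodule_generated_submodule[OF relations_subset])
  then show ?thesis using F.submoduleE(1) F.carrier_is_submodule
    by (intro subquotient.intro subquotient_axioms.intro module_F) auto
qed

lemma tensor_eq_subquot: "T = subquot F (carrier F) (tensor_kernel R M N)"
  by (simp add: tensor_def quot_module_eq_subquot)

interpretation Q: subquotient R F "carrier F" "tensor_kernel R M N" by (rule subquotient_F)

lemma module_tensor: "module R T"
  unfolding tensor_eq_subquot by (rule Q.module_subquot)

interpretation T: module R T by (rule module_tensor)

lemma class_F_hom: "(\<lambda>\<phi>. tensor_kernel R M N +>\<^bsub>F\<^esub> \<phi>) \<in> module_homs R F T"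
  using Q.class_hom by (simp add: tensor_eq_subquot)

lemma pure_closed [simp]: "x \<in> carrier M \<Longrightarrow> y \<in> carrier N \<Longrightarrow> pt x y \<in> carrier T"
  unfolding pure_tensor_def by (rule hom_closed[OF class_F_hom single_F])

lemma relation_class:
  assumes "\<phi> \<ominus>\<^bsub>F\<^esub> \<psi> \<in> tensor_relations R M N" "\<phi> \<in> carrier F" "\<psi> \<in> carrier F"
  shows "tensor_kernel R M N +>\<^bsub>F\<^esub> \<phi> = tensor_kernel R M N +>\<^bsub>F\<^esub> \<psi>"
  using assms Q.subquot_eq_iff submodule_generated_self[of "tensor_relations R M N" R F] by (auto simp: tensor_kernel_def)

lemma pure_bilinear: "bilinear R M N T pt"
  unfolding bilinear_def
proof (intro conjI ballI)
  fix x assume x: "x \<in> carrier M"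
  show "pt x \<in> module_homs R N T"
  proof (rule module_homsI)
    fix y assume y: "y \<in> carrier N"
    then show "pt x y \<in> carrier T" using x by simp
    {
      fix y' assume y': "y' \<in> carrier N"
      have "single R (x, y \<oplus>\<^bsub>N\<^esub> y') \<ominus>\<^bsub>F\<^esub> (single R (x, y) \<oplus>\<^bsub>F\<^esub> single R (x, y')) \<in> tensor_relations R M N"
        unfolding tensor_relations_def Let_def using x y y' by blast
      note relation_class[OF this]
      then show "pt x (y \<oplus>\<^bsub>N\<^esub> y') = pt x y \<oplus>\<^bsub>T\<^esub> pt x y'"
        unfolding pure_tensor_def using x y y'
        by (simp add: hom_add[OF class_F_hom] single_F F.M.a_closed del: free_on_sel)
    next
      fix a assume a: "a \<in> carrier R"
      have "single R (x, a \<odot>\<^bsub>N\<^esub> y) \<ominus>\<^bsub>F\<^esub> a \<odot>\<^bsub>F\<^esub> single R (x, y) \<in> tensor_relations R M N"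
        unfolding tensor_relations_def Let_def using x y a by blast
      note relation_class[OF this]
      then show "pt x (a \<odot>\<^bsub>N\<^esub> y) = a \<odot>\<^bsub>T\<^esub> pt x y"
        unfolding pure_tensor_def using x y a
        by (simp add: hom_smult[OF class_F_hom] single_F F.smult_closed del: free_on_sel)
    }
  qed
next
  fix y assume y: "y \<in> carrier N"
  show "(\<lambda>x. pt x y) \<in> module_homs R M T"
  proof (rule module_homsI)
    fix x assume x: "x \<in> carrier M"
    then show "pt x y \<in> carrier T" using y by simp
    {
      fix x' assume x': "x' \<in> carrier M"
      have "single R (x \<oplus>\<^bsub>M\<^esub> x', y) \<ominus>\<^bsub>F\<^esub> (single R (x, y) \<oplus>\<^bsub>F\<^esub> single R (x', y)) \<in> tensor_relations R M N"
        unfolding tensor_relations_def Let_def using x y x' by blast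
      note relation_class[OF this]
      then show "pt (x \<oplus>\<^bsub>M\<^esub> x') y = pt x y \<oplus>\<^bsub>T\<^esub> pt x' y"
        unfolding pure_tensor_def using x y x'
        by (simp add: hom_add[OF class_F_hom] single_F F.M.a_closed del: free_on_sel)
    next
      fix a assume a: "a \<in> carrier R"
      have "single R (a \<odot>\<^bsub>M\<^esub> x, y) \<ominus>\<^bsub>F\<^esub> a \<odot>\<^bsub>F\<^esub> single R (x, y) \<in> tensor_relations R M N"
        unfolding tensor_relations_def Let_def using x y a by blast
      note relation_class[OF this]
      then show "pt (a \<odot>\<^bsub>M\<^esub> x) y = a \<odot>\<^bsub>T\<^esub> pt x y"
        unfolding pure_tensor_def using x y a
        by (simp add: hom_smult[OF class_F_hom] single_F F.smult_closed del: free_on_sel)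
    }
  qed
qed

lemma pure_hom_right: "x \<in> carrier M \<Longrightarrow> pt x \<in> module_homs R N T"
  and pure_hom_left: "y \<in> carrier N \<Longrightarrow> (\<lambda>x. pt x y) \<in> module_homs R M T"
  using pure_bilinear by (auto simp: bilinear_def)

lemma tensor_induct:
  assumes X: "X \<in> carrier T" and H: "submodule H R T"
    and pure: "\<And>x y. x \<in> carrier M \<Longrightarrow> y \<in> carrier N \<Longrightarrow> pt x y \<in> H"
  shows "X \<in> H"
proof -
  obtain \<phi> where \<phi>: "\<phi> \<in> carrier F" "X = tensor_kernel R M N +>\<^bsub>F\<^esub> \<phi>"
    using X by (auto simp: tensor_eq_subquot Q.subquot_carrier)
  have FT: "module_pair R F T" by (simp add: module_pair_def module_F module_tensor)
  have "\<phi> \<in> {\<phi> \<in> carrier F. tensor_kernel R M N +>\<^bsub>F\<^esub> \<phi> \<in> H}"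
    by (rule M.free_on_induct[OF \<phi>(1) module_pair.hom_vimage_submodule[OF FT class_F_hom H]])
      (use pure in \<open>auto simp: single_F pure_tensor_def\<close>)
  then show ?thesis using \<phi>(2) by simp
qed

lemma tensor_hom_eq:
  assumes W: "module R W" and h: "h \<in> module_homs R T W" and h': "h' \<in> module_homs R T W"
    and eq: "\<And>x y. x \<in> carrier M \<Longrightarrow> y \<in> carrier N \<Longrightarrow> h (pt x y) = h' (pt x y)" and X: "X \<in> carrier T"
  shows "h X = h' X"
  using tensor_induct[OF X module_hom_eq_submodule[OF module_tensor W h h']] eq by auto

context
  fixes W \<beta> assumes W: "module R W" and \<beta>: "bilinear R M N W \<beta>"
begin

interpretation W: module R W by (rule W)
interpretation FW: module_pair R F W by (simp add: module_pair_def module_F W)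

lemma lift_closed: "s \<in> carrier M \<times> carrier N \<Longrightarrow> (\<lambda>(x, y). \<beta> x y) s \<in> carrier W"
  using \<beta> by (auto simp: bilinear_def dest: hom_closed)

lemma lift_F_hom: "lin_ext R W (\<lambda>(x, y). \<beta> x y) \<in> module_homs R F W"
  by (rule W.lin_ext_hom) (rule lift_closed)

lemma lift_single:
  assumes "x \<in> carrier M" "y \<in> carrier N"
  shows "lin_ext R W (\<lambda>(x, y). \<beta> x y) (single R (x, y)) = \<beta> x y"
  using W.lin_ext_single[of "\<lambda>(x, y). \<beta> x y" "(x, y)"] lift_closed[of "(x, y)"] assms by simp

lemma kernel_lift: "\<phi> \<in> tensor_kernel R M N \<Longrightarrow> lin_ext R W (\<lambda>(x, y). \<beta> x y) \<phi> = \<zero>\<^bsub>W\<^esub>"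
proof -
  let ?L = "lin_ext R W (\<lambda>(x, y). \<beta> x y)"
  have 1: "\<beta> x \<in> module_homs R N W" if "x \<in> carrier M" for x using \<beta> that by (simp add: bilinear_def)
  have 2: "(\<lambda>x. \<beta> x y) \<in> module_homs R M W" if "y \<in> carrier N" for y using \<beta> that by (simp add: bilinear_def)
  have eq: "?L (\<phi> \<ominus>\<^bsub>F\<^esub> \<psi>) = \<zero>\<^bsub>W\<^esub>" if "\<phi> \<in> carrier F" "\<psi> \<in> carrier F" "?L \<phi> = ?L \<psi>" for \<phi> \<psi>
    using that W.minus_eq_zero_iff hom_closed[OF lift_F_hom] by (simp add: FW.hom_minus[OF lift_F_hom])
  note s = hom_add[OF lift_F_hom single_F single_F] hom_smult[OF lift_F_hom _ single_F] lift_single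
    hom_add[OF 1] hom_add[OF 2] hom_smult[OF 1] hom_smult[OF 2]
  have "tensor_relations R M N \<subseteq> a_kernel F W ?L"
  proof
    fix \<phi> assume \<phi>: "\<phi> \<in> tensor_relations R M N"
    have "?L \<phi> = \<zero>\<^bsub>W\<^esub>"
      using \<phi> unfolding tensor_relations_def Let_def
      by (elim UnE CollectE exE conjE; hypsubst; intro eq)
        (simp_all add: s F.single_carrier F.M.a_closed F.smult_closed del: free_on_sel)
    then show "\<phi> \<in> a_kernel F W ?L" using \<phi> relations_subset by (auto simp: a_kernel_def')
  qed
  then have "tensor_kernel R M N \<subseteq> a_kernel F W ?L"
    unfolding tensor_kernel_def by (intro submodule_generated_minimal FW.a_kernel_submodule[OF lift_F_hom])
  then show "\<phi> \<in> tensor_kernel R M N \<Longrightarrow> ?L \<phi> = \<zero>\<^bsub>W\<^esub>" by (auto simp: a_kernel_def')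
qed

lemma lift_class:
  assumes "\<phi> \<in> carrier F"
  shows "tensor_lift R W \<beta> (tensor_kernel R M N +>\<^bsub>F\<^esub> \<phi>) = lin_ext R W (\<lambda>(x, y). \<beta> x y) \<phi>"
  unfolding tensor_lift_def
proof (rule Q.the_elem_class[OF assms])
  fix \<psi> assume \<psi>: "\<psi> \<in> carrier F" "\<psi> \<ominus>\<^bsub>F\<^esub> \<phi> \<in> tensor_kernel R M N"
  then show "lin_ext R W (\<lambda>(x, y). \<beta> x y) \<psi> = lin_ext R W (\<lambda>(x, y). \<beta> x y) \<phi>"
    using kernel_lift[OF \<psi>(2)] assms W.minus_eq_zero_iff hom_closed[OF lift_F_hom] by (simp add: FW.hom_minus[OF lift_F_hom])
qed

lemma lift_hom: "tensor_lift R W \<beta> \<in> module_homs R T W"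
proof (rule module_homsI)
  fix X assume "X \<in> carrier T"
  then obtain \<phi> where \<phi>: "\<phi> \<in> carrier F" "X = tensor_kernel R M N +>\<^bsub>F\<^esub> \<phi>"
    by (auto simp: tensor_eq_subquot Q.subquot_carrier)
  then show "tensor_lift R W \<beta> X \<in> carrier W" by (simp add: lift_class hom_closed[OF lift_F_hom])
  {
    fix a assume a: "a \<in> carrier R"
    show "tensor_lift R W \<beta> (a \<odot>\<^bsub>T\<^esub> X) = a \<odot>\<^bsub>W\<^esub> tensor_lift R W \<beta> X"
      using a \<phi> by (simp add: hom_smult[OF class_F_hom, symmetric] lift_class hom_smult[OF lift_F_hom] F.smult_closed del: free_on_sel)
  next
    fix Y assume "Y \<in> carrier T"
    then obtain \<psi> where \<psi>: "\<psi> \<in> carrier F" "Y = tensor_kernel R M N +>\<^bsub>F\<^esub> \<psi>"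
      by (auto simp: tensor_eq_subquot Q.subquot_carrier)
    show "tensor_lift R W \<beta> (X \<oplus>\<^bsub>T\<^esub> Y) = tensor_lift R W \<beta> X \<oplus>\<^bsub>W\<^esub> tensor_lift R W \<beta> Y"
      using \<psi> \<phi> by (simp add: hom_add[OF class_F_hom, symmetric] lift_class hom_add[OF lift_F_hom] F.M.a_closed del: free_on_sel)
  }
qed

lemma lift_pure: "x \<in> carrier M \<Longrightarrow> y \<in> carrier N \<Longrightarrow> tensor_lift R W \<beta> (pt x y) = \<beta> x y"
  by (simp add: pure_tensor_def lift_class single_F lift_single)

end

end

lemma tensor_map_hom:
  assumes MN: "module R M" "module R N" and MN': "module R M'" "module R N'"
    and f: "f \<in> module_homs R M M'" and g: "g \<in> module_homs R N N'"
  shows "tensor_map R M' N' f g \<in> module_homs R (tensor R M N) (tensor R M' N')"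
    and "x \<in> carrier M \<Longrightarrow> y \<in> carrier N \<Longrightarrow>
      tensor_map R M' N' f g (pure_tensor R M N x y) = pure_tensor R M' N' (f x) (g y)"
proof -
  interpret A: tensor_product R M N using MN by (simp add: tensor_product_def module_pair_def)
  interpret B: tensor_product R M' N' using MN' by (simp add: tensor_product_def module_pair_def)
  have \<beta>: "bilinear R M N (tensor R M' N') (\<lambda>x y. pure_tensor R M' N' (f x) (g y))"
    unfolding bilinear_def using hom_comp[OF g B.pure_hom_right] hom_comp[OF f B.pure_hom_left] hom_closed[OF f] hom_closed[OF g]
    by auto
  show "tensor_map R M' N' f g \<in> module_homs R (tensor R M N) (tensor R M' N')"
    unfolding tensor_map_eq_lift by (rule A.lift_hom[OF B.module_tensor \<beta>])
  show "x \<in> carrier M \<Longrightarrow> y \<in> carrier N \<Longrightarrow>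
      tensor_map R M' N' f g (pure_tensor R M N x y) = pure_tensor R M' N' (f x) (g y)"
    unfolding tensor_map_eq_lift by (rule A.lift_pure[OF B.module_tensor \<beta>])
qed

section \<open>Coordinates on projective modules\<close>

lemma ideal_module_sel [simp]:
  "carrier (ideal_module R K) = K" "\<zero>\<^bsub>ideal_module R K\<^esub> = \<zero>\<^bsub>R\<^esub>"
  "a \<oplus>\<^bsub>ideal_module R K\<^esub> b = a \<oplus>\<^bsub>R\<^esub> b" "a \<odot>\<^bsub>ideal_module R K\<^esub> b = a \<otimes>\<^bsub>R\<^esub> b"
  by (simp_all add: ideal_module_def)

text \<open>A projective module with a chosen dual basis: the elements of \<open>M\<close> are the
  generators, and \<open>\<lambda>p. \<sigma> p q\<close> is the coordinate belonging to
  \<open>q\<close>. Fixing \<open>\<sigma>\<close> turns flatness into a computation with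
  coordinates.\<close>

locale split_module = module +
  fixes \<sigma> assumes \<sigma>_hom: "\<sigma> \<in> module_homs R M (free_on R (carrier M))"
    and lin_ext_\<sigma>: "p \<in> carrier M \<Longrightarrow> lin_ext R M (\<lambda>y. y) (\<sigma> p) = p"
begin

lemma \<sigma>_F: "p \<in> carrier M \<Longrightarrow> \<sigma> p \<in> carrier (free_on R (carrier M))"
  by (rule hom_closed[OF \<sigma>_hom])

lemma \<sigma>_closed: "p \<in> carrier M \<Longrightarrow> \<sigma> p q \<in> carrier R"
  using \<sigma>_F by (auto simp: free_on_carrier)

lemma \<sigma>_support: "p \<in> carrier M \<Longrightarrow> finite {q. \<sigma> p q \<noteq> \<zero>}" "p \<in> carrier M \<Longrightarrow> {q. \<sigma> p q \<noteq> \<zero>} \<subseteq> carrier M"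
  using \<sigma>_F by (auto simp: free_on_carrier)

lemma \<sigma>_add: "p \<in> carrier M \<Longrightarrow> p' \<in> carrier M \<Longrightarrow> \<sigma> (p \<oplus>\<^bsub>M\<^esub> p') q = \<sigma> p q \<oplus> \<sigma> p' q"
  using hom_add[OF \<sigma>_hom] by simp

lemma \<sigma>_smult: "a \<in> carrier R \<Longrightarrow> p \<in> carrier M \<Longrightarrow> \<sigma> (a \<odot>\<^bsub>M\<^esub> p) q = a \<otimes> \<sigma> p q"
  using hom_smult[OF \<sigma>_hom] by simp

lemma \<sigma>_zero: "\<sigma> \<zero>\<^bsub>M\<^esub> q = \<zero>"
  using \<sigma>_smult[of \<zero> "\<zero>\<^bsub>M\<^esub>" q] \<sigma>_closed[of "\<zero>\<^bsub>M\<^esub>" q] by simp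

lemma \<sigma>_expand:
  assumes p: "p \<in> carrier M" and A: "finite A" "{q. \<sigma> p q \<noteq> \<zero>} \<subseteq> A" "A \<subseteq> carrier M"
  shows "p = (\<Oplus>\<^bsub>M\<^esub>q\<in>A. \<sigma> p q \<odot>\<^bsub>M\<^esub> q)"
  using lin_ext_eq_finsum[OF A(1,2), of "\<lambda>y. y"] \<sigma>_closed[OF p] A(3) lin_ext_\<sigma>[OF p] by auto

text \<open>This is the submodule \<open>K M\<close>, see \<open>scaled_smult\<close> and \<open>scaled_induct\<close>.\<close>

definition scaled :: "'a set \<Rightarrow> 'c set"
  where "scaled K = {p \<in> carrier M. \<forall>q. \<sigma> p q \<in> K}"

lemma scaled_carrier: "p \<in> scaled K \<Longrightarrow> p \<in> carrier M"
  by (simp add: scaled_def)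

lemma scaled_mono: "K \<subseteq> K' \<Longrightarrow> scaled K \<subseteq> scaled K'"
  by (auto simp: scaled_def)

lemma scaled_all: "scaled (carrier R) = carrier M"
  by (auto simp: scaled_def \<sigma>_closed)

lemma scaled_submodule:
  assumes K: "ideal K R" shows "submodule (scaled K) R M"
proof -
  interpret K: ideal K R by fact
  show ?thesis
    by (rule submoduleI') (auto simp: scaled_def \<sigma>_zero \<sigma>_add \<sigma>_smult K.I_l_closed)
qed

lemma scaled_smult:
  assumes K: "ideal K R" and a: "a \<in> K" and p: "p \<in> carrier M"
  shows "a \<odot>\<^bsub>M\<^esub> p \<in> scaled K"
proof -
  interpret K: ideal K R by fact
  show ?thesis using a p by (simp add: scaled_def \<sigma>_smult K.I_r_closed \<sigma>_closed K.Icarr)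
qed

lemma scaled_induct:
  assumes p: "p \<in> scaled K" and H: "submodule H R M" and step: "\<And>a q. a \<in> K \<Longrightarrow> q \<in> carrier M \<Longrightarrow> a \<odot>\<^bsub>M\<^esub> q \<in> H"
  shows "p \<in> H"
proof -
  have "(\<Oplus>\<^bsub>M\<^esub>q\<in>{q. \<sigma> p q \<noteq> \<zero>}. \<sigma> p q \<odot>\<^bsub>M\<^esub> q) \<in> H"
    using p \<sigma>_support(2)[OF scaled_carrier[OF p]]
    by (intro submodule_finsum[OF H] step) (auto simp: scaled_def)
  then show ?thesis using \<sigma>_expand[OF scaled_carrier[OF p]] \<sigma>_support[OF scaled_carrier[OF p]] by simp
qed

lemma scaled_zero: "scaled {\<zero>} = {\<zero>\<^bsub>M\<^esub>}"
proof -
  have "p \<in> {\<zero>\<^bsub>M\<^esub>}" if "p \<in> scaled {\<zero>}" for p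
    by (rule scaled_induct[OF that zero_submodule]) auto
  then show ?thesis by (auto simp: scaled_def \<sigma>_zero)
qed

text \<open>Coordinates are linear, so injectivity of \<open>x\<close> on \<open>R/K\<close> passes
  to \<open>M/K M\<close>.\<close>

lemma scaled_cancel:
  assumes "x \<in> carrier R" "\<And>a. a \<in> carrier R \<Longrightarrow> x \<otimes> a \<in> K \<Longrightarrow> a \<in> K" "p \<in> carrier M" "x \<odot>\<^bsub>M\<^esub> p \<in> scaled K"
  shows "p \<in> scaled K"
  using assms by (auto simp: scaled_def \<sigma>_smult \<sigma>_closed)

text \<open>The sums \<open>x u + v\<close> form a submodule, so it is enough to split the
  generators \<open>c q\<close> of \<open>K M\<close>.\<close>

lemma scaled_decompose:
  assumes p: "p \<in> scaled K" and x: "x \<in> carrier R" and A: "ideal A R" and B: "ideal B R"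
    and K: "\<And>c. c \<in> K \<Longrightarrow> \<exists>a\<in>A. \<exists>b\<in>B. c = x \<otimes> a \<oplus> b"
  shows "\<exists>u\<in>scaled A. \<exists>v\<in>scaled B. p = x \<odot>\<^bsub>M\<^esub> u \<oplus>\<^bsub>M\<^esub> v"
proof -
  let ?H = "{x \<odot>\<^bsub>M\<^esub> u \<oplus>\<^bsub>M\<^esub> v | u v. u \<in> scaled A \<and> v \<in> scaled B}"
  note sA = submodule_closed[OF scaled_submodule[OF A]] and sB = submodule_closed[OF scaled_submodule[OF B]]
  interpret A: ideal A R by fact
  interpret B: ideal B R by fact
  have "p \<in> ?H"
  proof (rule scaled_induct[OF p])
    show "submodule ?H R M"
    proof (rule submoduleI')
      show "?H \<subseteq> carrier M" using x by (auto simp: scaled_carrier)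
      have "\<zero>\<^bsub>M\<^esub> = x \<odot>\<^bsub>M\<^esub> \<zero>\<^bsub>M\<^esub> \<oplus>\<^bsub>M\<^esub> \<zero>\<^bsub>M\<^esub>" using x by simp
      then show "\<zero>\<^bsub>M\<^esub> \<in> ?H" using sA(1) sB(1) by blast
    next
      fix y z assume "y \<in> ?H" "z \<in> ?H"
      then obtain u v u' v' where *: "y = x \<odot>\<^bsub>M\<^esub> u \<oplus>\<^bsub>M\<^esub> v" "u \<in> scaled A" "v \<in> scaled B"
        "z = x \<odot>\<^bsub>M\<^esub> u' \<oplus>\<^bsub>M\<^esub> v'" "u' \<in> scaled A" "v' \<in> scaled B" by blast
      have c: "u \<in> carrier M" "v \<in> carrier M" "u' \<in> carrier M" "v' \<in> carrier M" using * scaled_carrier by auto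
      have "y \<oplus>\<^bsub>M\<^esub> z = x \<odot>\<^bsub>M\<^esub> (u \<oplus>\<^bsub>M\<^esub> u') \<oplus>\<^bsub>M\<^esub> (v \<oplus>\<^bsub>M\<^esub> v')" unfolding *(1,4) using c x by algebra
      then show "y \<oplus>\<^bsub>M\<^esub> z \<in> ?H" using sA(5)[OF *(2,5)] sB(5)[OF *(3,6)] by blast
    next
      fix a y assume a: "a \<in> carrier R" and "y \<in> ?H"
      then obtain u v where *: "y = x \<odot>\<^bsub>M\<^esub> u \<oplus>\<^bsub>M\<^esub> v" "u \<in> scaled A" "v \<in> scaled B" by blast
      have c: "u \<in> carrier M" "v \<in> carrier M" using * scaled_carrier by auto
      have "a \<odot>\<^bsub>M\<^esub> y = x \<odot>\<^bsub>M\<^esub> (a \<odot>\<^bsub>M\<^esub> u) \<oplus>\<^bsub>M\<^esub> a \<odot>\<^bsub>M\<^esub> v" unfolding *(1) using c x a by algebra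
      then show "a \<odot>\<^bsub>M\<^esub> y \<in> ?H" using sA(4)[OF a *(2)] sB(4)[OF a *(3)] by blast
    qed
  next
    fix c q assume c: "c \<in> K" and q: "q \<in> carrier M"
    obtain a b where ab: "a \<in> A" "b \<in> B" "c = x \<otimes> a \<oplus> b" using K[OF c] by blast
    have "c \<odot>\<^bsub>M\<^esub> q = x \<odot>\<^bsub>M\<^esub> (a \<odot>\<^bsub>M\<^esub> q) \<oplus>\<^bsub>M\<^esub> b \<odot>\<^bsub>M\<^esub> q"
      unfolding ab(3) using ab(1,2) A.Icarr B.Icarr q x by (simp add: smult_l_distr smult_assoc1)
    then show "c \<odot>\<^bsub>M\<^esub> q \<in> ?H" using scaled_smult[OF A ab(1) q] scaled_smult[OF B ab(2) q] by blast
  qed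
  then show ?thesis by blast
qed

text \<open>The coordinate functional of \<open>q\<close> tensored with \<open>L\<close>.\<close>

definition coord :: "('a, 'l, 'k) module_scheme \<Rightarrow> 'c \<Rightarrow> ('c \<times> 'l \<Rightarrow> 'a) set \<Rightarrow> 'l"
  where "coord L q = tensor_lift R L (\<lambda>p l. \<sigma> p q \<odot>\<^bsub>L\<^esub> l)"

context
  fixes L assumes L: "module R L"
begin

interpretation L: module R L by (rule L)
interpretation T: tensor_product R M L by (simp add: tensor_product_def module_pair_def L module_axioms)
interpretation TT: module R "tensor R M L" by (rule T.module_tensor)

lemma coord_bilinear: "bilinear R M L L (\<lambda>p l. \<sigma> p q \<odot>\<^bsub>L\<^esub> l)"
  by (auto simp: bilinear_def intro!: module_homsI)
    (simp_all add: \<sigma>_closed \<sigma>_add \<sigma>_smult L.smult_l_distr L.smult_r_distr L.smult_assoc1 L.smult_lcomm)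

lemma coord_hom: "coord L q \<in> module_homs R (tensor R M L) L"
  unfolding coord_def by (rule T.lift_hom[OF L coord_bilinear])

lemma coord_pure: "p \<in> carrier M \<Longrightarrow> l \<in> carrier L \<Longrightarrow> coord L q (pure_tensor R M L p l) = \<sigma> p q \<odot>\<^bsub>L\<^esub> l"
  unfolding coord_def by (rule T.lift_pure[OF L coord_bilinear])

text \<open>The dual basis identity tensored with \<open>L\<close>: finitely many coordinates
  recover \<open>t\<close>.\<close>

lemma tensor_expand:
  assumes t: "t \<in> carrier (tensor R M L)"
  obtains A where "finite A" "A \<subseteq> carrier M" "t = finsum (tensor R M L) (\<lambda>q. pure_tensor R M L q (coord L q t)) A"
proof -
  let ?T = "tensor R M L"
  define E where "E B t = finsum ?T (\<lambda>q. pure_tensor R M L q (coord L q t)) B" for B t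
  interpret E: module_pair R ?T ?T by (simp add: module_pair_def T.module_tensor)
  have E_hom: "E B \<in> module_homs R ?T ?T" if "finite B" "B \<subseteq> carrier M" for B
    unfolding E_def
    by (rule E.finsum_module_hom[OF that(1)], rule hom_comp[OF coord_hom T.pure_hom_right]) (use that(2) in auto)
  \<comment> \<open>Stability under every larger finite \<open>B\<close> is included so that two
    elements can be compared over the union of their index sets.\<close>
  define S where "S A t \<longleftrightarrow> finite A \<and> A \<subseteq> carrier M \<and>
    (\<forall>B. finite B \<longrightarrow> A \<subseteq> B \<longrightarrow> B \<subseteq> carrier M \<longrightarrow> E B t = t)" for A t
  have pure: "E B (pure_tensor R M L p l) = pure_tensor R M L p l"
    if p: "p \<in> carrier M" and l: "l \<in> carrier L" and B: "finite B" "{q. \<sigma> p q \<noteq> \<zero>} \<subseteq> B" "B \<subseteq> carrier M" for p l B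
  proof -
    have pT: "module_pair R M ?T" by (simp add: module_pair_def module_axioms T.module_tensor)
    have "pure_tensor R M L p l = pure_tensor R M L (\<Oplus>\<^bsub>M\<^esub>q\<in>B. \<sigma> p q \<odot>\<^bsub>M\<^esub> q) l"
      using \<sigma>_expand[OF p B] by simp
    also have "\<dots> = finsum ?T (\<lambda>q. pure_tensor R M L (\<sigma> p q \<odot>\<^bsub>M\<^esub> q) l) B"
      by (rule module_pair.hom_finsum[OF pT T.pure_hom_left[OF l] B(1)]) (use B \<sigma>_closed[OF p] in auto)
    also have "\<dots> = E B (pure_tensor R M L p l)"
      unfolding E_def
    proof (rule TT.M.finsum_cong')
      fix q assume "q \<in> B"
      then have q: "q \<in> carrier M" using B by auto
      show "pure_tensor R M L (\<sigma> p q \<odot>\<^bsub>M\<^esub> q) l = pure_tensor R M L q (coord L q (pure_tensor R M L p l))"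
        using p l q \<sigma>_closed[OF p] by (simp add: coord_pure hom_smult[OF T.pure_hom_left] hom_smult[OF T.pure_hom_right])
    qed (use B p l hom_closed[OF coord_hom] in auto)
    finally show ?thesis by simp
  qed
  have "t \<in> {t \<in> carrier ?T. \<exists>A. S A t}"
  proof (rule T.tensor_induct[OF t TT.submoduleI'])
    have "S {} \<zero>\<^bsub>?T\<^esub>" using E.hom_zero[OF E_hom] by (simp add: S_def)
    then show "\<zero>\<^bsub>?T\<^esub> \<in> {t \<in> carrier ?T. \<exists>A. S A t}" by auto
    fix t u assume "t \<in> {t \<in> carrier ?T. \<exists>A. S A t}" "u \<in> {t \<in> carrier ?T. \<exists>A. S A t}"
    then obtain A A' where A: "t \<in> carrier ?T" "u \<in> carrier ?T" "S A t" "S A' u" by blast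
    have "S (A \<union> A') (t \<oplus>\<^bsub>?T\<^esub> u)" using A hom_add[OF E_hom] by (simp add: S_def)
    then show "t \<oplus>\<^bsub>?T\<^esub> u \<in> {t \<in> carrier ?T. \<exists>A. S A t}" using A(1,2) by auto
  next
    fix a t assume a: "a \<in> carrier R" and "t \<in> {t \<in> carrier ?T. \<exists>A. S A t}"
    then obtain A where A: "t \<in> carrier ?T" "S A t" by blast
    have "S A (a \<odot>\<^bsub>?T\<^esub> t)" using A hom_smult[OF E_hom] a by (simp add: S_def)
    then show "a \<odot>\<^bsub>?T\<^esub> t \<in> {t \<in> carrier ?T. \<exists>A. S A t}" using A(1) a by auto
  next
    fix p l assume p: "p \<in> carrier M" and l: "l \<in> carrier L"
    have "S {q. \<sigma> p q \<noteq> \<zero>} (pure_tensor R M L p l)" using \<sigma>_support[OF p] pure[OF p l] by (simp add: S_def)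
    then show "pure_tensor R M L p l \<in> {t \<in> carrier ?T. \<exists>A. S A t}" using p l by auto
  qed auto
  then obtain A where A: "finite A" "A \<subseteq> carrier M" "E A t = t" by (auto simp: S_def)
  show thesis by (rule that[OF A(1,2)]) (use A(3) in \<open>simp add: E_def\<close>)
qed

text \<open>Coordinates separate the elements of the tensor product; the injectivity statements
  below, in particular flatness, reduce to this.\<close>

lemma tensor_eq_zero:
  assumes t: "t \<in> carrier (tensor R M L)" and z: "\<And>q. q \<in> carrier M \<Longrightarrow> coord L q t = \<zero>\<^bsub>L\<^esub>"
  shows "t = \<zero>\<^bsub>tensor R M L\<^esub>"
proof -
  obtain A where A: "finite A" "A \<subseteq> carrier M" "t = finsum (tensor R M L) (\<lambda>q. pure_tensor R M L q (coord L q t)) A"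
    using tensor_expand[OF t] .
  have "pure_tensor R M L q (coord L q t) = \<zero>\<^bsub>tensor R M L\<^esub>" if "q \<in> A" for q
    using that A(2) z module_pair.hom_zero[OF _ T.pure_hom_right, of q] by (auto simp: module_pair_def L T.module_tensor)
  then have "(\<Oplus>\<^bsub>tensor R M L\<^esub>q\<in>A. pure_tensor R M L q (coord L q t)) = (\<Oplus>\<^bsub>tensor R M L\<^esub>q\<in>A. \<zero>\<^bsub>tensor R M L\<^esub>)"
    by (intro TT.M.finsum_cong') auto
  then show ?thesis using A(3) by simp
qed

end

section \<open>Exactness of tensoring with a projective module\<close>

lemma coord_tensor_map:
  assumes L: "module R L" and N: "module R N" and f: "f \<in> module_homs R L N" and t: "t \<in> carrier (tensor R M L)"
  shows "coord N q (tensor_map R M N (\<lambda>x. x) f t) = f (coord L q t)"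
proof (rule tensor_product.tensor_hom_eq[OF _ N _ _ _ t])
  show "tensor_product R M L" by (simp add: tensor_product_def module_pair_def L module_axioms)
  note tm = tensor_map_hom[OF module_axioms L module_axioms N id_hom f]
  show "(\<lambda>t. coord N q (tensor_map R M N (\<lambda>x. x) f t)) \<in> module_homs R (tensor R M L) N"
    by (rule hom_comp[OF tm(1) coord_hom[OF N]])
  show "(\<lambda>t. f (coord L q t)) \<in> module_homs R (tensor R M L) N"
    by (rule hom_comp[OF coord_hom[OF L] f])
  fix p l assume "p \<in> carrier M" "l \<in> carrier L"
  then show "coord N q (tensor_map R M N (\<lambda>x. x) f (pure_tensor R M L p l)) = f (coord L q (pure_tensor R M L p l))"
    by (simp add: tm(2) coord_pure[OF L] coord_pure[OF N] hom_closed[OF f] hom_smult[OF f] \<sigma>_closed)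
qed

text \<open>Tensoring a map acts on each coordinate by the map itself
  (\<open>coord_tensor_map\<close>), so kernels are tested on coordinates and preimages are
  assembled from preimages of coordinates.\<close>

theorem short_exact_tensor:
  assumes ex: "short_exact R L N C f g"
  shows "short_exact R (tensor R M L) (tensor R M N) (tensor R M C)
    (tensor_map R M N (\<lambda>x. x) f) (tensor_map R M C (\<lambda>x. x) g)"
proof -
  have L: "module R L" and N: "module R N" and C: "module R C" and f: "f \<in> module_homs R L N"
    and g: "g \<in> module_homs R N C" and inj: "inj_on f (carrier L)" and im: "f ` carrier L = a_kernel N C g"
    and sur: "g ` carrier N = carrier C" using ex by (auto simp: short_exact_def)
  let ?f = "tensor_map R M N (\<lambda>x. x) f" and ?g = "tensor_map R M C (\<lambda>x. x) g"
  note tf = tensor_map_hom[OF module_axioms L module_axioms N id_hom f] and tg = tensor_map_hom[OF module_axioms N module_axioms C id_hom g]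
  interpret TL: tensor_product R M L by (simp add: tensor_product_def module_pair_def L module_axioms)
  interpret TN: tensor_product R M N by (simp add: tensor_product_def module_pair_def N module_axioms)
  interpret TC: tensor_product R M C by (simp add: tensor_product_def module_pair_def C module_axioms)
  interpret pf: module_pair R "tensor R M L" "tensor R M N" by (simp add: module_pair_def TL.module_tensor TN.module_tensor)
  interpret pg: module_pair R "tensor R M N" "tensor R M C" by (simp add: module_pair_def TC.module_tensor TN.module_tensor)
  interpret LN: module_pair R L N by (simp add: module_pair_def L N)
  \<comment> \<open>Stated for general \<open>A\<close> and \<open>B\<close> because it serves both
    \<open>f\<close> and \<open>g\<close>. The chosen values \<open>a q\<close> may differ from the
    coordinates of the assembled element; only its image matters.\<close>
  have lift: "\<exists>t'\<in>carrier (tensor R M A). tensor_map R M B (\<lambda>x. x) h t' = t"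
    if A: "module R A" and B: "module R B" and h: "h \<in> module_homs R A B" and t: "t \<in> carrier (tensor R M B)"
      and pre: "\<And>q. q \<in> carrier M \<Longrightarrow> coord B q t \<in> h ` carrier A"
    for A :: "('a, 'x, 'y) module_scheme" and B :: "('a, 'z, 'w) module_scheme" and h t
  proof -
    interpret TA: tensor_product R M A by (simp add: tensor_product_def module_pair_def A module_axioms)
    interpret TA': module R "tensor R M A" by (rule TA.module_tensor)
    interpret TB: tensor_product R M B by (simp add: tensor_product_def module_pair_def B module_axioms)
    interpret TB': module R "tensor R M B" by (rule TB.module_tensor)
    note th = tensor_map_hom[OF module_axioms A module_axioms B id_hom h]
    obtain F where F: "finite F" "F \<subseteq> carrier M" "t = finsum (tensor R M B) (\<lambda>q. pure_tensor R M B q (coord B q t)) F"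
      using tensor_expand[OF B t] .
    have "\<forall>q\<in>F. \<exists>a. a \<in> carrier A \<and> coord B q t = h a" using pre F(2) by blast
    then obtain a where a: "\<And>q. q \<in> F \<Longrightarrow> a q \<in> carrier A \<and> coord B q t = h (a q)" by metis
    let ?t = "finsum (tensor R M A) (\<lambda>q. pure_tensor R M A q (a q)) F"
    have "tensor_map R M B (\<lambda>x. x) h ?t = finsum (tensor R M B) (\<lambda>q. tensor_map R M B (\<lambda>x. x) h (pure_tensor R M A q (a q))) F"
      by (rule module_pair.hom_finsum[OF _ th(1) F(1)]) (use a F(2) in \<open>auto simp: module_pair_def TA.module_tensor TB.module_tensor\<close>)
    also have "\<dots> = finsum (tensor R M B) (\<lambda>q. pure_tensor R M B q (coord B q t)) F"
      by (rule TB'.M.finsum_cong') (use a F(2) in \<open>auto simp: th(2) subset_iff hom_closed[OF h]\<close>)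
    finally have "tensor_map R M B (\<lambda>x. x) h ?t = t" using F(3) by simp
    moreover have "?t \<in> carrier (tensor R M A)" by (rule TA'.M.finsum_closed) (use a F(2) in auto)
    ultimately show ?thesis by blast
  qed
  have f0: "x = \<zero>\<^bsub>L\<^esub>" if "x \<in> carrier L" "f x = \<zero>\<^bsub>N\<^esub>" for x
    using inj_onD[OF inj, of x "\<zero>\<^bsub>L\<^esub>"] that LN.hom_zero[OF f] by auto
  have "inj_on ?f (carrier (tensor R M L))"
  proof (rule inj_onI)
    fix t t' assume t: "t \<in> carrier (tensor R M L)" "t' \<in> carrier (tensor R M L)" and eq: "?f t = ?f t'"
    let ?d = "t \<ominus>\<^bsub>tensor R M L\<^esub> t'"
    have d: "?d \<in> carrier (tensor R M L)" using t by simp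
    have fd: "?f ?d = \<zero>\<^bsub>tensor R M N\<^esub>" using t eq pf.N.minus_eq_zero_iff hom_closed[OF tf(1)] by (simp add: pf.hom_minus[OF tf(1)])
    have "?d = \<zero>\<^bsub>tensor R M L\<^esub>"
    proof (rule tensor_eq_zero[OF L d])
      fix q assume "q \<in> carrier M"
      have "f (coord L q ?d) = \<zero>\<^bsub>N\<^esub>" unfolding coord_tensor_map[OF L N f d, symmetric] fd
        by (rule module_pair.hom_zero[OF _ coord_hom[OF N]]) (simp add: module_pair_def N TN.module_tensor)
      then show "coord L q ?d = \<zero>\<^bsub>L\<^esub>" using f0 hom_closed[OF coord_hom[OF L] d] by blast
    qed
    then show "t = t'" using t pf.M.minus_eq_zero_iff by blast
  qed
  moreover have "?f ` carrier (tensor R M L) = a_kernel (tensor R M N) (tensor R M C) ?g"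
  proof
    show "?f ` carrier (tensor R M L) \<subseteq> a_kernel (tensor R M N) (tensor R M C) ?g"
    proof
      fix u assume "u \<in> ?f ` carrier (tensor R M L)"
      then obtain t where t: "t \<in> carrier (tensor R M L)" "u = ?f t" by blast
      have u: "u \<in> carrier (tensor R M N)" using t hom_closed[OF tf(1)] by blast
      have gf: "g (f l) = \<zero>\<^bsub>C\<^esub>" if "l \<in> carrier L" for l using that im by (auto simp: a_kernel_def')
      have "?g u = \<zero>\<^bsub>tensor R M C\<^esub>"
        by (rule tensor_eq_zero[OF C hom_closed[OF tg(1) u]])
          (simp add: coord_tensor_map[OF N C g u], simp add: t coord_tensor_map[OF L N f] gf hom_closed[OF coord_hom[OF L]])
      then show "u \<in> a_kernel (tensor R M N) (tensor R M C) ?g" using u by (simp add: a_kernel_def')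
    qed
    show "a_kernel (tensor R M N) (tensor R M C) ?g \<subseteq> ?f ` carrier (tensor R M L)"
    proof
      fix u assume "u \<in> a_kernel (tensor R M N) (tensor R M C) ?g"
      then have u: "u \<in> carrier (tensor R M N)" "?g u = \<zero>\<^bsub>tensor R M C\<^esub>" by (auto simp: a_kernel_def')
      have "coord N q u \<in> f ` carrier L" for q
      proof -
        have "g (coord N q u) = \<zero>\<^bsub>C\<^esub>" unfolding coord_tensor_map[OF N C g u(1), symmetric] u(2)
          by (rule module_pair.hom_zero[OF _ coord_hom[OF C]]) (simp add: module_pair_def C TC.module_tensor)
        then show ?thesis unfolding im using hom_closed[OF coord_hom[OF N] u(1)] by (simp add: a_kernel_def')
      qed
      then show "u \<in> ?f ` carrier (tensor R M L)" using lift[OF L N f u(1)] by blast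
    qed
  qed
  moreover have "?g ` carrier (tensor R M N) = carrier (tensor R M C)"
  proof
    show "?g ` carrier (tensor R M N) \<subseteq> carrier (tensor R M C)" using hom_closed[OF tg(1)] by blast
    show "carrier (tensor R M C) \<subseteq> ?g ` carrier (tensor R M N)"
    proof
      fix u assume u: "u \<in> carrier (tensor R M C)"
      have "coord C q u \<in> g ` carrier N" for q using hom_closed[OF coord_hom[OF C] u] sur by blast
      then show "u \<in> ?g ` carrier (tensor R M N)" using lift[OF N C g u] by blast
    qed
  qed
  ultimately show ?thesis
    unfolding short_exact_def by (intro conjI tf(1) tg(1) TL.module_tensor TN.module_tensor TC.module_tensor)
qed

section \<open>The multiplication map from \<open>M \<otimes> K\<close> onto
  \<open>K M\<close>\<close>

definition mult_map :: "('c \<times> 'a \<Rightarrow> 'a) set \<Rightarrow> 'c"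
  where "mult_map = tensor_lift R M (\<lambda>p a. a \<odot>\<^bsub>M\<^esub> p)"

context
  fixes K assumes K: "ideal K R"
begin

interpretation K: ideal K R by (rule K)

lemma module_K: "module R (ideal_module R K)"
  by (rule module_ideal_module[OF is_cring K])

interpretation T: tensor_product R M "ideal_module R K"
  by (simp add: tensor_product_def module_pair_def module_K module_axioms)
interpretation TT: module R "tensor R M (ideal_module R K)" by (rule T.module_tensor)

lemma mult_bilinear: "bilinear R M (ideal_module R K) M (\<lambda>p a. a \<odot>\<^bsub>M\<^esub> p)"
  by (auto simp: bilinear_def K.Icarr smult_l_distr smult_r_distr smult_assoc1 smult_lcomm intro!: module_homsI)

lemma mult_map_hom: "mult_map \<in> module_homs R (tensor R M (ideal_module R K)) M"
  unfolding mult_map_def by (rule T.lift_hom[OF module_axioms mult_bilinear])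

lemma mult_map_pure: "p \<in> carrier M \<Longrightarrow> a \<in> K \<Longrightarrow> mult_map (pure_tensor R M (ideal_module R K) p a) = a \<odot>\<^bsub>M\<^esub> p"
  unfolding mult_map_def using T.lift_pure[OF module_axioms mult_bilinear] by simp

text \<open>On a pure tensor both sides are the product of \<open>a\<close> and
  \<open>\<sigma> p q\<close>. Injectivity of \<open>mult_map\<close> follows, since a tensor is
  determined by its coordinates, and so does the inclusion of its image in
  \<open>scaled K\<close>.\<close>

lemma \<sigma>_mult_map:
  assumes t: "t \<in> carrier (tensor R M (ideal_module R K))"
  shows "\<sigma> (mult_map t) q = coord (ideal_module R K) q t"
proof -
  note c = hom_closed[OF mult_map_hom] hom_add[OF mult_map_hom] hom_smult[OF mult_map_hom]
    hom_add[OF coord_hom[OF module_K]] hom_smult[OF coord_hom[OF module_K]]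
  let ?H = "{t \<in> carrier (tensor R M (ideal_module R K)). \<sigma> (mult_map t) q = coord (ideal_module R K) q t}"
  have "t \<in> ?H"
  proof (rule T.tensor_induct[OF t])
    show "submodule ?H R (tensor R M (ideal_module R K))"
    proof (rule TT.submoduleI')
      have "mult_map \<zero>\<^bsub>tensor R M (ideal_module R K)\<^esub> = \<zero>\<^bsub>M\<^esub>"
        by (rule module_pair.hom_zero[OF _ mult_map_hom]) (simp add: module_pair_def T.module_tensor module_axioms)
      moreover have "coord (ideal_module R K) q \<zero>\<^bsub>tensor R M (ideal_module R K)\<^esub> = \<zero>\<^bsub>ideal_module R K\<^esub>"
        by (rule module_pair.hom_zero[OF _ coord_hom[OF module_K]]) (simp add: module_pair_def T.module_tensor module_K)
      ultimately show "\<zero>\<^bsub>tensor R M (ideal_module R K)\<^esub> \<in> ?H" by (simp add: \<sigma>_zero)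
    qed (auto simp: c \<sigma>_add \<sigma>_smult)
    fix p a assume "p \<in> carrier M" "a \<in> carrier (ideal_module R K)"
    then show "pure_tensor R M (ideal_module R K) p a \<in> ?H"
      using T.pure_closed[of p a]
      by (simp add: mult_map_pure \<sigma>_smult K.Icarr coord_pure[OF module_K] \<sigma>_closed R.m_comm)
  qed
  then show ?thesis by simp
qed

lemma mult_map_zero:
  assumes t: "t \<in> carrier (tensor R M (ideal_module R K))" and z: "mult_map t = \<zero>\<^bsub>M\<^esub>"
  shows "t = \<zero>\<^bsub>tensor R M (ideal_module R K)\<^esub>"
  by (rule tensor_eq_zero[OF module_K t]) (simp add: \<sigma>_mult_map[OF t, symmetric] z \<sigma>_zero)

lemma mult_map_image: "mult_map ` carrier (tensor R M (ideal_module R K)) = scaled K"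
proof
  show "mult_map ` carrier (tensor R M (ideal_module R K)) \<subseteq> scaled K"
    using hom_closed[OF mult_map_hom] hom_closed[OF coord_hom[OF module_K]] by (auto simp: scaled_def \<sigma>_mult_map)
  have P: "module_pair R (tensor R M (ideal_module R K)) M" by (simp add: module_pair_def T.module_tensor module_axioms)
  show "scaled K \<subseteq> mult_map ` carrier (tensor R M (ideal_module R K))"
  proof
    fix p assume "p \<in> scaled K"
    then show "p \<in> mult_map ` carrier (tensor R M (ideal_module R K))"
    proof (rule scaled_induct[OF _ module_pair.hom_image_submodule[OF P mult_map_hom TT.carrier_is_submodule]])
      fix a q assume "a \<in> K" "q \<in> carrier M"
      then show "a \<odot>\<^bsub>M\<^esub> q \<in> mult_map ` carrier (tensor R M (ideal_module R K))"
        using T.pure_closed[of q a] mult_map_pure[of q a] by (metis ideal_module_sel(1) imageI)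
    qed
  qed
qed

end

end

text \<open>\<open>scaled\<close> is defined through coordinates, but its generators
  \<open>a q\<close> with \<open>a\<close> in \<open>K\<close> make it compatible with every linear
  map, whatever the splittings.\<close>

lemma scaled_hom:
  assumes A: "split_module R M \<sigma>" and B: "split_module R N \<tau>" and f: "f \<in> module_homs R M N" and K: "ideal K R"
    and p: "p \<in> split_module.scaled M \<sigma> K"
  shows "f p \<in> split_module.scaled N \<tau> K"
proof -
  interpret A: split_module R M \<sigma> by fact
  interpret B: split_module R N \<tau> by fact
  interpret K: ideal K R by fact
  interpret module_pair R M N by unfold_locales
  have "p \<in> {p \<in> carrier M. f p \<in> B.scaled K}"
    by (rule A.scaled_induct[OF p hom_vimage_submodule[OF f B.scaled_submodule[OF K]]])
      (simp add: hom_smult[OF f] K.Icarr B.scaled_smult[OF K] hom_closed[OF f])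
  then show ?thesis by simp
qed

section \<open>Powers of ideals generated by regular sequences\<close>

context cring
begin

abbreviation pw :: "'a set \<Rightarrow> nat \<Rightarrow> 'a set" where "pw I n \<equiv> I [^]\<^bsub>ideals_set R\<^esub> n"

lemma pw_0: "pw I 0 = carrier R"
  by (simp add: nat_pow_def ideals_set_def)

lemma pw_Suc: "pw I (Suc n) = ideal_prod R (pw I n) I"
  by (simp add: nat_pow_def ideals_set_def)

lemma ideal_prod_mono: "I \<subseteq> I' \<Longrightarrow> J \<subseteq> J' \<Longrightarrow> ideal_prod R I J \<subseteq> ideal_prod R I' J'"
proof
  fix c assume s: "I \<subseteq> I'" "J \<subseteq> J'" and c: "c \<in> ideal_prod R I J"
  show "c \<in> ideal_prod R I' J'" using c
    by (induct) (use s in \<open>auto intro: ideal_prod.intros\<close>)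
qed

lemma pw_mono: "J \<subseteq> I \<Longrightarrow> pw J n \<subseteq> pw I n"
  by (induct n) (simp_all only: pw_0 pw_Suc subset_refl ideal_prod_mono)

lemma pw_mult: "ideal I R \<Longrightarrow> y \<in> I \<Longrightarrow> a \<in> pw I n \<Longrightarrow> y \<otimes> a \<in> pw I (Suc n)"
  using ideal_prod.prod[of a "pw I n" y I R] ideal.Icarr[of I R y] ideal.Icarr[OF ideal_power_ideal, of I a n]
  by (simp only: pw_Suc m_comm)

definition nzd_mod :: "'a \<Rightarrow> 'a set \<Rightarrow> bool"
  where "nzd_mod x K \<longleftrightarrow> (\<forall>a\<in>carrier R. x \<otimes> a \<in> K \<longrightarrow> a \<in> K)"

definition adjoined :: "'a set \<Rightarrow> 'a \<Rightarrow> 'a set \<Rightarrow> bool"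
  where "adjoined J y I \<longleftrightarrow> ideal J R \<and> ideal I R \<and> J \<subseteq> I \<and> y \<in> I \<and>
    (\<forall>a\<in>I. \<exists>r\<in>carrier R. \<exists>j\<in>J. a = y \<otimes> r \<oplus> j)"

lemma genideal_adjoined:
  assumes "set ys \<subseteq> carrier R" "y \<in> carrier R"
  shows "adjoined (genideal R (set ys)) y (genideal R (set (ys @ [y])))"
proof -
  let ?J = "genideal R (set ys)" and ?I = "genideal R (set (ys @ [y]))"
  have J: "ideal ?J R" and I: "ideal ?I R" using assms by (auto intro: genideal_ideal)
  have P: "ideal (PIdl y) R" by (rule cgenideal_ideal[OF assms(2)])
  interpret J: ideal ?J R by (rule J)
  interpret P: ideal "PIdl y" R by (rule P)
  have gI: "set (ys @ [y]) \<subseteq> ?I" by (rule genideal_self) (use assms in auto)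
  have "?I \<subseteq> ?J <+> PIdl y"
  proof (rule genideal_minimal[OF add_ideals[OF J P]])
    have "?J \<subseteq> ?J <+> PIdl y"
    proof
      fix j assume "j \<in> ?J"
      then have "j = j \<oplus> \<zero>" "j \<in> ?J" using J.Icarr by auto
      then show "j \<in> ?J <+> PIdl y" using P.zero_closed unfolding set_add_def' by blast
    qed
    moreover have "set ys \<subseteq> ?J" by (rule genideal_self[OF assms(1)])
    moreover have "y = \<zero> \<oplus> y" using assms by simp
    then have "y \<in> ?J <+> PIdl y" using J.zero_closed cgenideal_self[OF assms(2)] unfolding set_add_def' by blast
    ultimately show "set (ys @ [y]) \<subseteq> ?J <+> PIdl y" by auto
  qed
  moreover have "\<exists>r\<in>carrier R. \<exists>j\<in>?J. a = y \<otimes> r \<oplus> j" if "a \<in> ?J <+> PIdl y" for a :: 'a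
  proof -
    obtain j r where "j \<in> ?J" "r \<in> carrier R" "a = j \<oplus> r \<otimes> y"
      using \<open>a \<in> ?J <+> PIdl y\<close> unfolding set_add_def' cgenideal_def by blast
    then show ?thesis using J.Icarr assms(2) by (intro bexI[of _ r] bexI[of _ j]) (auto simp: a_comm m_comm)
  qed
  moreover have "?J \<subseteq> ?I" by (rule genideal_minimal[OF I]) (use gI in auto)
  ultimately show ?thesis using I J gI by (auto simp: adjoined_def)
qed

lemma genideal_empty: "genideal R {} = {\<zero>}"
  using genideal_minimal[OF zeroideal, of "{}"] additive_subgroup.zero_closed[OF ideal.axioms(1)[OF genideal_ideal[of "{}"]]]
  by auto

text \<open>Regularity of an entry is relative to its predecessors, so the inductions on the
  sequence remove the last entry.\<close>

lemma regular_sequence_snoc: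
  "regular_sequence R (ys @ [y]) \<longleftrightarrow> regular_sequence R ys \<and> y \<in> carrier R \<and> nzd_mod y (genideal R (set ys))"
proof (cases "set ys \<subseteq> carrier R \<and> y \<in> carrier R")
  case True
  let ?P = "\<lambda>J x. \<forall>c\<in>carrier (R Quot J). (J +> x) \<otimes>\<^bsub>R Quot J\<^esub> c = \<zero>\<^bsub>R Quot J\<^esub> \<longrightarrow> c = \<zero>\<^bsub>R Quot J\<^esub>"
  have J: "ideal (genideal R (set ys)) R" using True by (intro genideal_ideal) auto
  interpret J: ideal "genideal R (set ys)" R by (rule J)
  have e: "genideal R (set ys) +> r = genideal R (set ys) \<longleftrightarrow> r \<in> genideal R (set ys)" if "r \<in> carrier R" for r
    using J.rcos_const_imp_mem[OF that] a_rcos_zero[OF J] by blast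
  have "?P (genideal R (set ys)) y \<longleftrightarrow> nzd_mod y (genideal R (set ys))"
    using True by (auto simp: nzd_mod_def FactRing_def A_RCOSETS_def' J.rcoset_mult_add e)
  moreover have "(\<forall>i<Suc (length ys). ?P (genideal R (set (take i (ys @ [y])))) ((ys @ [y]) ! i)) \<longleftrightarrow>
    (\<forall>i<length ys. ?P (genideal R (set (take i ys))) (ys ! i)) \<and> ?P (genideal R (set ys)) y"
    by (simp add: less_Suc_eq nth_append all_conj_distrib imp_disjL)
  ultimately show ?thesis using True by (simp add: regular_sequence_def Let_def)
next
  case False
  then show ?thesis by (auto simp: regular_sequence_def)
qed

text \<open>In a product of elements \<open>y r + j\<close>, the summand without a factor
  \<open>y\<close> lies in the power of \<open>J\<close>; all others are \<open>y\<close> times an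
  element of a power of \<open>I\<close> that is lower by one.\<close>

lemma pw_adjoined:
  assumes adj: "adjoined J y I" and c: "c \<in> pw I (Suc n)"
  shows "\<exists>a\<in>pw I n. \<exists>b\<in>pw J (Suc n). c = y \<otimes> a \<oplus> b"
  using c
proof (induct n arbitrary: c)
  case 0
  have "ideal_prod R (carrier R) I \<subseteq> I" using ideal_prod_inter[OF oneideal] adj by (auto simp: adjoined_def)
  then have "c \<in> I" using 0 by (simp only: pw_Suc pw_0) blast
  then obtain r j where rj: "r \<in> carrier R" "j \<in> J" "c = y \<otimes> r \<oplus> j" using adj by (auto simp: adjoined_def)
  have "\<one> \<otimes> j \<in> pw J (Suc 0)" unfolding pw_Suc pw_0 using rj(2) by (intro ideal_prod.prod) auto
  moreover have "j \<in> carrier R" using adj rj(2) by (auto simp: adjoined_def ideal.Icarr)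
  ultimately show ?case using rj pw_0 by auto
next
  case (Suc n)
  have I: "ideal I R" and J: "ideal J R" and JI: "J \<subseteq> I" and yI: "y \<in> I" using adj by (auto simp: adjoined_def)
  note pI = ideal.Icarr[OF ideal_power_ideal[OF I]] and pJ = ideal.Icarr[OF ideal_power_ideal[OF J]]
  have y: "y \<in> carrier R" using yI ideal.Icarr[OF I] by blast
  have "c \<in> ideal_prod R (pw I (Suc n)) I" using Suc.prems by (simp only: pw_Suc)
  then show ?case
  proof (induct)
    case (prod i j)
    obtain a b where ab: "a \<in> pw I n" "b \<in> pw J (Suc n)" "i = y \<otimes> a \<oplus> b" using Suc.hyps[OF prod(1)] by blast
    obtain r k where rk: "r \<in> carrier R" "k \<in> J" "j = y \<otimes> r \<oplus> k" using adj prod(2) by (auto simp: adjoined_def)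
    have car: "a \<in> carrier R" "b \<in> carrier R" "k \<in> carrier R" "j \<in> carrier R"
      using ab rk prod(2) pI pJ ideal.Icarr[OF J] ideal.Icarr[OF I] by blast+
    have bI: "b \<in> pw I (Suc n)" using ab(2) pw_mono[OF JI] by blast
    \<comment> \<open>With \<open>j\<close> left unexpanded next to \<open>y a\<close>, only
      \<open>b k\<close> has no factor \<open>y\<close>.\<close>
    have "i \<otimes> j = y \<otimes> (j \<otimes> a \<oplus> r \<otimes> b) \<oplus> b \<otimes> k"
      unfolding ab(3) rk(3) using car y rk(1) by algebra
    moreover have "j \<otimes> a \<oplus> r \<otimes> b \<in> pw I (Suc n)"
      using pw_mult[OF I prod(2) ab(1)] ideal.I_l_closed[OF ideal_power_ideal[OF I] bI rk(1)]
        additive_subgroup.a_closed[OF ideal.axioms(1)[OF ideal_power_ideal[OF I]]] by blast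
    moreover have "b \<otimes> k \<in> pw J (Suc (Suc n))"
      unfolding pw_Suc[of J "Suc n"] using ab(2) rk(2) by (rule ideal_prod.prod)
    ultimately show ?case by blast
  next
    case (sum c c')
    obtain a b a' b' where *: "a \<in> pw I (Suc n)" "b \<in> pw J (Suc (Suc n))" "c = y \<otimes> a \<oplus> b"
      "a' \<in> pw I (Suc n)" "b' \<in> pw J (Suc (Suc n))" "c' = y \<otimes> a' \<oplus> b'" using sum by blast
    have "a \<in> carrier R" "b \<in> carrier R" "a' \<in> carrier R" "b' \<in> carrier R" using * pI pJ by blast+
    then have "c \<oplus> c' = y \<otimes> (a \<oplus> a') \<oplus> (b \<oplus> b')" unfolding *(3,6) using y by algebra
    then show ?case using * additive_subgroup.a_closed[OF ideal.axioms(1)[OF ideal_power_ideal[OF I]]]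
        additive_subgroup.a_closed[OF ideal.axioms(1)[OF ideal_power_ideal[OF J]]] by blast
  qed
qed

text \<open>The same splitting with a factor \<open>K\<close> carried along, for use in
  \<open>regular_sequence_graded\<close>.\<close>

lemma prod_pw_adjoined:
  assumes adj: "adjoined J y I" and K: "ideal K R" and c: "c \<in> ideal_prod R K (pw I (Suc n))"
  shows "\<exists>a\<in>ideal_prod R K (pw I n). \<exists>b\<in>ideal_prod R K (pw J (Suc n)). c = y \<otimes> a \<oplus> b"
  using c
proof (induct)
  have I: "ideal I R" and J: "ideal J R" and yI: "y \<in> I" using adj by (auto simp: adjoined_def)
  note pI = ideal.Icarr[OF ideal_power_ideal[OF I]] and pJ = ideal.Icarr[OF ideal_power_ideal[OF J]]
  have y: "y \<in> carrier R" using yI ideal.Icarr[OF I] by blast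
  {
    case (prod k j)
    obtain a b where ab: "a \<in> pw I n" "b \<in> pw J (Suc n)" "j = y \<otimes> a \<oplus> b" using pw_adjoined[OF adj prod(2)] by blast
    have "a \<in> carrier R" "b \<in> carrier R" "k \<in> carrier R" using ab pI pJ prod(1) ideal.Icarr[OF K] by blast+
    then have "k \<otimes> j = y \<otimes> (k \<otimes> a) \<oplus> k \<otimes> b" unfolding ab(3) using y by algebra
    then show ?case using ideal_prod.prod[OF prod(1) ab(1)] ideal_prod.prod[OF prod(1) ab(2)] by blast
  next
    case (sum c c')
    note c = ideal.Icarr[OF ideal_prod_is_ideal[OF K ideal_power_ideal[OF I]]] ideal.Icarr[OF ideal_prod_is_ideal[OF K ideal_power_ideal[OF J]]]
    obtain a b a' b' where *: "a \<in> ideal_prod R K (pw I n)" "b \<in> ideal_prod R K (pw J (Suc n))" "c = y \<otimes> a \<oplus> b"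
      "a' \<in> ideal_prod R K (pw I n)" "b' \<in> ideal_prod R K (pw J (Suc n))" "c' = y \<otimes> a' \<oplus> b'" using sum by blast
    have "a \<in> carrier R" "b \<in> carrier R" "a' \<in> carrier R" "b' \<in> carrier R" using * c by blast+
    then have "c \<oplus> c' = y \<otimes> (a \<oplus> a') \<oplus> (b \<oplus> b')" unfolding *(3,6) using y by algebra
    then show ?case using ideal_prod.sum[OF *(1,4)] ideal_prod.sum[OF *(2,5)] by blast
  }
qed

lemma prod_pw_mult:
  assumes I: "ideal I R" and K: "ideal K R" and y: "y \<in> I" and c: "c \<in> ideal_prod R K (pw I n)"
  shows "y \<otimes> c \<in> ideal_prod R K (pw I (Suc n))"
  using c
proof (induct)
  have yc: "y \<in> carrier R" using y ideal.Icarr[OF I] by blast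
  note pI = ideal.Icarr[OF ideal_power_ideal[OF I]]
  {
    case (prod k a)
    have "a \<in> carrier R" "k \<in> carrier R" using prod pI ideal.Icarr[OF K] by blast+
    then have "y \<otimes> (k \<otimes> a) = k \<otimes> (y \<otimes> a)" using yc by algebra
    then show ?case using ideal_prod.prod[OF prod(1) pw_mult[OF I y prod(2)]] by simp
  next
    case (sum c c')
    have "c \<in> carrier R" "c' \<in> carrier R" using sum ideal.Icarr[OF ideal_prod_is_ideal[OF K ideal_power_ideal[OF I]]] by blast+
    then show ?case using ideal_prod.sum[OF sum(2,4)] yc by (simp add: r_distr)
  }
qed

text \<open>The hypothesis on products says that \<open>x\<close> is a non-zero-divisor on the pieces \<open>J\<^sup>n/J\<^sup>n\<^sup>+\<^sup>1\<close>.\<close>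

lemma nzd_mod_pw:
  assumes J: "ideal J R" and x: "x \<in> carrier R"
    and gr: "\<And>n a. a \<in> pw J n \<Longrightarrow> x \<otimes> a \<in> ideal_prod R J (pw J n) \<Longrightarrow> a \<in> ideal_prod R J (pw J n)"
  shows "nzd_mod x (pw J n)"
proof (induct n)
  case 0 show ?case by (simp only: pw_0 nzd_mod_def) simp
next
  case (Suc n)
  have e: "pw J (Suc n) = ideal_prod R J (pw J n)"
    unfolding pw_Suc by (rule ideal_prod_commute[OF ideal_power_ideal[OF J] J])
  show ?case unfolding nzd_mod_def
  proof (intro ballI impI)
    fix a assume a: "a \<in> carrier R" and xa: "x \<otimes> a \<in> pw J (Suc n)"
    then have "a \<in> pw J n" using Suc ideal_power_Suc_subset[OF J, of n] unfolding nzd_mod_def by blast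
    then show "a \<in> pw J (Suc n)" using gr xa unfolding e by blast
  qed
qed

text \<open>Injectivity of \<open>x\<close> on \<open>J\<^sup>s/K J\<^sup>s\<close>, a trace of the
  fact that for a regular sequence \<open>J\<^sup>s/J\<^sup>s\<^sup>+\<^sup>1\<close> is free over
  \<open>R/J\<close>. The ideal \<open>K\<close> is independent of the sequence because the passage
  to a shorter sequence shrinks \<open>J\<close> but keeps \<open>K\<close>. The outer induction is
  on the sequence, the inner one on \<open>s\<close>; in the splitting \<open>a = y a2 + a1\<close>
  the inner hypothesis handles \<open>a2\<close> and the outer one \<open>a1\<close>.\<close>

lemma regular_sequence_graded:
  assumes "regular_sequence R ys" "ideal K R" "genideal R (set ys) \<subseteq> K" "x \<in> carrier R" "nzd_mod x K"
    "a \<in> pw (genideal R (set ys)) s" "x \<otimes> a \<in> ideal_prod R K (pw (genideal R (set ys)) s)"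
  shows "a \<in> ideal_prod R K (pw (genideal R (set ys)) s)"
  using assms
proof (induct ys arbitrary: K x a s rule: rev_induct)
  case Nil
  show ?case
  proof (cases s)
    case 0
    have "a \<in> carrier R" using Nil(6) unfolding 0 pw_0 .
    then show ?thesis using Nil(5,7) unfolding 0 pw_0 ideal_prod_one[OF Nil(2)] by (auto simp: nzd_mod_def)
  next
    case (Suc n)
    have z: "ideal {\<zero>} R" by (rule zeroideal)
    have "pw {\<zero>} s \<subseteq> {\<zero>}" unfolding Suc pw_Suc using ideal_prod_inter[OF ideal_power_ideal[OF z] z] by blast
    then have "a = \<zero>" using Nil(6) by (auto simp: genideal_empty)
    then show ?thesis
      using additive_subgroup.zero_closed[OF ideal.axioms(1)[OF ideal_prod_is_ideal[OF Nil(2) ideal_power_ideal]]] z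
      by (simp add: genideal_empty)
  qed
next
  case (snoc y ys)
  let ?J' = "genideal R (set ys)" and ?J = "genideal R (set (ys @ [y]))"
  have reg: "regular_sequence R ys" "y \<in> carrier R" "nzd_mod y ?J'" using snoc(2) by (auto simp: regular_sequence_snoc)
  then have ysR: "set ys \<subseteq> carrier R" by (simp add: regular_sequence_def)
  have adj: "adjoined ?J' y ?J" by (rule genideal_adjoined[OF ysR reg(2)])
  have J': "ideal ?J' R" and J: "ideal ?J R" and JJ: "?J' \<subseteq> ?J" and yJ: "y \<in> ?J" using adj by (auto simp: adjoined_def)
  note K = snoc(3) and x = snoc(5)
  have yK: "y \<in> K" using yJ snoc(4) by blast
  \<comment> \<open>The outer hypothesis with \<open>?J'\<close> in place of \<open>K\<close> and
    \<open>y\<close> in place of \<open>x\<close>.\<close>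
  have nzy: "nzd_mod y (pw ?J' n)" for n
    by (rule nzd_mod_pw[OF J' reg(2)]) (rule snoc(1)[OF reg(1) J' subset_refl reg(2,3)])
  show ?case using snoc(7,8)
  proof (induct s arbitrary: a)
    case 0
    have "a \<in> carrier R" using 0(1) unfolding pw_0 .
    then show ?case using snoc(6) 0(2) unfolding pw_0 ideal_prod_one[OF K] by (auto simp: nzd_mod_def)
  next
    case (Suc s)
    let ?KJ = "ideal_prod R K (pw ?J s)" and ?KJ' = "ideal_prod R K (pw ?J' (Suc s))"
    interpret KJ: ideal ?KJ R by (rule ideal_prod_is_ideal[OF K ideal_power_ideal[OF J]])
    interpret KJ': ideal ?KJ' R by (rule ideal_prod_is_ideal[OF K ideal_power_ideal[OF J']])
    interpret PJ': ideal "pw ?J' (Suc s)" R by (rule ideal_power_ideal[OF J'])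
    obtain a2 a1 where a: "a2 \<in> pw ?J s" "a1 \<in> pw ?J' (Suc s)" "a = y \<otimes> a2 \<oplus> a1" using pw_adjoined[OF adj Suc(2)] by blast
    obtain c b where c: "c \<in> ?KJ" "b \<in> ?KJ'" "x \<otimes> a = y \<otimes> c \<oplus> b" using prod_pw_adjoined[OF adj K Suc(3)] by blast
    have bp: "b \<in> pw ?J' (Suc s)" using c(2) ideal_prod_inter[OF K ideal_power_ideal[OF J']] by blast
    have car: "a1 \<in> carrier R" "a2 \<in> carrier R" "b \<in> carrier R" "c \<in> carrier R"
      using a bp c(1) KJ.Icarr PJ'.Icarr ideal.Icarr[OF ideal_power_ideal[OF J]] by blast+
    \<comment> \<open>Two splittings of \<open>x a\<close> along \<open>y\<close> are compared:
      \<open>y\<close> times this difference lies in a power of \<open>?J'\<close>, modulo which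
      \<open>y\<close> can be cancelled.\<close>
    let ?d = "x \<otimes> a2 \<ominus> c"
    have d: "?d \<in> carrier R" using car x by simp
    have eq: "y \<otimes> (x \<otimes> a2) \<oplus> x \<otimes> a1 = y \<otimes> c \<oplus> b"
      using c(3) unfolding a(3) using car x reg(2) by (simp add: r_distr m_lcomm)
    have "y \<otimes> ?d = (y \<otimes> (x \<otimes> a2) \<oplus> x \<otimes> a1) \<ominus> (y \<otimes> c \<oplus> x \<otimes> a1)" using car x reg(2) by algebra
    also have "\<dots> = b \<ominus> x \<otimes> a1" unfolding eq using car x reg(2) by algebra
    finally have yd: "y \<otimes> ?d = b \<ominus> x \<otimes> a1" .
    have "b \<ominus> x \<otimes> a1 \<in> pw ?J' (Suc s)"
      unfolding a_minus_def by (intro PJ'.a_closed PJ'.a_inv_closed PJ'.I_l_closed bp a(2) x)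
    then have dJ: "?d \<in> pw ?J' (Suc s)" using nzy[of "Suc s"] d yd by (simp add: nzd_mod_def)
    \<comment> \<open>One factor from \<open>?J'\<close> is moved into \<open>K\<close>; hence
      \<open>x a2\<close> lies in \<open>?KJ\<close> and the inner hypothesis applies to
      \<open>a2\<close>.\<close>
    have "pw ?J' (Suc s) \<subseteq> ?KJ"
      unfolding pw_Suc ideal_prod_commute[OF ideal_power_ideal[OF J'] J']
      by (rule ideal_prod_mono[OF _ pw_mono[OF JJ]]) (use JJ snoc(4) in blast)
    then have "?d \<oplus> c \<in> ?KJ" using dJ c(1) by blast
    moreover have "?d \<oplus> c = x \<otimes> a2" using car x by algebra
    ultimately have "a2 \<in> ?KJ" using Suc(1)[OF a(1)] by simp
    then have 2: "y \<otimes> a2 \<in> ideal_prod R K (pw ?J (Suc s))" by (rule prod_pw_mult[OF J K yJ])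
    \<comment> \<open>As \<open>y\<close> lies in \<open>K\<close>, the product \<open>x a1\<close>
      lies in \<open>?KJ'\<close>, and the outer hypothesis applies with the same
      \<open>K\<close>.\<close>
    have "x \<otimes> a1 = b \<ominus> y \<otimes> ?d" unfolding yd using car x by algebra
    moreover have "y \<otimes> ?d \<in> ?KJ'" by (rule ideal_prod.prod[OF yK dJ])
    then have "b \<ominus> y \<otimes> ?d \<in> ?KJ'" unfolding a_minus_def[of _ b] by (intro KJ'.a_closed KJ'.a_inv_closed c(2))
    ultimately have "a1 \<in> ?KJ'"
      using snoc(1)[OF reg(1) K _ x snoc(6) a(2)] JJ snoc(4) by auto
    then have "a1 \<in> ideal_prod R K (pw ?J (Suc s))"
      using ideal_prod_mono[OF subset_refl pw_mono[OF JJ]] by blast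
    with 2 show ?case unfolding a(3) by (rule ideal_prod.sum)
  qed
qed

lemma regular_sequence_nzd_pw:
  assumes "regular_sequence R (ys @ [y])"
  shows "nzd_mod y (pw (genideal R (set ys)) s)"
proof -
  have *: "regular_sequence R ys" "y \<in> carrier R" "nzd_mod y (genideal R (set ys))"
    using assms by (auto simp: regular_sequence_snoc)
  have J: "ideal (genideal R (set ys)) R" using * by (intro genideal_ideal) (simp add: regular_sequence_def)
  show ?thesis by (rule nzd_mod_pw[OF J *(2)]) (rule regular_sequence_graded[OF *(1) J subset_refl *(2,3)])
qed

end

section \<open>A projective resolution of the quotient ring\<close>

lemma hom_lin_ext:
  fixes R (structure)
  assumes M: "module R M" and N: "module R N" and f: "f \<in> module_homs R M N"
    and h: "\<And>s. s \<in> S \<Longrightarrow> h s \<in> carrier M" and \<phi>: "\<phi> \<in> carrier (free_on R S)"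
  shows "f (lin_ext R M h \<phi>) = lin_ext R N (\<lambda>s. f (h s)) \<phi>"
proof -
  interpret module_pair R M N using M N by (simp add: module_pair_def)
  have \<phi>': "finite {s. \<phi> s \<noteq> \<zero>}" "{s. \<phi> s \<noteq> \<zero>} \<subseteq> S" "\<And>s. \<phi> s \<in> carrier R" using \<phi> by (auto simp: free_on_carrier)
  have "f (lin_ext R M h \<phi>) = finsum N (\<lambda>s. f (\<phi> s \<odot>\<^bsub>M\<^esub> h s)) {s. \<phi> s \<noteq> \<zero>}"
    unfolding lin_ext_def by (rule hom_finsum[OF f \<phi>'(1)]) (use \<phi>' h in auto)
  also have "\<dots> = lin_ext R N (\<lambda>s. f (h s)) \<phi>"
    unfolding lin_ext_def
    by (rule N.M.finsum_cong') (use \<phi>' h in \<open>auto simp: subset_iff hom_smult[OF f] hom_closed[OF f]\<close>)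
  finally show ?thesis .
qed

text \<open>The lifting property of a projective module. Preimages are demanded only for the values
  of \<open>g\<close>, since a differential is usually not surjective.\<close>

lemma (in split_module) projective_lift:
  assumes L: "module R L" and Q: "module R Q" and f: "f \<in> module_homs R L Q" and g: "g \<in> module_homs R M Q"
    and im: "\<And>p. p \<in> carrier M \<Longrightarrow> \<exists>l\<in>carrier L. f l = g p"
  shows "\<exists>h\<in>module_homs R M L. \<forall>p\<in>carrier M. f (h p) = g p"
proof -
  obtain pre where pre: "\<And>p. p \<in> carrier M \<Longrightarrow> pre p \<in> carrier L \<and> f (pre p) = g p" using im by metis
  let ?h = "\<lambda>p. lin_ext R L pre (\<sigma> p)"
  have "?h \<in> module_homs R M L"
    by (rule hom_comp[OF \<sigma>_hom module.lin_ext_hom[OF L]]) (use pre in blast)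
  moreover have "f (?h p) = g p" if p: "p \<in> carrier M" for p
  proof -
    have "f (?h p) = lin_ext R Q (\<lambda>s. f (pre s)) (\<sigma> p)"
      by (rule hom_lin_ext[OF L Q f _ \<sigma>_F[OF p]]) (use pre in blast)
    also have "\<dots> = lin_ext R Q g (\<sigma> p)"
      unfolding lin_ext_def
      by (rule abelian_monoid.finsum_cong'[OF abelian_group.axioms(1)[OF module.axioms(2)[OF Q]]])
        (use pre \<sigma>_support(2)[OF p] \<sigma>_closed[OF p] hom_closed[OF g] module.smult_closed[OF Q] in \<open>auto simp: subset_iff\<close>)
    also have "\<dots> = g (lin_ext R M (\<lambda>y. y) (\<sigma> p))"
      by (rule hom_lin_ext[OF module_axioms Q g _ \<sigma>_F[OF p], symmetric])
    also have "\<dots> = g p" by (simp add: lin_ext_\<sigma>[OF p])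
    finally show ?thesis .
  qed
  ultimately show ?thesis by (intro bexI[of _ ?h] ballI)
qed

locale resolution = cring R for R :: "('a, 'm) ring_scheme" (structure) +
  fixes I and P :: "('a, 'p) chain_complex" and \<epsilon> \<sigma>
  assumes I: "ideal I R"
    and res: "projective_resolution R (quot_module (ideal_module R (carrier R)) I) P \<epsilon>"
    and split: "split_module R (obj P k) (\<sigma> k)"
begin

abbreviation "A \<equiv> quot_module (ideal_module R (carrier R)) I"

lemma obj_neg: "k < 0 \<Longrightarrow> carrier (obj P k) = {\<zero>\<^bsub>obj P k\<^esub>}"
  and cycles_pos: "k > 0 \<Longrightarrow> cycles P k = boundaries P k"
  and \<epsilon>_hom: "\<epsilon> \<in> module_homs R (obj P 0) A" and \<epsilon>_surj: "\<epsilon> ` carrier (obj P 0) = carrier A"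
  and ker_\<epsilon>: "a_kernel (obj P 0) A \<epsilon> = boundaries P 0"
  using res by (auto simp: projective_resolution_def)

lemma module_P: "module R (obj P k)"
  by (rule split_module.axioms(1)[OF split])

sublocale complex R P
proof (rule complex.intro)
  show "module R (obj P k)" for k by (rule module_P)
  show hom: "bd P k \<in> module_homs R (obj P k) (obj P (k - 1))" for k
    using res unfolding projective_resolution_def by blast
  show "bd P (k - 1) (bd P k x) = \<zero>\<^bsub>obj P (k - 1 - 1)\<^esub>" if x: "x \<in> carrier (obj P k)" for k x
  proof (cases "k - 1 > 0")
    case True
    have "bd P k x \<in> boundaries P (k - 1)" using x by (auto simp: boundaries_def)
    then show ?thesis using cycles_pos[OF True] by (auto simp: cycles_def a_kernel_def')
  next
    case False
    then show ?thesis using obj_neg[of "k - 1 - 1"] hom_closed[OF hom hom_closed[OF hom x]] by simp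
  qed
qed

interpretation N: module R "ideal_module R (carrier R)"
  by (rule module_ideal_module[OF is_cring oneideal])

lemma subquotient_A: "subquotient R (ideal_module R (carrier R)) (carrier R) I"
proof -
  interpret I: ideal I R by (rule I)
  have "submodule I R (ideal_module R (carrier R))"
  proof (rule N.module_incl_imp_submodule)
    show "module R (ideal_module R (carrier R)\<lparr>carrier := I\<rparr>)"
      using module_ideal_module[OF is_cring I] by (simp add: ideal_module_def)
  qed (use I.Icarr in auto)
  then show ?thesis
    using N.carrier_is_submodule I.Icarr
    by (intro subquotient.intro subquotient_axioms.intro) (auto intro: N.module_axioms)
qed

lemma A_eq: "A = subquot (ideal_module R (carrier R)) (carrier R) I"
  using quot_module_eq_subquot[of "ideal_module R (carrier R)" I] by simp

interpretation A: subquotient R "ideal_module R (carrier R)" "carrier R" I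
  by (rule subquotient_A)

lemma A_killed:
  assumes "x \<in> I" "y \<in> carrier A" shows "x \<odot>\<^bsub>A\<^esub> y = \<zero>\<^bsub>A\<^esub>"
proof -
  interpret I: ideal I R by (rule I)
  obtain r where r: "r \<in> carrier R" "y = I +>\<^bsub>ideal_module R (carrier R)\<^esub> r" using assms(2) by (auto simp: A_eq A.subquot_carrier)
  have "x \<in> carrier R" "x \<otimes> r \<in> I" using assms(1) r I.Icarr I.I_r_closed by auto
  then show ?thesis using r A.subquot_smult[of x r] A.subquot_eq_zero_iff[of "x \<otimes> r"] by (simp add: A_eq A.subquot_zero)
qed

text \<open>Multiplication by \<open>x\<close> is zero on \<open>R/I\<close>, hence null homotopic
  on \<open>P\<close>. Only the two components around a given degree are asserted, as each later
  argument involves no others. The last two conditions are the homotopy identity on cycles; they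
  also carry the induction on \<open>k\<close>.\<close>

lemma homotopy_exists:
  assumes x: "x \<in> I"
  shows "\<exists>h\<in>module_homs R (obj P k) (obj P (k + 1)). \<exists>h'\<in>module_homs R (obj P (k - 1)) (obj P k).
    (\<forall>p\<in>carrier (obj P k). bd P (k + 1) (h p) \<oplus>\<^bsub>obj P k\<^esub> h' (bd P k p) = x \<odot>\<^bsub>obj P k\<^esub> p) \<and>
    (\<forall>w\<in>cycles P k. bd P (k + 1) (h w) = x \<odot>\<^bsub>obj P k\<^esub> w) \<and>
    (\<forall>w\<in>cycles P (k - 1). bd P k (h' w) = x \<odot>\<^bsub>obj P (k - 1)\<^esub> w)"
proof -
  have xR: "x \<in> carrier R" using x ideal.Icarr[OF I] by blast
  \<comment> \<open>By the condition on \<open>h'\<close>, the map sending \<open>p\<close> to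
    \<open>x p - h' (bd p)\<close> has values in the cycles. These values are boundaries, so it
    lifts along the differential.\<close>
  have lift_step: "\<exists>h\<in>module_homs R (obj P k) (obj P (k + 1)).
    (\<forall>p\<in>carrier (obj P k). bd P (k + 1) (h p) \<oplus>\<^bsub>obj P k\<^esub> h' (bd P k p) = x \<odot>\<^bsub>obj P k\<^esub> p) \<and>
    (\<forall>w\<in>cycles P k. bd P (k + 1) (h w) = x \<odot>\<^bsub>obj P k\<^esub> w)"
    if h': "h' \<in> module_homs R (obj P (k - 1)) (obj P k)" and bh': "\<forall>w\<in>cycles P (k - 1). bd P k (h' w) = x \<odot>\<^bsub>obj P (k - 1)\<^esub> w"
      and k: "k \<ge> 0" for k h'
  proof -
    interpret S: split_module R "obj P k" "\<sigma> k" by (rule split)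
    interpret P': module R "obj P (k - 1)" by (rule module_P)
    let ?g = "\<lambda>p. x \<odot>\<^bsub>obj P k\<^esub> p \<ominus>\<^bsub>obj P k\<^esub> h' (bd P k p)"
    have hb: "(\<lambda>p. h' (bd P k p)) \<in> module_homs R (obj P k) (obj P k)" by (rule hom_comp[OF bd_hom h'])
    have g: "?g \<in> module_homs R (obj P k) (obj P k)"
    proof (rule module_homsI)
      fix p p' assume p: "p \<in> carrier (obj P k)" "p' \<in> carrier (obj P k)"
      note c = hom_closed[OF hb p(1)] hom_closed[OF hb p(2)]
      show "x \<odot>\<^bsub>obj P k\<^esub> (p \<oplus>\<^bsub>obj P k\<^esub> p') \<ominus>\<^bsub>obj P k\<^esub> h' (bd P k (p \<oplus>\<^bsub>obj P k\<^esub> p')) = ?g p \<oplus>\<^bsub>obj P k\<^esub> ?g p'"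
        unfolding hom_add[OF hb p] using p c xR by algebra
    next
      fix a p assume a: "a \<in> carrier R" and p: "p \<in> carrier (obj P k)"
      note c = hom_closed[OF hb p]
      show "x \<odot>\<^bsub>obj P k\<^esub> (a \<odot>\<^bsub>obj P k\<^esub> p) \<ominus>\<^bsub>obj P k\<^esub> h' (bd P k (a \<odot>\<^bsub>obj P k\<^esub> p)) = a \<odot>\<^bsub>obj P k\<^esub> ?g p"
        unfolding hom_smult[OF hb a p] using p c xR a by algebra
    qed (use hom_closed[OF hb] xR in auto)
    have cyc: "?g p \<in> cycles P k" if p: "p \<in> carrier (obj P k)" for p
    proof -
      have w: "bd P k p \<in> cycles P (k - 1)" using bd_bd[OF p] bd_closed[OF p] by (simp add: cycles_iff)
      have "bd P k (?g p) = bd P k (x \<odot>\<^bsub>obj P k\<^esub> p) \<ominus>\<^bsub>obj P (k - 1)\<^esub> bd P k (h' (bd P k p))"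
        by (rule bd_minus) (use p xR hom_closed[OF hb p] in auto)
      also have "\<dots> = \<zero>\<^bsub>obj P (k - 1)\<^esub>"
        using bh' w bd_smult[OF xR p] bd_closed[OF p] xR by (simp add: P'.minus_eq_zero_iff)
      finally show ?thesis using hom_closed[OF g p] by (simp add: cycles_iff)
    qed
    have bnd: "?g p \<in> boundaries P k" if p: "p \<in> carrier (obj P k)" for p
    proof (cases "k > 0")
      case True
      then show ?thesis using cyc[OF p] cycles_pos by simp
    next
      \<comment> \<open>In degree 0 the boundaries are the kernel of \<open>\<epsilon>\<close>,
        which contains \<open>x p\<close> because \<open>x\<close> kills \<open>R/I\<close>.\<close>
      case False
      then have [simp]: "k = 0" using k by simp
      have "bd P 0 p = \<zero>\<^bsub>obj P (0 - 1)\<^esub>" using obj_neg[of "0 - 1"] bd_closed[OF p] by simp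
      then have "h' (bd P k p) = \<zero>\<^bsub>obj P k\<^esub>" using module_pair.hom_zero[OF bd_pair h'] by simp
      moreover have "x \<odot>\<^bsub>obj P k\<^esub> p \<ominus>\<^bsub>obj P k\<^esub> \<zero>\<^bsub>obj P k\<^esub> = x \<odot>\<^bsub>obj P k\<^esub> p" using p xR by algebra
      ultimately have "?g p = x \<odot>\<^bsub>obj P k\<^esub> p" by simp
      moreover have "\<epsilon> (x \<odot>\<^bsub>obj P 0\<^esub> p) = \<zero>\<^bsub>A\<^esub>"
        using A_killed[OF x] hom_closed[OF \<epsilon>_hom] hom_smult[OF \<epsilon>_hom xR] p by simp
      ultimately have "?g p \<in> a_kernel (obj P 0) A \<epsilon>" using hom_closed[OF g p] by (simp add: a_kernel_def')
      then show ?thesis unfolding ker_\<epsilon> by simp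
    qed
    have "bd P (k + 1) \<in> module_homs R (obj P (k + 1)) (obj P k)" using bd_hom[of "k + 1"] by simp
    from S.projective_lift[OF module_P module_P this g]
    obtain h where h: "h \<in> module_homs R (obj P k) (obj P (k + 1))" "\<And>p. p \<in> carrier (obj P k) \<Longrightarrow> bd P (k + 1) (h p) = ?g p"
      using bnd unfolding boundaries_iff by metis
    have "bd P (k + 1) (h p) \<oplus>\<^bsub>obj P k\<^esub> h' (bd P k p) = x \<odot>\<^bsub>obj P k\<^esub> p" if p: "p \<in> carrier (obj P k)" for p
      unfolding h(2)[OF p] using p xR hom_closed[OF hb p] by algebra
    moreover have "bd P (k + 1) (h w) = x \<odot>\<^bsub>obj P k\<^esub> w" if "w \<in> cycles P k" for w
    proof -
      have w: "w \<in> carrier (obj P k)" "bd P k w = \<zero>\<^bsub>obj P (k - 1)\<^esub>" using that by (auto simp: cycles_iff)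
      have "x \<odot>\<^bsub>obj P k\<^esub> w \<ominus>\<^bsub>obj P k\<^esub> \<zero>\<^bsub>obj P k\<^esub> = x \<odot>\<^bsub>obj P k\<^esub> w" using w(1) xR by algebra
      then show ?thesis using h(2)[OF w(1)] w(2) module_pair.hom_zero[OF bd_pair h'] by simp
    qed
    ultimately show ?thesis using h(1) by (intro bexI[of _ h] conjI ballI)
  qed
  \<comment> \<open>\<open>P\<close> vanishes in negative degrees, so zero maps serve as homotopies
    there and start the induction.\<close>
  have neg: "bd P k (\<zero>\<^bsub>obj P k\<^esub>) = x \<odot>\<^bsub>obj P (k - 1)\<^esub> w" if "k \<le> 0" "w \<in> cycles P (k - 1)" for k w
  proof -
    interpret P': module R "obj P (k - 1)" by (rule module_P)
    show ?thesis using that obj_neg[of "k - 1"] xR by (simp add: cycles_iff bd_zero)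
  qed
  show ?thesis
  proof (cases "k \<ge> 0")
    case True
    then show ?thesis
    proof (induct k rule: int_ge_induct)
      case base
      have z: "\<forall>w\<in>cycles P (0 - 1). bd P 0 \<zero>\<^bsub>obj P 0\<^esub> = x \<odot>\<^bsub>obj P (0 - 1)\<^esub> w" using neg[of 0] by auto
      obtain h where "h \<in> module_homs R (obj P 0) (obj P (0 + 1))"
        "\<forall>p\<in>carrier (obj P 0). bd P (0 + 1) (h p) \<oplus>\<^bsub>obj P 0\<^esub> \<zero>\<^bsub>obj P 0\<^esub> = x \<odot>\<^bsub>obj P 0\<^esub> p"
        "\<forall>w\<in>cycles P 0. bd P (0 + 1) (h w) = x \<odot>\<^bsub>obj P 0\<^esub> w"
        using lift_step[OF zero_hom[OF module_P] z] by auto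
      then show ?case using z zero_hom[OF module_P] by (intro bexI[of _ h] bexI[of _ "\<lambda>_. \<zero>\<^bsub>obj P 0\<^esub>"] conjI)
    next
      case (step i)
      then obtain h' where h': "h' \<in> module_homs R (obj P i) (obj P (i + 1))" "\<forall>w\<in>cycles P i. bd P (i + 1) (h' w) = x \<odot>\<^bsub>obj P i\<^esub> w"
        by blast
      have e: "i + 1 - 1 = i" by simp
      have "i + 1 \<ge> 0" using \<open>0 \<le> i\<close> by simp
      note st = lift_step[of h' "i + 1", unfolded e, OF h' this]
      then show ?case unfolding e using h' by blast
    qed
  next
    case False
    have z: "x \<odot>\<^bsub>obj P l\<^esub> \<zero>\<^bsub>obj P l\<^esub> = \<zero>\<^bsub>obj P l\<^esub>" "\<zero>\<^bsub>obj P l\<^esub> \<oplus>\<^bsub>obj P l\<^esub> \<zero>\<^bsub>obj P l\<^esub> = \<zero>\<^bsub>obj P l\<^esub>" for l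
    proof -
      interpret L: module R "obj P l" by (rule module_P)
      show "x \<odot>\<^bsub>obj P l\<^esub> \<zero>\<^bsub>obj P l\<^esub> = \<zero>\<^bsub>obj P l\<^esub>" "\<zero>\<^bsub>obj P l\<^esub> \<oplus>\<^bsub>obj P l\<^esub> \<zero>\<^bsub>obj P l\<^esub> = \<zero>\<^bsub>obj P l\<^esub>" using xR by auto
    qed
    show ?thesis
      by (intro bexI[OF _ zero_hom[OF module_P]] conjI ballI)
        (use False neg[of k] neg[of "k + 1"] obj_neg[of k] z bd_zero[of "k + 1"] in \<open>auto simp: cycles_iff\<close>)
  qed
qed

end

text \<open>The last hypothesis says that \<open>H\<close> pulls back to \<open>D\<close> within
  \<open>Z\<close>, so \<open>f\<close> induces an isomorphism from \<open>Z/D\<close> onto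
  \<open>(f Z + H)/H\<close>.\<close>

lemma qfilt_image_sum:
  assumes NM: "module_pair R N M" and filt: "qfilt R I N D Z" and f: "f \<in> module_homs R N M"
    and H: "submodule H R M" and iff: "\<And>z. z \<in> Z \<Longrightarrow> f z \<in> H \<longleftrightarrow> z \<in> D"
  shows "qfilt R I M H {y \<oplus>\<^bsub>M\<^esub> h | y h. y \<in> f ` Z \<and> h \<in> H}"
proof -
  interpret module_pair R N M by fact
  have Z: "submodule Z R N" and DZ: "D \<subseteq> Z" using qfilt_submodule[OF filt] by auto
  note Zc = M.submodule_carrier[OF Z] and Hc = N.submodule_carrier[OF H] and hc = N.submodule_closed[OF H]
  let ?Z' = "{y \<oplus>\<^bsub>M\<^esub> h | y h. y \<in> f ` Z \<and> h \<in> H}"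
  let ?\<rho> = "\<lambda>z y. z \<in> Z \<and> (\<exists>h\<in>H. y = f z \<oplus>\<^bsub>M\<^esub> h)"
  have fc: "f z \<in> carrier M" if "z \<in> Z" for z using hom_closed[OF f Zc[OF that]] .
  show ?thesis
  proof (rule qfilt_transport[OF M.module_axioms N.module_axioms filt H, where \<rho> = ?\<rho>])
    show "H \<subseteq> ?Z'"
    proof
      fix h assume "h \<in> H"
      then have "h = f \<zero>\<^bsub>N\<^esub> \<oplus>\<^bsub>M\<^esub> h" using hom_zero[OF f] Hc by simp
      then show "h \<in> ?Z'" using M.submodule_zero[OF Z] \<open>h \<in> H\<close> by blast
    qed
    show "?Z' \<subseteq> carrier M" using fc Hc by auto
    show "x \<in> Z \<and> y \<in> ?Z'" if "?\<rho> x y" for x y using that by blast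
    show "?\<rho> (x \<oplus>\<^bsub>N\<^esub> x') (y \<oplus>\<^bsub>M\<^esub> y')" if r: "?\<rho> x y" "?\<rho> x' y'" for x y x' y'
    proof -
      obtain h h' where h: "h \<in> H" "y = f x \<oplus>\<^bsub>M\<^esub> h" "h' \<in> H" "y' = f x' \<oplus>\<^bsub>M\<^esub> h'" using r by blast
      have xx: "x \<in> Z" "x' \<in> Z" using r by auto
      have "y \<oplus>\<^bsub>M\<^esub> y' = f (x \<oplus>\<^bsub>N\<^esub> x') \<oplus>\<^bsub>M\<^esub> (h \<oplus>\<^bsub>M\<^esub> h')"
        unfolding h(2,4) hom_add[OF f Zc[OF xx(1)] Zc[OF xx(2)]]
        using fc[OF xx(1)] fc[OF xx(2)] Hc[OF h(1)] Hc[OF h(3)] by algebra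
      then show ?thesis using M.submodule_closed(5)[OF Z xx] hc(5)[OF h(1,3)] by blast
    qed
    show "?\<rho> (a \<odot>\<^bsub>N\<^esub> x) (a \<odot>\<^bsub>M\<^esub> y)" if a: "a \<in> carrier R" and r: "?\<rho> x y" for a x y
    proof -
      obtain h where h: "h \<in> H" "y = f x \<oplus>\<^bsub>M\<^esub> h" using r by blast
      have xx: "x \<in> Z" using r by auto
      have "a \<odot>\<^bsub>M\<^esub> y = f (a \<odot>\<^bsub>N\<^esub> x) \<oplus>\<^bsub>M\<^esub> a \<odot>\<^bsub>M\<^esub> h"
        unfolding h(2) hom_smult[OF f a Zc[OF xx]] using fc[OF xx] Hc[OF h(1)] a by (simp add: N.smult_r_distr)
      then show ?thesis using M.submodule_closed(4)[OF Z a xx] hc(4)[OF a h(1)] by blast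
    qed
    show "\<exists>y. ?\<rho> x y" if "x \<in> Z" for x using that N.submodule_zero[OF H] by blast
    show "\<exists>x. ?\<rho> x y" if "y \<in> ?Z'" for y using that by blast
    show "x \<in> D \<longleftrightarrow> y \<in> H" if r: "?\<rho> x y" for x y
    proof -
      obtain h where h: "h \<in> H" "y = f x \<oplus>\<^bsub>M\<^esub> h" using r by blast
      have xx: "x \<in> Z" using r by auto
      have "f x = y \<ominus>\<^bsub>M\<^esub> h" unfolding h(2) using fc[OF xx] Hc[OF h(1)] by algebra
      then have "f x \<in> H" if "y \<in> H" using hc(2)[OF that h(1)] by simp
      moreover have "y \<in> H" if "f x \<in> H" unfolding h(2) by (rule hc(5)[OF that h(1)])
      ultimately have "f x \<in> H \<longleftrightarrow> y \<in> H" by blast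
      then show ?thesis using iff[OF xx] by simp
    qed
  qed
qed

declare nat_pow_Suc [simp del]

section \<open>The subcomplexes \<open>K P\<close> with their cycles and boundaries\<close>

context resolution
begin

abbreviation "sc K k \<equiv> split_module.scaled (obj P k) (\<sigma> k) K"

text \<open>Kept inside \<open>P\<close>, so that different ideals \<open>K\<close> can be compared
  by inclusion. \<open>sbounds\<close> takes the image of \<open>K P\<close> only: a cycle of
  \<open>K P\<close> that bounds in \<open>P\<close> may fail to lie in it, and this is what Tor
  detects.\<close>

definition scycles :: "'a set \<Rightarrow> int \<Rightarrow> 'p set"
  where "scycles K k = cycles P k \<inter> sc K k"

definition sbounds :: "'a set \<Rightarrow> int \<Rightarrow> 'p set"
  where "sbounds K k = bd P (k + 1) ` sc K (k + 1)"

lemmas sc_carrier = split_module.scaled_carrier[OF split]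
lemmas sc_submodule = split_module.scaled_submodule[OF split]
lemmas sc_closed = module.submodule_closed[OF module_P sc_submodule]
lemmas sc_hom = scaled_hom[OF split split]

lemma sc_bd: "ideal K R \<Longrightarrow> p \<in> sc K k \<Longrightarrow> bd P k p \<in> sc K (k - 1)"
  by (rule sc_hom[OF bd_hom])

lemma scycles_iff: "z \<in> scycles K k \<longleftrightarrow> z \<in> sc K k \<and> bd P k z = \<zero>\<^bsub>obj P (k - 1)\<^esub>"
  using sc_carrier by (auto simp: scycles_def cycles_iff)

lemma sboundsI: "t \<in> sc K (k + 1) \<Longrightarrow> z = bd P (k + 1) t \<Longrightarrow> z \<in> sbounds K k"
  by (simp add: sbounds_def)

lemma scycles_submodule: "ideal K R \<Longrightarrow> submodule (scycles K k) R (obj P k)"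
  unfolding scycles_def by (intro module.submodule_Int[OF module_P] cycles_submodule sc_submodule)

lemma sbounds_submodule: "ideal K R \<Longrightarrow> submodule (sbounds K k) R (obj P k)"
  unfolding sbounds_def
  using module_pair.hom_image_submodule[OF bd_pair bd_hom sc_submodule, of K "k + 1"] by simp

lemma sbounds_subset: "ideal K R \<Longrightarrow> sbounds K k \<subseteq> scycles K k"
  using sc_bd[of K _ "k + 1"] bd_bd[OF sc_carrier, of _ "k + 1" K] by (auto simp: sbounds_def scycles_iff)

lemma sbounds_mono: "K \<subseteq> K' \<Longrightarrow> sbounds K k \<subseteq> sbounds K' k"
  unfolding sbounds_def by (intro image_mono split_module.scaled_mono[OF split])

lemma sc_mono: "K \<subseteq> K' \<Longrightarrow> sc K k \<subseteq> sc K' k"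
  by (rule split_module.scaled_mono[OF split])

text \<open>The homotopy is linear and so preserves \<open>K P\<close>; thus \<open>x\<close> is
  null homotopic on each subcomplex.\<close>

lemma scycles_killed:
  assumes K: "ideal K R" and x: "x \<in> I" and z: "z \<in> scycles K k"
  shows "x \<odot>\<^bsub>obj P k\<^esub> z \<in> sbounds K k"
proof -
  obtain h where h: "h \<in> module_homs R (obj P k) (obj P (k + 1))" "\<forall>w\<in>cycles P k. bd P (k + 1) (h w) = x \<odot>\<^bsub>obj P k\<^esub> w"
    using homotopy_exists[OF x, of k] by blast
  show ?thesis using z h(2) sc_hom[OF h(1) K] by (intro sboundsI[of "h z"]) (auto simp: scycles_def)
qed

lemma scycles_zero: "scycles {\<zero>} k = {\<zero>\<^bsub>obj P k\<^esub>}" and sbounds_zero: "sbounds {\<zero>} k = {\<zero>\<^bsub>obj P k\<^esub>}"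
  using split_module.scaled_zero[OF split] bd_zero[of k] bd_zero[of "k + 1"]
  by (auto simp: scycles_iff sbounds_def)

end

section \<open>Adjoining one element of the sequence\<close>

locale resolution_step = resolution +
  fixes J x I' s
  assumes adj: "adjoined J x I'" and x: "x \<in> I" and nzd: "nzd_mod x (pw J (Suc s))"
    and zeroJ: "\<And>k. scycles (pw J (Suc s)) k \<subseteq> sbounds (pw J s) k"
begin

text \<open>\<open>KE = x KA + KB\<close>, and \<open>x\<close> is injective modulo
  \<open>KB\<close>. The arguments of this step write elements of \<open>KE P\<close> as
  \<open>x u + v\<close> and control \<open>u\<close> modulo \<open>KB P\<close>. The ideal
  \<open>I\<close> resolved by \<open>P\<close> stays fixed; membership of \<open>x\<close> in it
  supplies the homotopy.\<close>

abbreviation "KA \<equiv> pw I' s"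
abbreviation "KB \<equiv> pw J (Suc s)"
abbreviation "KE \<equiv> pw I' (Suc s)"

lemma xR: "x \<in> carrier R" using x ideal.Icarr[OF I] by blast

lemma ideals: "ideal KA R" "ideal KB R" "ideal KE R" "ideal (pw J s) R"
  using adj ideal_power_ideal by (auto simp: adjoined_def)

lemma KB_subset: "KB \<subseteq> KE" "KB \<subseteq> KA" "pw J s \<subseteq> KA" "KE \<subseteq> KA"
proof -
  have JI: "J \<subseteq> I'" and J: "ideal J R" and I': "ideal I' R" using adj by (auto simp: adjoined_def)
  show "KB \<subseteq> KE" "pw J s \<subseteq> KA" by (rule pw_mono[OF JI])+
  then show "KB \<subseteq> KA" using ideal_power_Suc_subset[OF J, of s] by blast
  show "KE \<subseteq> KA" by (rule ideal_power_Suc_subset[OF I'])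
qed

lemma sc_KE:
  assumes "p \<in> sc KE k"
  obtains u v where "u \<in> sc KA k" "v \<in> sc KB k" "p = x \<odot>\<^bsub>obj P k\<^esub> u \<oplus>\<^bsub>obj P k\<^esub> v"
  using split_module.scaled_decompose[OF split assms xR ideals(1,2) pw_adjoined[OF adj]] by blast

lemma sc_cancel: "p \<in> carrier (obj P k) \<Longrightarrow> x \<odot>\<^bsub>obj P k\<^esub> p \<in> sc KB k \<Longrightarrow> p \<in> sc KB k"
  by (rule split_module.scaled_cancel[OF split xR]) (use nzd in \<open>auto simp: nzd_mod_def\<close>)

lemma x_sc: "u \<in> sc KA k \<Longrightarrow> x \<odot>\<^bsub>obj P k\<^esub> u \<in> sc KE k"
proof -
  assume u: "u \<in> sc KA k"
  interpret S: split_module R "obj P k" "\<sigma> k" by (rule split)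
  have I': "ideal I' R" and xI: "x \<in> I'" using adj by (auto simp: adjoined_def)
  have "x \<otimes> \<sigma> k u q \<in> KE" for q using pw_mult[OF I' xI] u unfolding S.scaled_def by blast
  then show ?thesis using u S.\<sigma>_smult[OF xR] xR by (simp add: S.scaled_def)
qed

lemma bd_sum:
  assumes "u \<in> carrier (obj P k)" "v \<in> carrier (obj P k)"
  shows "bd P k (x \<odot>\<^bsub>obj P k\<^esub> u \<oplus>\<^bsub>obj P k\<^esub> v) = x \<odot>\<^bsub>obj P (k - 1)\<^esub> bd P k u \<oplus>\<^bsub>obj P (k - 1)\<^esub> bd P k v"
proof -
  interpret M: module R "obj P k" by (rule module_P)
  show ?thesis using assms xR by (simp add: bd_add bd_smult)
qed

lemma cancel_sum:
  assumes u: "u \<in> carrier (obj P k)" and v: "v \<in> sc KB k"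
    and uv: "x \<odot>\<^bsub>obj P k\<^esub> u \<oplus>\<^bsub>obj P k\<^esub> v \<in> sc KB k"
  shows "u \<in> sc KB k"
proof (rule sc_cancel[OF u])
  interpret M: module R "obj P k" by (rule module_P)
  have "x \<odot>\<^bsub>obj P k\<^esub> u = (x \<odot>\<^bsub>obj P k\<^esub> u \<oplus>\<^bsub>obj P k\<^esub> v) \<ominus>\<^bsub>obj P k\<^esub> v"
    using u sc_carrier[OF v] xR by algebra
  then show "x \<odot>\<^bsub>obj P k\<^esub> u \<in> sc KB k" using sc_closed(2)[OF ideals(2) uv v] by simp
qed

text \<open>Modulo \<open>KB P\<close> the boundary is \<open>x\<close> times that of
  \<open>u\<close>, and \<open>x\<close> can be cancelled there. The resulting cycle represents the
  class in \<open>Tor\<^sub>k\<^sub>-\<^sub>1(J\<^sup>s\<^sup>+\<^sup>1)\<close> attached to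
  \<open>x u + v\<close>.\<close>

lemma bd_cancel:
  assumes u: "u \<in> sc KA k" and v: "v \<in> sc KB k"
    and uv: "bd P k (x \<odot>\<^bsub>obj P k\<^esub> u \<oplus>\<^bsub>obj P k\<^esub> v) \<in> sc KB (k - 1)"
  shows "bd P k u \<in> scycles KB (k - 1)"
proof -
  have "bd P k u \<in> sc KB (k - 1)"
    by (rule cancel_sum[OF bd_closed[OF sc_carrier[OF u]] sc_bd[OF ideals(2) v]])
      (use uv bd_sum[OF sc_carrier[OF u] sc_carrier[OF v]] in simp)
  then show ?thesis using bd_bd[OF sc_carrier[OF u]] by (simp add: scycles_iff)
qed

text \<open>
  Write \<open>z = x u + v\<close>. Then the boundary \<open>w\<close> of \<open>u\<close> lies in \<open>J\<^sup>s\<^sup>+\<^sup>1 P\<close>, and a null homotopy \<open>h\<close> of \<open>x\<close> shows that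
  \<open>z\<close> differs by the boundary of \<open>h u\<close> from \<open>h w + v\<close>, which is a cycle in \<open>J\<^sup>s\<^sup>+\<^sup>1 P\<close>.
\<close>

lemma zero_step:
  assumes z: "z \<in> scycles KE k"
  shows "z \<in> sbounds KA k"
proof -
  interpret M: module R "obj P k" by (rule module_P)
  interpret M': module R "obj P (k - 1)" by (rule module_P)
  interpret M1: module R "obj P (k + 1)" by (rule module_P)
  have "z \<in> sc KE k" using z by (simp add: scycles_iff)
  then obtain u v where uv: "u \<in> sc KA k" "v \<in> sc KB k" "z = x \<odot>\<^bsub>obj P k\<^esub> u \<oplus>\<^bsub>obj P k\<^esub> v"
    by (rule sc_KE)
  note c = sc_carrier[OF uv(1)] sc_carrier[OF uv(2)]
  let ?w = "bd P k u"
  have bz: "bd P k z = \<zero>\<^bsub>obj P (k - 1)\<^esub>" using z by (simp add: scycles_iff)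
  have w: "?w \<in> scycles KB (k - 1)"
    by (rule bd_cancel[OF uv(1,2)]) (use bz uv(3) sc_closed(1)[OF ideals(2)] in simp)
  obtain h h' where h: "h \<in> module_homs R (obj P k) (obj P (k + 1))" and h': "h' \<in> module_homs R (obj P (k - 1)) (obj P k)"
    and e: "\<And>p. p \<in> carrier (obj P k) \<Longrightarrow> bd P (k + 1) (h p) \<oplus>\<^bsub>obj P k\<^esub> h' (bd P k p) = x \<odot>\<^bsub>obj P k\<^esub> p"
    and e': "\<And>w. w \<in> cycles P (k - 1) \<Longrightarrow> bd P k (h' w) = x \<odot>\<^bsub>obj P (k - 1)\<^esub> w"
    using homotopy_exists[OF x, of k] by blast
  let ?v = "h' ?w \<oplus>\<^bsub>obj P k\<^esub> v"
  have hw: "h' ?w \<in> sc KB k" using sc_hom[OF h' ideals(2)] w by (simp add: scycles_iff)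
  \<comment> \<open>On the cycle \<open>w\<close> the homotopy identity reads
    \<open>bd (h' w) = x w\<close>, which is also the boundary of \<open>x u\<close>.\<close>
  have "bd P k ?v = bd P k z"
    unfolding uv(3) bd_sum[OF c] using bd_add[OF sc_carrier[OF hw] c(2)] e' w by (simp add: scycles_def)
  then have "?v \<in> scycles KB k" using sc_closed(5)[OF ideals(2) hw uv(2)] bz by (simp add: scycles_iff)
  then obtain t where t: "t \<in> sc (pw J s) (k + 1)" "?v = bd P (k + 1) t" using zeroJ unfolding sbounds_def by blast
  have tA: "t \<in> sc KA (k + 1)" using t(1) sc_mono[OF KB_subset(3)] by blast
  have hu: "h u \<in> sc KA (k + 1)" by (rule sc_hom[OF h ideals(1) uv(1)])
  have bhu: "bd P (k + 1) (h u) \<in> carrier (obj P k)" using bd_closed[OF sc_carrier[OF hu]] by simp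
  have "z = (bd P (k + 1) (h u) \<oplus>\<^bsub>obj P k\<^esub> h' ?w) \<oplus>\<^bsub>obj P k\<^esub> v" unfolding uv(3) e[OF c(1)] ..
  also have "\<dots> = bd P (k + 1) (h u) \<oplus>\<^bsub>obj P k\<^esub> ?v" using bhu sc_carrier[OF hw] c(2) by (simp add: M.M.a_assoc)
  also have "\<dots> = bd P (k + 1) (h u \<oplus>\<^bsub>obj P (k + 1)\<^esub> t)"
    unfolding t(2) using bd_add[OF sc_carrier[OF hu] sc_carrier[OF tA]] by simp
  finally show ?thesis by (rule sboundsI[OF sc_closed(5)[OF ideals(1) hu tA]])
qed

text \<open>Injectivity of the map on Tor from \<open>KB\<close> to \<open>KE\<close>. If
  \<open>v\<close> is the boundary of \<open>x u + v'\<close>, the homotopy writes \<open>x\<close>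
  times the boundary of \<open>u\<close> as the boundary of an element of \<open>KB P\<close>, which
  can replace \<open>x u\<close>.\<close>

lemma bounds_KB:
  assumes v: "v \<in> scycles KB k" and vE: "v \<in> sbounds KE k"
  shows "v \<in> sbounds KB k"
proof -
  interpret M: module R "obj P k" by (rule module_P)
  obtain t where t: "t \<in> sc KE (k + 1)" "v = bd P (k + 1) t" using vE by (auto simp: sbounds_def)
  obtain u v' where uv: "u \<in> sc KA (k + 1)" "v' \<in> sc KB (k + 1)" "t = x \<odot>\<^bsub>obj P (k + 1)\<^esub> u \<oplus>\<^bsub>obj P (k + 1)\<^esub> v'"
    using t(1) by (rule sc_KE)
  have w: "bd P (k + 1) u \<in> scycles KB k"
    using bd_cancel[OF uv(1,2)] v t(2) uv(3) by (simp add: scycles_iff)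
  obtain h where h: "h \<in> module_homs R (obj P k) (obj P (k + 1))" "\<forall>w\<in>cycles P k. bd P (k + 1) (h w) = x \<odot>\<^bsub>obj P k\<^esub> w"
    using homotopy_exists[OF x, of k] by blast
  have hw: "h (bd P (k + 1) u) \<in> sc KB (k + 1)" using sc_hom[OF h(1) ideals(2)] w by (simp add: scycles_iff)
  have "v = bd P (k + 1) (h (bd P (k + 1) u) \<oplus>\<^bsub>obj P (k + 1)\<^esub> v')"
    using t(2) uv(3) bd_sum[OF sc_carrier[OF uv(1)] sc_carrier[OF uv(2)]] bd_add[OF sc_carrier[OF hw] sc_carrier[OF uv(2)]] h(2) w
    by (simp add: scycles_def)
  then show ?thesis by (rule sboundsI[OF sc_closed(5)[OF ideals(2) hw uv(2)]])
qed

text \<open>Comparison with a splitting \<open>t = x u + v\<close> shows that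
  \<open>x (p - bd u)\<close> lies in \<open>KB P\<close>, and \<open>x\<close> cancels. It is
  stated for \<open>p\<close> that need not be a cycle, because the last quotient of the filtration
  applies it to such elements.\<close>

lemma sum_is_bound:
  assumes p: "p \<in> carrier (obj P k)" and q: "q \<in> sc KB k" and t: "t \<in> sc KE (k + 1)"
    and eq: "x \<odot>\<^bsub>obj P k\<^esub> p \<oplus>\<^bsub>obj P k\<^esub> q = bd P (k + 1) t"
  obtains u where "u \<in> sc KA (k + 1)" "p \<ominus>\<^bsub>obj P k\<^esub> bd P (k + 1) u \<in> sc KB k"
    "bd P k (p \<ominus>\<^bsub>obj P k\<^esub> bd P (k + 1) u) = bd P k p"
proof -
  interpret M: module R "obj P k" by (rule module_P)
  obtain u v where uv: "u \<in> sc KA (k + 1)" "v \<in> sc KB (k + 1)" "t = x \<odot>\<^bsub>obj P (k + 1)\<^esub> u \<oplus>\<^bsub>obj P (k + 1)\<^esub> v"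
    using t by (rule sc_KE)
  have bv: "bd P (k + 1) v \<in> sc KB k" using sc_bd[OF ideals(2) uv(2)] by simp
  have bu: "bd P (k + 1) u \<in> carrier (obj P k)" using bd_closed[OF sc_carrier[OF uv(1)]] by simp
  note c = p sc_carrier[OF q] sc_carrier[OF bv] bu
  let ?p = "p \<ominus>\<^bsub>obj P k\<^esub> bd P (k + 1) u"
  have "x \<odot>\<^bsub>obj P k\<^esub> ?p = ((x \<odot>\<^bsub>obj P k\<^esub> p \<oplus>\<^bsub>obj P k\<^esub> q) \<ominus>\<^bsub>obj P k\<^esub> q) \<ominus>\<^bsub>obj P k\<^esub> x \<odot>\<^bsub>obj P k\<^esub> bd P (k + 1) u"
    using c xR by algebra
  also have "x \<odot>\<^bsub>obj P k\<^esub> p \<oplus>\<^bsub>obj P k\<^esub> q = x \<odot>\<^bsub>obj P k\<^esub> bd P (k + 1) u \<oplus>\<^bsub>obj P k\<^esub> bd P (k + 1) v"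
    unfolding eq uv(3) using bd_sum[OF sc_carrier[OF uv(1)] sc_carrier[OF uv(2)]] by simp
  also have "(\<dots> \<ominus>\<^bsub>obj P k\<^esub> q) \<ominus>\<^bsub>obj P k\<^esub> x \<odot>\<^bsub>obj P k\<^esub> bd P (k + 1) u = bd P (k + 1) v \<ominus>\<^bsub>obj P k\<^esub> q"
    using c xR by algebra
  finally have "x \<odot>\<^bsub>obj P k\<^esub> ?p \<in> sc KB k" using sc_closed(2)[OF ideals(2) bv q] by simp
  then have "?p \<in> sc KB k" using sc_cancel[of ?p k] c by simp
  moreover have "bd P k ?p = bd P k p"
  proof -
    interpret M': module R "obj P (k - 1)" by (rule module_P)
    have "bd P k p \<ominus>\<^bsub>obj P (k - 1)\<^esub> \<zero>\<^bsub>obj P (k - 1)\<^esub> = bd P k p" using bd_closed[OF p] by algebra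
    then show ?thesis using bd_minus[OF p bu] bd_bd[OF sc_carrier[OF uv(1)]] by simp
  qed
  ultimately show thesis using uv(1) that by blast
qed

text \<open>Multiplication by \<open>x\<close> is injective from Tor of \<open>KA\<close> to Tor of
  \<open>KE\<close> modulo the image of Tor of \<open>KB\<close>. After correction by a boundary,
  \<open>u\<close> becomes a cycle of \<open>KB P\<close>; such cycles bound in
  \<open>J\<^sup>s P\<close> by \<open>zeroJ\<close>, hence in \<open>KA P\<close>.\<close>

lemma bounds_KA:
  assumes u: "u \<in> scycles KA k" and v: "v \<in> scycles KB k" and t: "t \<in> sc KE (k + 1)"
    and eq: "x \<odot>\<^bsub>obj P k\<^esub> u = v \<oplus>\<^bsub>obj P k\<^esub> bd P (k + 1) t"
  shows "u \<in> sbounds KA k"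
proof -
  interpret M: module R "obj P k" by (rule module_P)
  have uA: "u \<in> sc KA k" and vB: "v \<in> sc KB k" using u v by (auto simp: scycles_iff)
  have bt: "bd P (k + 1) t \<in> carrier (obj P k)" using bd_closed[OF sc_carrier[OF t]] by simp
  note c = sc_carrier[OF uA] sc_carrier[OF vB]
  have "x \<odot>\<^bsub>obj P k\<^esub> u \<oplus>\<^bsub>obj P k\<^esub> (\<ominus>\<^bsub>obj P k\<^esub> v) = bd P (k + 1) t" unfolding eq using c bt by algebra
  with c(1) sc_closed(3)[OF ideals(2) vB] t
  obtain u' where u': "u' \<in> sc KA (k + 1)" "u \<ominus>\<^bsub>obj P k\<^esub> bd P (k + 1) u' \<in> sc KB k"
    "bd P k (u \<ominus>\<^bsub>obj P k\<^esub> bd P (k + 1) u') = bd P k u" by (rule sum_is_bound)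
  then have "u \<ominus>\<^bsub>obj P k\<^esub> bd P (k + 1) u' \<in> scycles KB k" using u by (simp add: scycles_iff)
  then have "u \<ominus>\<^bsub>obj P k\<^esub> bd P (k + 1) u' \<in> sbounds KA k" using zeroJ sbounds_mono[OF KB_subset(3)] by blast
  moreover have "bd P (k + 1) u' \<in> sbounds KA k" by (rule sboundsI[OF u'(1) refl])
  ultimately have "(u \<ominus>\<^bsub>obj P k\<^esub> bd P (k + 1) u') \<oplus>\<^bsub>obj P k\<^esub> bd P (k + 1) u' \<in> sbounds KA k"
    by (rule M.submodule_closed(5)[OF sbounds_submodule[OF ideals(1)]])
  moreover have "bd P (k + 1) u' \<in> carrier (obj P k)" using bd_closed[OF sc_carrier[OF u'(1)]] by simp
  then have "(u \<ominus>\<^bsub>obj P k\<^esub> bd P (k + 1) u') \<oplus>\<^bsub>obj P k\<^esub> bd P (k + 1) u' = u" using c(1) by algebra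
  ultimately show ?thesis by simp
qed

text \<open>
  The filtration of \<open>Tor\<^sub>k(I'\<^sup>s\<^sup>+\<^sup>1)\<close> with quotients \<open>Tor\<^sub>k(J\<^sup>s\<^sup>+\<^sup>1)\<close>, \<open>Tor\<^sub>k(I'\<^sup>s)\<close> and \<open>Tor\<^sub>k\<^sub>-\<^sub>1(J\<^sup>s\<^sup>+\<^sup>1)\<close>.
  The last one comes from sending \<open>z = x u + v\<close> to the boundary of \<open>u\<close>.
\<close>

lemma filtration_step:
  assumes fA: "qfilt R I (obj P k) (sbounds KA k) (scycles KA k)"
    and fB: "qfilt R I (obj P k) (sbounds KB k) (scycles KB k)"
    and fB': "qfilt R I (obj P (k - 1)) (sbounds KB (k - 1)) (scycles KB (k - 1))"
  shows "qfilt R I (obj P k) (sbounds KE k) (scycles KE k)"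
proof -
  let ?o = "obj P k"
  interpret M: module R ?o by (rule module_P)
  interpret M': module R "obj P (k - 1)" by (rule module_P)
  have pair: "module_pair R ?o ?o" by (rule bd_pair)
  have mx: "(\<lambda>p. x \<odot>\<^bsub>?o\<^esub> p) \<in> module_homs R ?o ?o"
    by (rule module_homsI) (auto simp: xR M.smult_r_distr M.smult_lcomm)
  note DE = sbounds_submodule[OF ideals(3), of k] and ZE = scycles_submodule[OF ideals(3), of k]
    and ZA = scycles_submodule[OF ideals(1), of k] and ZB = scycles_submodule[OF ideals(2), of k]
  \<comment> \<open>\<open>D1\<close> holds the classes coming from \<open>KB\<close>, and
    \<open>D2\<close> adds \<open>x\<close> times the cycles of \<open>KA P\<close>. The image under
    the identity is written out to match \<open>qfilt_image_sum\<close>.\<close>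
  define D1 where "D1 = {y \<oplus>\<^bsub>?o\<^esub> h | y h. y \<in> (\<lambda>p. p) ` scycles KB k \<and> h \<in> sbounds KE k}"
  define D2 where "D2 = {y \<oplus>\<^bsub>?o\<^esub> h | y h. y \<in> (\<lambda>p. x \<odot>\<^bsub>?o\<^esub> p) ` scycles KA k \<and> h \<in> D1}"
  have f1: "qfilt R I ?o (sbounds KE k) D1"
    unfolding D1_def
    by (rule qfilt_image_sum[OF pair fB id_hom DE]) (use bounds_KB sbounds_mono[OF KB_subset(1)] in blast)
  have D1: "submodule D1 R ?o" and DE1: "sbounds KE k \<subseteq> D1" using qfilt_submodule[OF f1] by auto
  have iff2: "x \<odot>\<^bsub>?o\<^esub> u \<in> D1 \<longleftrightarrow> u \<in> sbounds KA k" if u: "u \<in> scycles KA k" for u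
  proof
    assume "x \<odot>\<^bsub>?o\<^esub> u \<in> D1"
    then obtain v t where "v \<in> scycles KB k" "t \<in> sc KE (k + 1)" "x \<odot>\<^bsub>?o\<^esub> u = v \<oplus>\<^bsub>?o\<^esub> bd P (k + 1) t"
      unfolding D1_def sbounds_def by blast
    then show "u \<in> sbounds KA k" by (rule bounds_KA[OF u])
  next
    assume "u \<in> sbounds KA k"
    then obtain t where t: "t \<in> sc KA (k + 1)" "u = bd P (k + 1) t" unfolding sbounds_def by blast
    have "x \<odot>\<^bsub>?o\<^esub> u \<in> sbounds KE k"
      by (rule sboundsI[OF x_sc[OF t(1)]]) (use bd_smult[OF xR sc_carrier[OF t(1)]] t(2) in simp)
    then show "x \<odot>\<^bsub>?o\<^esub> u \<in> D1" using DE1 by blast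
  qed
  have f2: "qfilt R I ?o D1 D2"
    unfolding D2_def by (rule qfilt_image_sum[OF pair fA mx D1 iff2])
  have D2: "submodule D2 R ?o" and D12: "D1 \<subseteq> D2" using qfilt_submodule[OF f2] by auto
  have BE: "scycles KB k \<subseteq> scycles KE k" using sc_mono[OF KB_subset(1), of k] by (auto simp: scycles_iff)
  have xA: "x \<odot>\<^bsub>?o\<^esub> u \<in> scycles KE k" if u: "u \<in> scycles KA k" for u
    using x_sc[of u k] u bd_smult[OF xR sc_carrier, of u k KA] xR by (simp add: scycles_iff)
  have D1E: "D1 \<subseteq> scycles KE k"
    unfolding D1_def using BE sbounds_subset[OF ideals(3), of k] M.submodule_closed(5)[OF ZE] by blast
  then have D2E: "D2 \<subseteq> scycles KE k"
    unfolding D2_def using xA M.submodule_closed(5)[OF ZE] by blast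
  have BD2: "v \<in> D2" if "v \<in> scycles KB k" for v
  proof -
    have "v = v \<oplus>\<^bsub>?o\<^esub> \<zero>\<^bsub>?o\<^esub>" using M.submodule_carrier[OF ZB that] by simp
    then have "v \<in> D1" unfolding D1_def using that M.submodule_zero[OF DE] by blast
    then show ?thesis using D12 by blast
  qed
  have AD2: "x \<odot>\<^bsub>?o\<^esub> u \<in> D2" if u: "u \<in> scycles KA k" for u
  proof -
    have "x \<odot>\<^bsub>?o\<^esub> u = x \<odot>\<^bsub>?o\<^esub> u \<oplus>\<^bsub>?o\<^esub> \<zero>\<^bsub>?o\<^esub>" using M.submodule_carrier[OF ZA u] xR by simp
    then show ?thesis unfolding D2_def using u M.submodule_zero[OF D1] by blast
  qed
  \<comment> \<open>The pair \<open>u\<close>, \<open>v\<close> is not determined by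
    \<open>z\<close>; the relation admits all splittings.\<close>
  let ?\<rho> = "\<lambda>w z. z \<in> scycles KE k \<and> (\<exists>u\<in>sc KA k. \<exists>v\<in>sc KB k. z = x \<odot>\<^bsub>?o\<^esub> u \<oplus>\<^bsub>?o\<^esub> v \<and> w = bd P k u)"
  have "qfilt R I ?o D2 (scycles KE k)"
  proof (rule qfilt_transport[OF module_P module_P fB' D2 D2E, where \<rho> = ?\<rho>])
    show "scycles KE k \<subseteq> carrier ?o" using M.submodule_carrier[OF ZE] by blast
    show "w \<in> scycles KB (k - 1) \<and> z \<in> scycles KE k" if r: "?\<rho> w z" for w z
    proof -
      obtain u v where uv: "u \<in> sc KA k" "v \<in> sc KB k" "z = x \<odot>\<^bsub>?o\<^esub> u \<oplus>\<^bsub>?o\<^esub> v" "w = bd P k u" using r by blast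
      have "bd P k z = \<zero>\<^bsub>obj P (k - 1)\<^esub>" using r by (simp add: scycles_iff)
      then have "bd P k u \<in> scycles KB (k - 1)"
        using bd_cancel[OF uv(1,2)] uv(3) sc_closed(1)[OF ideals(2)] by simp
      then show ?thesis using r uv(4) by simp
    qed
    show "?\<rho> (w \<oplus>\<^bsub>obj P (k - 1)\<^esub> w') (z \<oplus>\<^bsub>?o\<^esub> z')" if r: "?\<rho> w z" "?\<rho> w' z'" for w z w' z'
    proof -
      obtain u v where uv: "u \<in> sc KA k" "v \<in> sc KB k" "z = x \<odot>\<^bsub>?o\<^esub> u \<oplus>\<^bsub>?o\<^esub> v" "w = bd P k u" using r by blast
      obtain u' v' where uv': "u' \<in> sc KA k" "v' \<in> sc KB k" "z' = x \<odot>\<^bsub>?o\<^esub> u' \<oplus>\<^bsub>?o\<^esub> v'" "w' = bd P k u'" using r by blast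
      note c = sc_carrier[OF uv(1)] sc_carrier[OF uv(2)] sc_carrier[OF uv'(1)] sc_carrier[OF uv'(2)]
      have "z \<oplus>\<^bsub>?o\<^esub> z' = x \<odot>\<^bsub>?o\<^esub> (u \<oplus>\<^bsub>?o\<^esub> u') \<oplus>\<^bsub>?o\<^esub> (v \<oplus>\<^bsub>?o\<^esub> v')"
        unfolding uv(3) uv'(3) using c xR by algebra
      moreover have "w \<oplus>\<^bsub>obj P (k - 1)\<^esub> w' = bd P k (u \<oplus>\<^bsub>?o\<^esub> u')" unfolding uv(4) uv'(4) by (rule bd_add[OF c(1,3), symmetric])
      ultimately show ?thesis
        using r M.submodule_closed(5)[OF ZE] sc_closed(5)[OF ideals(1) uv(1) uv'(1)] sc_closed(5)[OF ideals(2) uv(2) uv'(2)] by blast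
    qed
    show "?\<rho> (a \<odot>\<^bsub>obj P (k - 1)\<^esub> w) (a \<odot>\<^bsub>?o\<^esub> z)" if a: "a \<in> carrier R" and r: "?\<rho> w z" for a w z
    proof -
      obtain u v where uv: "u \<in> sc KA k" "v \<in> sc KB k" "z = x \<odot>\<^bsub>?o\<^esub> u \<oplus>\<^bsub>?o\<^esub> v" "w = bd P k u" using r by blast
      note c = sc_carrier[OF uv(1)] sc_carrier[OF uv(2)]
      have "a \<odot>\<^bsub>?o\<^esub> z = x \<odot>\<^bsub>?o\<^esub> (a \<odot>\<^bsub>?o\<^esub> u) \<oplus>\<^bsub>?o\<^esub> a \<odot>\<^bsub>?o\<^esub> v" unfolding uv(3) using c xR a by algebra
      moreover have "a \<odot>\<^bsub>obj P (k - 1)\<^esub> w = bd P k (a \<odot>\<^bsub>?o\<^esub> u)" unfolding uv(4) by (rule bd_smult[OF a c(1), symmetric])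
      ultimately show ?thesis
        using r M.submodule_closed(4)[OF ZE a] sc_closed(4)[OF ideals(1) a uv(1)] sc_closed(4)[OF ideals(2) a uv(2)] by blast
    qed
    show "\<exists>w. ?\<rho> w z" if z: "z \<in> scycles KE k" for z
    proof -
      have "z \<in> sc KE k" using z by (simp add: scycles_iff)
      then obtain u v where "u \<in> sc KA k" "v \<in> sc KB k" "z = x \<odot>\<^bsub>?o\<^esub> u \<oplus>\<^bsub>?o\<^esub> v" by (rule sc_KE)
      then show ?thesis using z by blast
    qed
    show "\<exists>z. ?\<rho> w z" if w: "w \<in> scycles KB (k - 1)" for w
    proof -
      \<comment> \<open>By \<open>zeroJ\<close> the cycle \<open>w\<close> is the boundary of some
        \<open>u\<close>; subtracting \<open>h' w\<close>, whose boundary is \<open>x w\<close>,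
        turns \<open>x u\<close> into a cycle.\<close>
      obtain u where u: "u \<in> sc (pw J s) k" "w = bd P k u" using zeroJ[of "k - 1"] w by (auto simp: sbounds_def)
      have uA: "u \<in> sc KA k" using u(1) sc_mono[OF KB_subset(3)] by blast
      obtain h' where h': "h' \<in> module_homs R (obj P (k - 1)) (obj P k)"
        "\<forall>w\<in>cycles P (k - 1). bd P k (h' w) = x \<odot>\<^bsub>obj P (k - 1)\<^esub> w"
        using homotopy_exists[OF x, of k] by blast
      let ?v = "\<ominus>\<^bsub>?o\<^esub> h' w"
      have hw: "h' w \<in> sc KB k" using sc_hom[OF h'(1) ideals(2)] w by (simp add: scycles_iff)
      have v: "?v \<in> sc KB k" by (rule sc_closed(3)[OF ideals(2) hw])
      let ?z = "x \<odot>\<^bsub>?o\<^esub> u \<oplus>\<^bsub>?o\<^esub> ?v"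
      have zE: "?z \<in> sc KE k"
        using sc_closed(5)[OF ideals(3) x_sc[OF uA]] v sc_mono[OF KB_subset(1)] by blast
      have wc: "x \<odot>\<^bsub>obj P (k - 1)\<^esub> w \<in> carrier (obj P (k - 1))" using w sc_carrier xR by (auto simp: scycles_iff)
      have "bd P k ?z = x \<odot>\<^bsub>obj P (k - 1)\<^esub> w \<oplus>\<^bsub>obj P (k - 1)\<^esub> \<ominus>\<^bsub>obj P (k - 1)\<^esub> (x \<odot>\<^bsub>obj P (k - 1)\<^esub> w)"
        using bd_sum[OF sc_carrier[OF uA] sc_carrier[OF v]] u(2) module_pair.hom_neg[OF bd_pair bd_hom sc_carrier[OF hw]] h'(2) w
        by (simp add: scycles_def)
      then have "bd P k ?z = \<zero>\<^bsub>obj P (k - 1)\<^esub>" using wc by (simp add: M'.M.r_neg)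
      then have "?z \<in> scycles KE k" using zE by (simp add: scycles_iff)
      then show ?thesis using uA v u(2) by blast
    qed
    show "w \<in> sbounds KB (k - 1) \<longleftrightarrow> z \<in> D2" if r: "?\<rho> w z" for w z
    proof -
      obtain u v where uv: "u \<in> sc KA k" "v \<in> sc KB k" "z = x \<odot>\<^bsub>?o\<^esub> u \<oplus>\<^bsub>?o\<^esub> v" "w = bd P k u" using r by blast
      have zZ: "z \<in> scycles KE k" using r by blast
      note c = sc_carrier[OF uv(1)] sc_carrier[OF uv(2)]
      show ?thesis
      proof
        assume "w \<in> sbounds KB (k - 1)"
        then obtain v0 where v0: "v0 \<in> sc KB k" "w = bd P k v0" by (auto simp: sbounds_def)
        have v0c: "v0 \<in> carrier ?o" by (rule sc_carrier[OF v0(1)])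
        \<comment> \<open>Moving \<open>v0\<close> from \<open>u\<close> to \<open>v\<close> makes
          the first part a cycle of \<open>KA P\<close>, and then the second one a cycle of
          \<open>KB P\<close>.\<close>
        let ?u = "u \<ominus>\<^bsub>?o\<^esub> v0" and ?v = "x \<odot>\<^bsub>?o\<^esub> v0 \<oplus>\<^bsub>?o\<^esub> v"
        have "v0 \<in> sc KA k" using v0(1) sc_mono[OF KB_subset(2)] by blast
        then have "?u \<in> sc KA k" by (rule sc_closed(2)[OF ideals(1) uv(1)])
        moreover have "bd P k ?u = \<zero>\<^bsub>obj P (k - 1)\<^esub>"
          using bd_minus[OF c(1) v0c] uv(4) v0(2) M'.minus_eq_zero_iff bd_closed[OF v0c] by simp
        ultimately have u: "?u \<in> scycles KA k" by (simp add: scycles_iff)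
        have z: "z = x \<odot>\<^bsub>?o\<^esub> ?u \<oplus>\<^bsub>?o\<^esub> ?v" unfolding uv(3) using c v0c xR by algebra
        have xu: "x \<odot>\<^bsub>?o\<^esub> ?u \<in> scycles KE k" by (rule xA[OF u])
        have "?v = z \<ominus>\<^bsub>?o\<^esub> x \<odot>\<^bsub>?o\<^esub> ?u" unfolding uv(3) using c v0c xR by algebra
        then have "?v \<in> scycles KE k" using M.submodule_closed(2)[OF ZE zZ xu] by simp
        moreover have "?v \<in> sc KB k" by (rule sc_closed(5)[OF ideals(2) sc_closed(4)[OF ideals(2) xR v0(1)] uv(2)])
        ultimately have "?v \<in> scycles KB k" by (simp add: scycles_iff)
        then show "z \<in> D2" unfolding z by (intro M.submodule_closed(5)[OF D2] AD2[OF u] BD2)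
      next
        assume "z \<in> D2"
        then obtain u0 v0 t where *: "u0 \<in> scycles KA k" "v0 \<in> scycles KB k" "t \<in> sc KE (k + 1)"
          "z = x \<odot>\<^bsub>?o\<^esub> u0 \<oplus>\<^bsub>?o\<^esub> (v0 \<oplus>\<^bsub>?o\<^esub> bd P (k + 1) t)"
          unfolding D2_def D1_def sbounds_def by blast
        have u0: "u0 \<in> sc KA k" "bd P k u0 = \<zero>\<^bsub>obj P (k - 1)\<^esub>" and v0: "v0 \<in> sc KB k"
          using *(1,2) by (auto simp: scycles_iff)
        have bt: "bd P (k + 1) t \<in> carrier ?o" using bd_closed[OF sc_carrier[OF *(3)]] by simp
        note c' = sc_carrier[OF u0(1)] sc_carrier[OF v0] bt
        \<comment> \<open>The difference of the two expressions for \<open>z\<close> has the form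
          treated by \<open>sum_is_bound\<close>, with \<open>u - u0\<close> as \<open>p\<close>;
          the corrected element lies in \<open>KB P\<close> and still has boundary
          \<open>w\<close>.\<close>
        have "x \<odot>\<^bsub>?o\<^esub> (u \<ominus>\<^bsub>?o\<^esub> u0) \<oplus>\<^bsub>?o\<^esub> (v \<ominus>\<^bsub>?o\<^esub> v0) = ((x \<odot>\<^bsub>?o\<^esub> u \<oplus>\<^bsub>?o\<^esub> v) \<ominus>\<^bsub>?o\<^esub> x \<odot>\<^bsub>?o\<^esub> u0) \<ominus>\<^bsub>?o\<^esub> v0"
          using c c' xR by algebra
        also have "\<dots> = bd P (k + 1) t" unfolding uv(3)[symmetric] *(4) using c' xR by algebra
        finally obtain u1 where "u1 \<in> sc KA (k + 1)" "(u \<ominus>\<^bsub>?o\<^esub> u0) \<ominus>\<^bsub>?o\<^esub> bd P (k + 1) u1 \<in> sc KB k"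
          "bd P k ((u \<ominus>\<^bsub>?o\<^esub> u0) \<ominus>\<^bsub>?o\<^esub> bd P (k + 1) u1) = bd P k (u \<ominus>\<^bsub>?o\<^esub> u0)"
          using c c' by (elim sum_is_bound[OF _ sc_closed(2)[OF ideals(2) uv(2) v0] *(3), rotated]) simp_all
        moreover have "w \<ominus>\<^bsub>obj P (k - 1)\<^esub> \<zero>\<^bsub>obj P (k - 1)\<^esub> = w" using bd_closed[OF c(1)] uv(4) by algebra
        then have "bd P k (u \<ominus>\<^bsub>?o\<^esub> u0) = w" using bd_minus[OF c(1) c'(1)] uv(4) u0(2) by simp
        ultimately show "w \<in> sbounds KB (k - 1)" by (intro sboundsI[of "(u \<ominus>\<^bsub>?o\<^esub> u0) \<ominus>\<^bsub>?o\<^esub> bd P (k + 1) u1"]) simp_all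
      qed
    qed
  qed
  then show ?thesis by (rule qfilt_trans[OF qfilt_trans[OF _ f2] f1])
qed

end

section \<open>Induction along the regular sequence\<close>

context resolution
begin

lemma pw_zero: "pw {\<zero>} (Suc n) = {\<zero>}"
  unfolding pw_Suc by (rule ideal_prod_zero[OF ideal_power_ideal[OF zeroideal]])

lemma step_snoc:
  assumes reg: "regular_sequence R (ys @ [y])" and sub: "set (ys @ [y]) \<subseteq> I"
    and zero: "\<And>k. scycles (pw (genideal R (set ys)) (Suc s)) k \<subseteq> sbounds (pw (genideal R (set ys)) s) k"
  shows "resolution_step R I P \<epsilon> \<sigma> (genideal R (set ys)) y (genideal R (set (ys @ [y]))) s"
proof (intro resolution_step.intro resolution_step_axioms.intro resolution_axioms zero)
  have "set ys \<subseteq> carrier R" "y \<in> carrier R" using sub ideal.Icarr[OF I] by auto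
  then show "adjoined (genideal R (set ys)) y (genideal R (set (ys @ [y])))" by (rule genideal_adjoined)
  show "y \<in> I" using sub by simp
  show "nzd_mod y (pw (genideal R (set ys)) (Suc s))" by (rule regular_sequence_nzd_pw[OF reg])
qed

text \<open>For the full sequence this says that the inclusion of
  \<open>I\<^sup>s\<^sup>+\<^sup>1\<close> in \<open>I\<^sup>s\<close> induces zero on Tor. The
  empty sequence starts the induction because the positive powers of its ideal are zero.\<close>

lemma regular_scycles_subset:
  assumes "regular_sequence R ys" "set ys \<subseteq> I"
  shows "scycles (pw (genideal R (set ys)) (Suc s)) k \<subseteq> sbounds (pw (genideal R (set ys)) s) k"
  using assms
proof (induct ys arbitrary: k rule: rev_induct)
  case Nil
  have "\<zero>\<^bsub>obj P k\<^esub> \<in> sbounds (pw {\<zero>} s) k"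
    by (rule module.submodule_zero[OF module_P sbounds_submodule[OF ideal_power_ideal[OF zeroideal]]])
  then show ?case by (simp add: genideal_empty pw_zero scycles_zero)
next
  case (snoc y ys)
  interpret resolution_step R I P \<epsilon> \<sigma> "genideal R (set ys)" y "genideal R (set (ys @ [y]))" s
    by (rule step_snoc[OF snoc(2,3)]) (use snoc in \<open>simp add: regular_sequence_snoc\<close>)
  show ?case using zero_step by blast
qed

interpretation A: subquotient R "ideal_module R (carrier R)" "carrier R" I
  by (rule subquotient_A)

text \<open>Exponent zero gives \<open>P\<close> itself, whose homology is \<open>R/I\<close> in
  degree 0 and zero elsewhere.\<close>

lemma qfilt_base: "qfilt R I (obj P k) (sbounds (carrier R) k) (scycles (carrier R) k)"
proof -
  interpret M: module R "obj P k" by (rule module_P)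
  have eq: "sbounds (carrier R) k = boundaries P k" "scycles (carrier R) k = cycles P k"
    by (auto simp: sbounds_def boundaries_def scycles_def split_module.scaled_all[OF split] cycles_iff)
  show ?thesis
  proof (cases "k = 0")
    case False
    have "cycles P k = boundaries P k"
    proof (cases "k > 0")
      case True then show ?thesis by (rule cycles_pos)
    next
      case neg: False
      then have "carrier (obj P k) = {\<zero>\<^bsub>obj P k\<^esub>}" using False obj_neg by simp
      then show ?thesis
        using module.submodule_zero[OF module_P boundaries_submodule[of k]] boundaries_subset[of k]
        by (auto simp: cycles_iff)
    qed
    then show ?thesis unfolding eq using qfilt_refl[OF boundaries_submodule] by simp
  next
    case True
    let ?o = "obj P 0" and ?c = "\<lambda>r. I +>\<^bsub>ideal_module R (carrier R)\<^esub> r"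
    interpret M0: module R ?o by (rule module_P)
    have e: "?c r = \<zero>\<^bsub>A\<^esub> \<longleftrightarrow> r \<in> I" if "r \<in> carrier R" for r
      using A.subquot_eq_zero_iff[OF that] by (simp add: A_eq A.subquot_zero)
    have "?c \<one> \<in> \<epsilon> ` carrier ?o" using \<epsilon>_surj A.subquot_class_closed[of \<one>] by (simp add: A_eq)
    \<comment> \<open>A preimage of 1 generates degree 0 modulo the boundaries, and
      \<open>r b\<close> is a boundary exactly when \<open>r\<close> lies in
      \<open>I\<close>.\<close>
    then obtain b where b: "b \<in> carrier ?o" "\<epsilon> b = ?c \<one>" by auto
    have rb: "\<epsilon> (r \<odot>\<^bsub>?o\<^esub> b) = ?c r" if r: "r \<in> carrier R" for r
      using A.subquot_smult[OF r, of \<one>] r b by (simp add: hom_smult[OF \<epsilon>_hom] A_eq)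
    have bnd: "p \<in> boundaries P 0 \<longleftrightarrow> p \<in> carrier ?o \<and> \<epsilon> p = \<zero>\<^bsub>A\<^esub>" for p
      unfolding ker_\<epsilon>[symmetric] by (simp add: a_kernel_def')
    interpret E: module_pair R ?o A
      using module_P A.module_subquot by (simp add: module_pair_def A_eq)
    have cyc: "p \<in> cycles P 0 \<longleftrightarrow> p \<in> carrier ?o" for p
      using bd_closed[of p 0] obj_neg[of "0 - 1"] by (auto simp: cycles_iff)
    have "\<exists>r\<in>carrier R. p \<ominus>\<^bsub>?o\<^esub> r \<odot>\<^bsub>?o\<^esub> b \<in> boundaries P 0" if p: "p \<in> carrier ?o" for p
    proof -
      obtain r where r: "r \<in> carrier R" "\<epsilon> p = ?c r"
        using hom_closed[OF \<epsilon>_hom p] by (auto simp: A_eq A.subquot_carrier)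
      have "\<epsilon> (p \<ominus>\<^bsub>?o\<^esub> r \<odot>\<^bsub>?o\<^esub> b) = \<zero>\<^bsub>A\<^esub>"
        using E.hom_minus[OF \<epsilon>_hom p, of "r \<odot>\<^bsub>?o\<^esub> b"] r b rb E.N.minus_eq_zero_iff hom_closed[OF \<epsilon>_hom p] by simp
      then show ?thesis using p b r by (intro bexI[of _ r]) (simp_all add: bnd)
    qed
    then have "qfilt R I ?o (boundaries P 0) (cycles P 0)"
      by (intro qfilt_step[OF qfilt_refl[OF boundaries_submodule] cycles_submodule boundaries_subset, of b])
        (use b rb e in \<open>simp_all add: bnd cyc\<close>)
    then show ?thesis using eq True by simp
  qed
qed

text \<open>Outer induction on the sequence, inner one on \<open>s\<close>:
  \<open>filtration_step\<close> takes the filtration for \<open>I'\<^sup>s\<close> from the inner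
  hypothesis and those for \<open>J\<^sup>s\<^sup>+\<^sup>1\<close> in degrees \<open>k\<close> and
  \<open>k - 1\<close> from the outer one, which is why both \<open>s\<close> and \<open>k\<close>
  are arbitrary.\<close>

lemma qfilt_regular:
  assumes "regular_sequence R ys" "set ys \<subseteq> I"
  shows "qfilt R I (obj P k) (sbounds (pw (genideal R (set ys)) s) k) (scycles (pw (genideal R (set ys)) s) k)"
  using assms
proof (induct ys arbitrary: s k rule: rev_induct)
  case Nil
  show ?case
  proof (cases s)
    case 0 show ?thesis unfolding 0 pw_0 by (rule qfilt_base)
  next
    case (Suc n)
    then show ?thesis using qfilt_refl[OF module.zero_submodule[OF module_P]]
      by (simp add: genideal_empty pw_zero scycles_zero sbounds_zero)
  qed
next
  case (snoc y ys)
  have reg: "regular_sequence R ys" "set ys \<subseteq> I" using snoc(2,3) by (simp_all add: regular_sequence_snoc)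
  show ?case
  proof (induct s arbitrary: k)
    case 0 show ?case unfolding pw_0 by (rule qfilt_base)
  next
    case (Suc s)
    interpret resolution_step R I P \<epsilon> \<sigma> "genideal R (set ys)" y "genideal R (set (ys @ [y]))" s
      by (rule step_snoc[OF snoc(2,3) regular_scycles_subset[OF reg]])
    show ?case by (rule filtration_step[OF Suc snoc(1)[OF reg] snoc(1)[OF reg]])
  qed
qed

section \<open>Tor of powers of the ideal\<close>

lemma complex_tensor:
  assumes L: "module R L"
  shows "complex R (tensor_complex R P L)"
proof (rule complex.intro)
  interpret T: tensor_product R "obj P k" L for k by (simp add: tensor_product_def module_pair_def L module_P)
  note tm = tensor_map_hom[OF module_P L module_P L bd_hom id_hom]
  show "module R (obj (tensor_complex R P L) k)" for k by (simp add: tensor_complex_def T.module_tensor)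
  show "bd (tensor_complex R P L) k \<in> module_homs R (obj (tensor_complex R P L) k) (obj (tensor_complex R P L) (k - 1))" for k
    by (simp add: tensor_complex_def tm(1))
  show "bd (tensor_complex R P L) (k - 1) (bd (tensor_complex R P L) k t) = \<zero>\<^bsub>obj (tensor_complex R P L) (k - 1 - 1)\<^esub>"
    if "t \<in> carrier (obj (tensor_complex R P L) k)" for k t
  proof -
    have z: "(\<lambda>_. \<zero>\<^bsub>tensor R (obj P (k - 1 - 1)) L\<^esub>) \<in> module_homs R (tensor R (obj P k) L) (tensor R (obj P (k - 1 - 1)) L)"
      by (rule zero_hom[OF T.module_tensor])
    have "pure_tensor R (obj P (k - 1 - 1)) L \<zero>\<^bsub>obj P (k - 1 - 1)\<^esub> l = \<zero>\<^bsub>tensor R (obj P (k - 1 - 1)) L\<^esub>"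
      if "l \<in> carrier L" for l
      by (rule module_pair.hom_zero[OF _ T.pure_hom_left[OF that]]) (simp add: module_pair_def module_P T.module_tensor)
    then have "tensor_map R (obj P (k - 1 - 1)) L (bd P (k - 1)) (\<lambda>y. y)
      (tensor_map R (obj P (k - 1)) L (bd P k) (\<lambda>y. y) (pure_tensor R (obj P k) L p l)) = \<zero>\<^bsub>tensor R (obj P (k - 1 - 1)) L\<^esub>"
      if "p \<in> carrier (obj P k)" "l \<in> carrier L" for p l
      unfolding tm(2)[OF that] tm(2)[OF bd_closed[OF that(1)] that(2)] bd_bd[OF that(1)] using that(2) by blast
    from T.tensor_hom_eq[OF T.module_tensor hom_comp[OF tm(1) tm(1)] z this, where X = t]
    show ?thesis using that by (simp add: tensor_complex_def)
  qed
qed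

lemma chain_map_tensor:
  assumes L: "module R L" and N: "module R N" and f: "f \<in> module_homs R L N"
  shows "chain_map R (tensor_complex R P L) (tensor_complex R P N) (\<lambda>k. tensor_map R (obj P k) N (\<lambda>x. x) f)"
proof (intro chain_map.intro complex_tensor L N chain_map_axioms.intro)
  interpret T: tensor_product R "obj P k" L for k by (simp add: tensor_product_def module_pair_def L module_P)
  interpret T': tensor_product R "obj P k" N for k by (simp add: tensor_product_def module_pair_def N module_P)
  note bL = tensor_map_hom[OF module_P L module_P L bd_hom id_hom] and bN = tensor_map_hom[OF module_P N module_P N bd_hom id_hom]
    and tf = tensor_map_hom[OF module_P L module_P N id_hom f]
  fix k
  show "tensor_map R (obj P k) N (\<lambda>x. x) f \<in> module_homs R (obj (tensor_complex R P L) k) (obj (tensor_complex R P N) k)"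
    by (simp add: tensor_complex_def tf(1))
  fix t assume t: "t \<in> carrier (obj (tensor_complex R P L) k)"
  then show "bd (tensor_complex R P N) k (tensor_map R (obj P k) N (\<lambda>x. x) f t) =
    tensor_map R (obj P (k - 1)) N (\<lambda>x. x) f (bd (tensor_complex R P L) k t)"
    using T.tensor_hom_eq[OF T'.module_tensor hom_comp[OF tf(1) bN(1)] hom_comp[OF bL(1) tf(1)], where X = t]
    by (simp add: tensor_complex_def tf(2) bN(2) bL(2) bd_closed hom_closed[OF f])
qed

lemma short_exact_complexes_tensor:
  assumes ex: "short_exact R L N C f g"
  shows "short_exact_complexes R (tensor_complex R P L) (tensor_complex R P N) (tensor_complex R P C)
    (\<lambda>k. tensor_map R (obj P k) N (\<lambda>x. x) f) (\<lambda>k. tensor_map R (obj P k) C (\<lambda>x. x) g)"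
proof -
  have "module R L" "module R N" "module R C" "f \<in> module_homs R L N" "g \<in> module_homs R N C"
    using ex by (auto simp: short_exact_def)
  then show ?thesis
    using split_module.short_exact_tensor[OF split ex]
    by (intro short_exact_complexes.intro short_exact_complexes_axioms.intro chain_map_tensor)
      (simp_all add: tensor_complex_def)
qed

section \<open>Identification of \<open>P \<otimes> K\<close> with \<open>K P\<close>\<close>

abbreviation "mm k \<equiv> split_module.mult_map R (obj P k)"
abbreviation "TK K \<equiv> tensor_complex R P (ideal_module R K)"

context
  fixes K assumes K: "ideal K R"
begin

interpretation T: complex R "TK K"
  by (rule complex_tensor[OF module_ideal_module[OF is_cring K]])

lemma TK_obj: "obj (TK K) k = tensor R (obj P k) (ideal_module R K)"
  by (simp add: tensor_complex_def)

lemma mult_hom: "mm k \<in> module_homs R (obj (TK K) k) (obj P k)"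
  unfolding TK_obj by (rule split_module.mult_map_hom[OF split K])

lemma mult_pair: "module_pair R (obj (TK K) k) (obj P k)"
  by (simp add: module_pair_def T.obj_module module_P)

lemma mult_inj:
  assumes t: "t \<in> carrier (obj (TK K) k)" "t' \<in> carrier (obj (TK K) k)" and eq: "mm k t = mm k t'"
  shows "t = t'"
proof -
  interpret module_pair R "obj (TK K) k" "obj P k" by (rule mult_pair)
  have "mm k (t \<ominus>\<^bsub>obj (TK K) k\<^esub> t') = \<zero>\<^bsub>obj P k\<^esub>"
    using t eq hom_minus[OF mult_hom] N.minus_eq_zero_iff hom_closed[OF mult_hom] by simp
  then have "t \<ominus>\<^bsub>obj (TK K) k\<^esub> t' = \<zero>\<^bsub>obj (TK K) k\<^esub>"
    using split_module.mult_map_zero[OF split K, of "t \<ominus>\<^bsub>obj (TK K) k\<^esub> t'" k] t unfolding TK_obj[symmetric] by simp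
  then show ?thesis using t M.minus_eq_zero_iff by simp
qed

lemma mult_image: "p \<in> sc K k \<longleftrightarrow> (\<exists>t\<in>carrier (obj (TK K) k). p = mm k t)"
  using split_module.mult_map_image[OF split K, of k] unfolding TK_obj[symmetric] by (auto simp: image_iff)

lemma mult_bd:
  assumes t: "t \<in> carrier (obj (TK K) k)"
  shows "bd P k (mm k t) = mm (k - 1) (bd (TK K) k t)"
proof -
  interpret tensor_product R "obj P k" "ideal_module R K"
    by (simp add: tensor_product_def module_pair_def module_P module_ideal_module[OF is_cring K])
  note b = tensor_map_hom[OF module_P module_ideal_module[OF is_cring K] module_P module_ideal_module[OF is_cring K] bd_hom[of k] id_hom]
  show ?thesis
    using tensor_hom_eq[OF module_P hom_comp[OF mult_hom[unfolded TK_obj] bd_hom] hom_comp[OF b(1) mult_hom[unfolded TK_obj]], where X = t] t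
    by (simp add: tensor_complex_def b(2) split_module.mult_map_pure[OF split K] bd_closed bd_smult ideal.Icarr[OF K])
qed

lemma mult_scycles:
  assumes t: "t \<in> carrier (obj (TK K) k)"
  shows "mm k t \<in> scycles K k \<longleftrightarrow> t \<in> cycles (TK K) k"
proof -
  have z: "\<zero>\<^bsub>obj (TK K) (k - 1)\<^esub> \<in> carrier (obj (TK K) (k - 1))"
    by (rule module.submodule_zero[OF T.obj_module module.carrier_is_submodule[OF T.obj_module]])
  have m0: "mm (k - 1) \<zero>\<^bsub>obj (TK K) (k - 1)\<^esub> = \<zero>\<^bsub>obj P (k - 1)\<^esub>" by (rule module_pair.hom_zero[OF mult_pair mult_hom])
  have "bd P k (mm k t) = \<zero>\<^bsub>obj P (k - 1)\<^esub> \<longleftrightarrow> bd (TK K) k t = \<zero>\<^bsub>obj (TK K) (k - 1)\<^esub>"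
    unfolding mult_bd[OF t] m0[symmetric] using mult_inj[OF T.bd_closed[OF t] z] by (rule iffI) simp_all
  moreover have "mm k t \<in> sc K k" using t by (auto simp: mult_image)
  ultimately show ?thesis using t unfolding scycles_iff T.cycles_iff by simp
qed

lemma mult_sbounds:
  assumes t: "t \<in> carrier (obj (TK K) k)"
  shows "mm k t \<in> sbounds K k \<longleftrightarrow> t \<in> boundaries (TK K) k"
proof
  assume "mm k t \<in> sbounds K k"
  then obtain y where y: "y \<in> carrier (obj (TK K) (k + 1))" "mm k t = bd P (k + 1) (mm (k + 1) y)"
    by (auto simp: sbounds_def mult_image)
  then have "t = bd (TK K) (k + 1) y" using mult_inj[OF t] mult_bd[OF y(1)] T.bd_closed[OF y(1)] by simp
  then show "t \<in> boundaries (TK K) k" using y by (auto simp: T.boundaries_iff)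
next
  assume "t \<in> boundaries (TK K) k"
  then obtain y where y: "y \<in> carrier (obj (TK K) (k + 1))" "t = bd (TK K) (k + 1) y" by (auto simp: T.boundaries_iff)
  then have "mm k t = bd P (k + 1) (mm (k + 1) y)" using mult_bd[OF y(1)] by simp
  moreover have "mm (k + 1) y \<in> sc K (k + 1)" using y by (auto simp: mult_image)
  ultimately show "mm k t \<in> sbounds K k" by (rule sboundsI[rotated])
qed

lemma Tor_killed: "killed_by I (Tor R P (ideal_module R K) k)"
  unfolding killed_by_def Tor_def
proof (intro ballI)
  fix x u assume x: "x \<in> I" and "u \<in> carrier (homology (TK K) k)"
  then obtain t where t: "t \<in> cycles (TK K) k" "u = boundaries (TK K) k +>\<^bsub>obj (TK K) k\<^esub> t"
    by (auto simp: T.homology_carrier)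
  have xR: "x \<in> carrier R" using x ideal.Icarr[OF I] by blast
  have tc: "t \<in> carrier (obj (TK K) k)" using t by (simp add: T.cycles_iff)
  have xt: "x \<odot>\<^bsub>obj (TK K) k\<^esub> t \<in> cycles (TK K) k"
    by (rule module.submodule_closed(4)[OF T.obj_module T.cycles_submodule xR t(1)])
  have "mm k t \<in> scycles K k" using t(1) mult_scycles[OF tc] by simp
  then have "mm k (x \<odot>\<^bsub>obj (TK K) k\<^esub> t) \<in> sbounds K k"
    using scycles_killed[OF K x] hom_smult[OF mult_hom xR tc] by simp
  then have "x \<odot>\<^bsub>obj (TK K) k\<^esub> t \<in> boundaries (TK K) k" using mult_sbounds xt by (simp add: T.cycles_iff)
  then show "x \<odot>\<^bsub>homology (TK K) k\<^esub> u = \<zero>\<^bsub>homology (TK K) k\<^esub>"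
    using t xR xt by (simp add: T.homology_smult T.homology_zero T.homology_eq_zero_iff)
qed

text \<open>The relation in the proof is the isomorphism, induced by the multiplication map, between
  \<open>scycles K k\<close> modulo \<open>sbounds K k\<close> and Tor.\<close>

lemma qfilt_Tor:
  assumes filt: "qfilt R I (obj P k) (sbounds K k) (scycles K k)"
  shows "qfilt R I (Tor R P (ideal_module R K) k) {\<zero>\<^bsub>Tor R P (ideal_module R K) k\<^esub>} (carrier (Tor R P (ideal_module R K) k))"
proof -
  interpret H: module R "homology (TK K) k" by (rule T.module_homology)
  interpret Q: subquotient R "obj (TK K) k" "cycles (TK K) k" "boundaries (TK K) k" by (rule T.subquotient)
  let ?\<rho> = "\<lambda>z u. \<exists>t\<in>cycles (TK K) k. z = mm k t \<and> u = boundaries (TK K) k +>\<^bsub>obj (TK K) k\<^esub> t"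
  note c = Q.submodule_carrier[OF Q.Z]
  show ?thesis
    unfolding Tor_def
  proof (rule qfilt_transport[OF module_P T.module_homology filt H.zero_submodule, where \<rho> = ?\<rho>])
    show "z \<in> scycles K k \<and> u \<in> carrier (homology (TK K) k)" if "?\<rho> z u" for z u
      using that mult_scycles c by (auto simp: T.homology_carrier)
    show "?\<rho> (z \<oplus>\<^bsub>obj P k\<^esub> z') (u \<oplus>\<^bsub>homology (TK K) k\<^esub> u')" if r: "?\<rho> z u" "?\<rho> z' u'" for z u z' u'
    proof -
      obtain t t' where t: "t \<in> cycles (TK K) k" "z = mm k t" "u = boundaries (TK K) k +>\<^bsub>obj (TK K) k\<^esub> t"
        "t' \<in> cycles (TK K) k" "z' = mm k t'" "u' = boundaries (TK K) k +>\<^bsub>obj (TK K) k\<^esub> t'" using r by blast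
      show ?thesis
        by (rule bexI[OF _ Q.submodule_closed(5)[OF Q.Z t(1,4)]])
          (simp add: t T.homology_add hom_add[OF mult_hom c[OF t(1)] c[OF t(4)]])
    qed
    show "?\<rho> (a \<odot>\<^bsub>obj P k\<^esub> z) (a \<odot>\<^bsub>homology (TK K) k\<^esub> u)" if a: "a \<in> carrier R" and r: "?\<rho> z u" for a z u
    proof -
      obtain t where t: "t \<in> cycles (TK K) k" "z = mm k t" "u = boundaries (TK K) k +>\<^bsub>obj (TK K) k\<^esub> t" using r by blast
      show ?thesis
        by (rule bexI[OF _ Q.submodule_closed(4)[OF Q.Z a t(1)]])
          (simp add: t a T.homology_smult hom_smult[OF mult_hom a c[OF t(1)]])
    qed
    show "\<exists>u. ?\<rho> z u" if z: "z \<in> scycles K k" for z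
    proof -
      obtain t where t: "t \<in> carrier (obj (TK K) k)" "z = mm k t" using z by (auto simp: scycles_iff mult_image)
      then show ?thesis using z mult_scycles[OF t(1)] by blast
    qed
    show "\<exists>z. ?\<rho> z u" if "u \<in> carrier (homology (TK K) k)" for u
      using that by (auto simp: T.homology_carrier)
    show "z \<in> sbounds K k \<longleftrightarrow> u \<in> {\<zero>\<^bsub>homology (TK K) k\<^esub>}" if r: "?\<rho> z u" for z u
    proof -
      obtain t where t: "t \<in> cycles (TK K) k" "z = mm k t" "u = boundaries (TK K) k +>\<^bsub>obj (TK K) k\<^esub> t" using r by blast
      show ?thesis unfolding t(2,3) using mult_sbounds[OF c[OF t(1)]] by (simp add: T.homology_zero T.homology_eq_zero_iff t(1))
    qed
  qed auto
qed

end

text \<open>After multiplication into \<open>P\<close>, the map induced by an inclusion of ideals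
  becomes the inclusion of subcomplexes. This turns a statement about \<open>P\<close> into the
  vanishing required by \<open>short_exact_homology\<close>.\<close>

lemma inclusion_boundaries:
  assumes K: "ideal K R" and K': "ideal K' R" and KK: "K \<subseteq> K'" and sub: "scycles K k \<subseteq> sbounds K' k"
    and t: "t \<in> cycles (TK K) k"
  shows "tensor_map R (obj P k) (ideal_module R K') (\<lambda>x. x) (\<lambda>x. x) t \<in> boundaries (TK K') k"
proof -
  let ?f = "tensor_map R (obj P k) (ideal_module R K') (\<lambda>x. x) (\<lambda>x. x)"
  interpret T: complex R "TK K" by (rule complex_tensor[OF module_ideal_module[OF is_cring K]])
  interpret tensor_product R "obj P k" "ideal_module R K"
    by (simp add: tensor_product_def module_pair_def module_P module_ideal_module[OF is_cring K])
  have i: "(\<lambda>y. y) \<in> module_homs R (ideal_module R K) (ideal_module R K')"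
    using KK by (auto intro!: module_homsI)
  note f = tensor_map_hom[OF module_P module_ideal_module[OF is_cring K] module_P module_ideal_module[OF is_cring K'] id_hom i]
  have tc: "t \<in> carrier (obj (TK K) k)" using t by (simp add: T.cycles_iff)
  have "mm k (?f t) = mm k t"
    using tensor_hom_eq[OF module_P hom_comp[OF f(1) mult_hom[OF K', unfolded TK_obj[OF K']]] mult_hom[OF K, unfolded TK_obj[OF K]], where X = t]
      tc KK by (simp add: tensor_complex_def f(2) split_module.mult_map_pure[OF split K] split_module.mult_map_pure[OF split K'] subset_iff)
  moreover have "mm k t \<in> scycles K k" using mult_scycles[OF K tc] t by simp
  ultimately have "mm k (?f t) \<in> sbounds K' k" using sub by auto
  then show ?thesis using mult_sbounds[OF K', of "?f t" k] hom_closed[OF f(1)] tc by (simp add: tensor_complex_def)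
qed

text \<open>A scalar acts on a pure tensor through its second factor, so \<open>I\<close> already
  kills the complex \<open>P \<otimes> L\<close>. This serves the graded piece.\<close>

lemma Tor_killed_of_killed:
  assumes L: "module R L" and k: "killed_by I L"
  shows "killed_by I (Tor R P L k)"
  unfolding killed_by_def Tor_def
proof (intro ballI)
  interpret T: complex R "tensor_complex R P L" by (rule complex_tensor[OF L])
  interpret P: tensor_product R "obj P k" L by (simp add: tensor_product_def module_pair_def L module_P)
  interpret PT: module R "tensor R (obj P k) L" by (rule P.module_tensor)
  fix x u assume x: "x \<in> I" and "u \<in> carrier (homology (tensor_complex R P L) k)"
  then obtain t where t: "t \<in> cycles (tensor_complex R P L) k"
    "u = boundaries (tensor_complex R P L) k +>\<^bsub>obj (tensor_complex R P L) k\<^esub> t"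
    by (auto simp: T.homology_carrier)
  have xR: "x \<in> carrier R" using x ideal.Icarr[OF I] by blast
  have x_hom: "(\<lambda>t. x \<odot>\<^bsub>tensor R (obj P k) L\<^esub> t) \<in> module_homs R (tensor R (obj P k) L) (tensor R (obj P k) L)"
    by (rule module_homsI) (auto simp: xR PT.smult_r_distr PT.smult_lcomm)
  have z_hom: "(\<lambda>t. \<zero>\<^bsub>tensor R (obj P k) L\<^esub>) \<in> module_homs R (tensor R (obj P k) L) (tensor R (obj P k) L)"
    by (rule module_homsI) auto
  have "x \<odot>\<^bsub>tensor R (obj P k) L\<^esub> t = \<zero>\<^bsub>tensor R (obj P k) L\<^esub>"
  proof (rule P.tensor_hom_eq[OF P.module_tensor x_hom z_hom])
    fix p l assume p: "p \<in> carrier (obj P k)" and l: "l \<in> carrier L"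
    have "x \<odot>\<^bsub>tensor R (obj P k) L\<^esub> P.pt p l = P.pt p (x \<odot>\<^bsub>L\<^esub> l)" using hom_smult[OF P.pure_hom_right[OF p] xR l] by simp
    also have "x \<odot>\<^bsub>L\<^esub> l = \<zero>\<^bsub>L\<^esub>" using k x l by (simp add: killed_by_def)
    also have "P.pt p \<zero>\<^bsub>L\<^esub> = \<zero>\<^bsub>tensor R (obj P k) L\<^esub>"
      by (rule module_pair.hom_zero[OF _ P.pure_hom_right[OF p]]) (simp add: module_pair_def L P.module_tensor)
    finally show "x \<odot>\<^bsub>tensor R (obj P k) L\<^esub> P.pt p l = \<zero>\<^bsub>tensor R (obj P k) L\<^esub>" .
  qed (use t in \<open>simp add: T.cycles_iff\<close>, simp add: tensor_complex_def)
  then show "x \<odot>\<^bsub>homology (tensor_complex R P L) k\<^esub> u = \<zero>\<^bsub>homology (tensor_complex R P L) k\<^esub>"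
    using t xR module.rcos_zero[OF T.obj_module T.boundaries_submodule, of k]
    by (simp add: T.homology_smult T.homology_zero) (simp add: tensor_complex_def)
qed

lemma graded_piece_killed: "killed_by I (graded_piece R I n)"
  unfolding killed_by_def
proof (intro ballI)
  note ex = short_exact_ideal_powers[OF is_cring I, of n]
  fix x y assume x: "x \<in> I" "y \<in> carrier (graded_piece R I n)"
  have "graded_proj R I n ` pw I n = carrier (graded_piece R I n)"
    using ex by (simp add: short_exact_def power_module_def)
  with x(2) obtain a where a: "a \<in> pw I n" "y = graded_proj R I n a" by blast
  have xR: "x \<in> carrier R" using x(1) ideal.Icarr[OF I] by blast
  \<comment> \<open>Multiplication by an element of \<open>I\<close> raises the power by one, so the
    product falls into the kernel of the projection.\<close>
  have "x \<otimes> a \<in> a_kernel (power_module R I n) (graded_piece R I n) (graded_proj R I n)"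
    using pw_mult[OF I x(1) a(1)] ex by (auto simp: short_exact_def power_module_def)
  moreover have "graded_proj R I n (x \<otimes> a) = x \<odot>\<^bsub>graded_piece R I n\<^esub> y"
    using ex a xR hom_smult[of "graded_proj R I n" R "power_module R I n" "graded_piece R I n" x a]
    by (simp add: short_exact_def power_module_def)
  ultimately show "x \<odot>\<^bsub>graded_piece R I n\<^esub> y = \<zero>\<^bsub>graded_piece R I n\<^esub>" by (simp add: a_kernel_def')
qed

end

theorem theorem1:
  fixes R :: "('a, 'm) ring_scheme"
    and xs :: "'a list" and I :: "'a set" and s :: nat
    and P :: "('a, 'p) chain_complex" and \<epsilon> :: "'p \<Rightarrow> 'a set"
  assumes "cring R"
    and "regular_sequence R xs"
    and "I = genideal R (set xs)"
    and "projective_resolution R (quot_module (ideal_module R (carrier R)) I) P \<epsilon>"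
  shows "\<forall>k::int.
     free_over_quot R I (Tor R P (power_module R I s) k) \<and>
     free_over_quot R I (Tor R P (graded_piece R I s) k) \<and>
     free_over_quot R I (Tor R P (power_module R I (Suc s)) (k - 1)) \<and>
     short_exact (R Quot I)
       (quot_scalars (Tor R P (power_module R I s) k))
       (quot_scalars (Tor R P (graded_piece R I s) k))
       (quot_scalars (Tor R P (power_module R I (Suc s)) (k - 1)))
       (Tor_map R P (graded_piece R I s) (graded_proj R I s) k)
       (Tor_connecting R P
          (power_module R I (Suc s)) (power_module R I s) (graded_piece R I s)
          (\<lambda>x. x) (graded_proj R I s) k)"
proof
  fix k
  interpret cring R by (rule assms(1))
  have xs: "set xs \<subseteq> carrier R" using assms(2) by (simp add: regular_sequence_def)
  have I: "ideal I R" and xsI: "set xs \<subseteq> I" unfolding assms(3) using genideal_ideal[OF xs] genideal_self[OF xs] by auto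
  have "projective_module R (obj P l)" for l using assms(4) by (simp add: projective_resolution_def)
  then have "\<exists>\<tau>. split_module R (obj P l) \<tau>" for l
    unfolding projective_module_def split_module_def split_module_axioms_def by blast
  then obtain \<sigma> where \<sigma>: "\<And>l. split_module R (obj P l) (\<sigma> l)" by metis
  interpret resolution R I P \<epsilon> \<sigma>
    by (intro resolution.intro resolution_axioms.intro assms(1,4) I \<sigma>)
  note pw = ideal_power_ideal[OF I]
  have ex: "short_exact R (power_module R I (Suc s)) (power_module R I s) (graded_piece R I s) (\<lambda>x. x) (graded_proj R I s)"
    by (rule short_exact_ideal_powers[OF assms(1) I])
  interpret E: short_exact_complexes R "tensor_complex R P (power_module R I (Suc s))"
    "tensor_complex R P (power_module R I s)" "tensor_complex R P (graded_piece R I s)"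
    "\<lambda>k. tensor_map R (obj P k) (power_module R I s) (\<lambda>x. x) (\<lambda>x. x)"
    "\<lambda>k. tensor_map R (obj P k) (graded_piece R I s) (\<lambda>x. x) (graded_proj R I s)"
    by (rule short_exact_complexes_tensor[OF ex])
  \<comment> \<open>The vanishing hypothesis of \<open>short_exact_homology\<close> is
    \<open>regular_scycles_subset\<close> for the full sequence, moved to Tor by
    \<open>inclusion_boundaries\<close>.\<close>
  have ses: "short_exact R (Tor R P (power_module R I s) k) (Tor R P (graded_piece R I s) k) (Tor R P (power_module R I (Suc s)) (k - 1))
      (Tor_map R P (graded_piece R I s) (graded_proj R I s) k)
      (Tor_connecting R P (power_module R I (Suc s)) (power_module R I s) (graded_piece R I s) (\<lambda>x. x) (graded_proj R I s) k)"
    unfolding Tor_def Tor_map_def Tor_connecting_def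
    by (rule E.short_exact_homology)
      (use inclusion_boundaries[OF pw pw ideal_power_Suc_subset[OF I]] regular_scycles_subset[OF assms(2) xsI, folded assms(3)]
        in \<open>auto simp: power_module_def\<close>)
  have killed: "killed_by I (Tor R P (power_module R I n) l)" for n l
    unfolding power_module_def by (rule Tor_killed[OF pw])
  have filt: "qfilt R I (Tor R P (power_module R I n) l) {\<zero>\<^bsub>Tor R P (power_module R I n) l\<^esub>} (carrier (Tor R P (power_module R I n) l))" for n l
    unfolding power_module_def by (rule qfilt_Tor[OF pw qfilt_regular[OF assms(2) xsI, folded assms(3)]])
  \<comment> \<open>\<open>Tor_killed\<close> covers ideals only; the graded piece is itself killed
    by \<open>I\<close>, and its filtration comes from the two outer terms.\<close>
  have killed': "killed_by I (Tor R P (graded_piece R I s) k)"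
    by (rule Tor_killed_of_killed[OF _ graded_piece_killed]) (use ex in \<open>simp add: short_exact_def\<close>)
  have mods: "module R (Tor R P (power_module R I s) k)" "module R (Tor R P (graded_piece R I s) k)"
    "module R (Tor R P (power_module R I (Suc s)) (k - 1))"
    using ses by (simp_all add: short_exact_def)
  show "free_over_quot R I (Tor R P (power_module R I s) k) \<and>
     free_over_quot R I (Tor R P (graded_piece R I s) k) \<and>
     free_over_quot R I (Tor R P (power_module R I (Suc s)) (k - 1)) \<and>
     short_exact (R Quot I)
       (quot_scalars (Tor R P (power_module R I s) k))
       (quot_scalars (Tor R P (graded_piece R I s) k))
       (quot_scalars (Tor R P (power_module R I (Suc s)) (k - 1)))
       (Tor_map R P (graded_piece R I s) (graded_proj R I s) k)
       (Tor_connecting R P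
          (power_module R I (Suc s)) (power_module R I s) (graded_piece R I s)
          (\<lambda>x. x) (graded_proj R I s) k)"
    by (intro conjI short_exact_quot_scalars[OF I ses killed killed' killed]
        module.qfilt_imp_free_over_quot[OF mods(1) I killed filt]
        module.qfilt_imp_free_over_quot[OF mods(2) I killed' qfilt_short_exact[OF ses filt filt]]
        module.qfilt_imp_free_over_quot[OF mods(3) I killed filt])
qed

end
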